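(* Let $\vartheta\in(0,1)$, $\eta>0$, and let $\{u_n\}_{n\ge0}$ be a weakly stationary mean-zero $I(0)$ time series with $\{u_n^2\}$ weakly stationary and $\operatorname{Cov}(u_1^2,u_{1+k}^2)\to0$ as $|k|\to\infty$. Assume the $I(1)$-to-$I(0)$ change-point model $$Y_i=\begin{cases}\sum_{j=0}^iu_j,& i=0,\dots,\lfloor N\vartheta\rfloor-1,\\ \eta u_i,& i=\lfloor N\vartheta\rfloor,\dots,N.\end{cases}$$ Let $\kappa\in(0,1)$. Then $$U_N(s)\Rightarrow\mathcal{U}_{10,\vartheta}(s)=\frac{s^{-1}\zeta\int_0^s\left(\int_0^{\min(r,\vartheta)}B(t)\,dt\right)^2K(\zeta(r-s))\,dr}{\int_0^{\min(s,\vartheta)}B(t)^2\,dt}$$ in $D[\kappa,1]$ as $N\to\infty$. Consequently, for the stopping time $R_N=\min\{k\le n\le N:U_N(n/N)<c\}$ with $k=\lfloor\kappa N\rfloor$ and control limit $c$, $$N^{-1}R_N\stackrel{d}{\to}\inf\{\kappa\le s\le1:\ \mathcal{U}_{10,\vartheta}(s)<c\},\qquad N\to\infty.$$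
   Context: $B$ denotes standard Brownian motion on $[0,1]$; $\Rightarrow$ denotes weak convergence in the space of right-continuous functions with left-hand limits on the indicated interval, equipped with the Skorohod topology; $\stackrel{d}{\to}$ is convergence in distribution; $\lfloor x\rfloor$ is the floor function. A series $\{u_n\}$ is called $I(0)$ if $N^{-1/2}\sum_{i=1}^{\lfloor Ns\rfloor}u_i\Rightarrow\sigma B(s)$, $s\in[0,1]$, in $D[0,1]$ as $N\to\infty$, for some constant $0<\sigma<\infty$. Kernel and bandwidth: $K:\mathbb{R}\to[0,\infty)$ is a Lipschitz continuous probability density, symmetric around $0$, with mean $0$ and finite variance; $h=h_N>0$ is a sequence of bandwidths with $N/h_N\to\zeta\in[1,\infty)$ as $N\to\infty$; $K_h(x)=K(x/h)/h$. The process $U_N$ is $U_N(s)=0$ for $s\in[0,1/N)$ and $$U_N(s)=\frac{\lfloor Ns\rfloor^{-3}\sum_{i=1}^{\lfloor Ns\rfloor}\left(\sum_{j=1}^i Y_j\right)^2K_h(i-\lfloor Ns\rfloor)}{\lfloor Ns\rfloor^{-2}\sum_{j=1}^{\lfloor Ns\rfloor}Y_j^2},\qquad s\in[1/N,1].$$ Conventions: if no $n$ in the defining set of $R_N$ exists, $R_N=N$; correspondingly the infimum in the limit is $1$ if the set is empty. *)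

theory Defs
  imports "HOL-Probability.Probability"
begin

section \<open>The Skorohod space\<close>

text \<open>Elements of \<open>D[a,b]\<close> are represented by extensional functions, so that equality in
  the carrier is equality on \<open>[a,b]\<close>.\<close>

definition skorohod_space :: "real \<Rightarrow> real \<Rightarrow> (real \<Rightarrow> real) set" where
  "skorohod_space a b = {f \<in> extensional {a..b}.
     (\<forall>t\<in>{a..<b}. (f \<longlongrightarrow> f t) (at_right t)) \<and>
     (\<forall>t\<in>{a<..b}. \<exists>l. (f \<longlongrightarrow> l) (at_left t))}"

definition time_changes :: "real \<Rightarrow> real \<Rightarrow> (real \<Rightarrow> real) set" where
  "time_changes a b = {\<rho>. strict_mono_on {a..b} \<rho> \<and> continuous_on {a..b} \<rho> \<and> \<rho> ` {a..b} = {a..b}}"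

definition skorohod_close :: "real \<Rightarrow> real \<Rightarrow> (real \<Rightarrow> real) \<Rightarrow> (real \<Rightarrow> real) \<Rightarrow> real \<Rightarrow> bool" where
  "skorohod_close a b f g e \<longleftrightarrow> 0 < e \<and>
     (\<exists>\<rho>\<in>time_changes a b. \<forall>t\<in>{a..b}. \<bar>\<rho> t - t\<bar> \<le> e \<and> \<bar>f t - g (\<rho> t)\<bar> \<le> e)"

text \<open>The value 0 outside the carrier is only there because the library's
  \<^locale>\<open>Metric_space\<close> demands symmetry and nonnegativity of a total function.\<close>

definition skorohod_dist :: "real \<Rightarrow> real \<Rightarrow> (real \<Rightarrow> real) \<Rightarrow> (real \<Rightarrow> real) \<Rightarrow> real" where
  "skorohod_dist a b f g =
     (if f \<in> skorohod_space a b \<and> g \<in> skorohod_space a b then Inf {e. skorohod_close a b f g e} else 0)"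

definition skorohod_topology :: "real \<Rightarrow> real \<Rightarrow> (real \<Rightarrow> real) topology" where
  "skorohod_topology a b = Metric_space.mtopology (skorohod_space a b) (skorohod_dist a b)"

lemma skorohod_space_bounded:
  assumes f: "f \<in> skorohod_space a b"
  shows "\<exists>C. \<forall>t\<in>{a..b}. \<bar>f t\<bar> \<le> C"
proof -
  have loc: "\<exists>d>0. \<exists>C. \<forall>x\<in>{a..b}. \<bar>x - t\<bar> < d \<longrightarrow> \<bar>f x\<bar> \<le> C" if t: "t \<in> {a..b}" for t
  proof -
    have R: "\<exists>y>t. \<exists>C. \<forall>x. t < x \<and> x < y \<and> x \<le> b \<longrightarrow> \<bar>f x\<bar> \<le> C"
    proof (cases "t < b")
      case True
      then have "(f \<longlongrightarrow> f t) (at_right t)" using f t by (auto simp: skorohod_space_def)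
      then have "\<forall>\<^sub>F x in at_right t. dist (f x) (f t) < 1" by (rule tendstoD) simp
      then obtain y where y: "y > t" "\<And>x. t < x \<Longrightarrow> x < y \<Longrightarrow> \<bar>f x - f t\<bar> < 1"
        unfolding eventually_at_right_field dist_real_def by blast
      have "\<bar>f x\<bar> \<le> \<bar>f t\<bar> + 1" if "t < x" "x < y" for x using y(2)[OF that] by linarith
      then show ?thesis using y(1) by blast
    next
      case False
      then show ?thesis using t by (intro exI[of _ "t+1"]) auto
    qed
    have L: "\<exists>z<t. \<exists>C. \<forall>x. z < x \<and> x < t \<and> a \<le> x \<longrightarrow> \<bar>f x\<bar> \<le> C"
    proof (cases "a < t")
      case True
      then have "t \<in> {a<..b}" using t by simp
      then obtain l where "(f \<longlongrightarrow> l) (at_left t)" using f unfolding skorohod_space_def by blast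
      then have "\<forall>\<^sub>F x in at_left t. dist (f x) l < 1" by (rule tendstoD) simp
      then obtain y where y: "y < t" "\<And>x. y < x \<Longrightarrow> x < t \<Longrightarrow> \<bar>f x - l\<bar> < 1"
        unfolding eventually_at_left_field dist_real_def by blast
      have "\<bar>f x\<bar> \<le> \<bar>l\<bar> + 1" if "y < x" "x < t" for x using y(2)[OF that] by linarith
      then show ?thesis using y(1) by blast
    next
      case False
      then show ?thesis using t by (intro exI[of _ "t-1"]) auto
    qed
    from R L obtain y C z C' where
      yz: "z < t" "t < y" and C: "\<And>x. t < x \<Longrightarrow> x < y \<Longrightarrow> x \<le> b \<Longrightarrow> \<bar>f x\<bar> \<le> C"
      and C': "\<And>x. z < x \<Longrightarrow> x < t \<Longrightarrow> a \<le> x \<Longrightarrow> \<bar>f x\<bar> \<le> C'" by metis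
    have "\<bar>f x\<bar> \<le> max \<bar>f t\<bar> (max C C')"
      if x: "x \<in> {a..b}" "\<bar>x - t\<bar> < min (y - t) (t - z)" for x
    proof -
      consider "x = t" | "t < x" | "x < t" by linarith
      then show ?thesis
      proof cases
        case 2 then have "\<bar>f x\<bar> \<le> C" using x by (intro C) auto
        then show ?thesis by simp
      next
        case 3 then have "\<bar>f x\<bar> \<le> C'" using x by (intro C') auto
        then show ?thesis by simp
      qed simp
    qed
    moreover have "min (y - t) (t - z) > 0" using yz by simp
    ultimately show ?thesis by blast
  qed
  then obtain d C where d: "\<And>t. t \<in> {a..b} \<Longrightarrow> d t > 0"
    and C: "\<And>t x. t \<in> {a..b} \<Longrightarrow> x \<in> {a..b} \<Longrightarrow> \<bar>x - t\<bar> < d t \<Longrightarrow> \<bar>f x\<bar> \<le> C t" by metis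
  have "{a..b} \<subseteq> (\<Union>t\<in>{a..b}. ball t (d t))" using d by force
  then obtain T where T: "T \<subseteq> {a..b}" "finite T" "{a..b} \<subseteq> (\<Union>t\<in>T. ball t (d t))"
    by (rule compactE_image[OF compact_Icc _ , rotated]) auto
  have "\<bar>f x\<bar> \<le> (\<Sum>t\<in>T. \<bar>C t\<bar>)" if x: "x \<in> {a..b}" for x
  proof -
    obtain t where t: "t \<in> T" "x \<in> ball t (d t)" using T x by blast
    then have "\<bar>f x\<bar> \<le> C t" using C[of t x] T x by (auto simp: dist_real_def abs_minus_commute)
    also have "\<dots> \<le> \<bar>C t\<bar>" by simp
    also have "\<dots> \<le> (\<Sum>t\<in>T. \<bar>C t\<bar>)" using t T by (intro member_le_sum) auto
    finally show ?thesis .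
  qed
  then show ?thesis by blast
qed

lemma time_changes_id: "(\<lambda>t. t) \<in> time_changes a b"
  by (auto simp: time_changes_def strict_mono_on_def)

lemma time_changes_inv:
  assumes l: "l \<in> time_changes a b"
  shows "the_inv_into {a..b} l \<in> time_changes a b"
    and "t \<in> {a..b} \<Longrightarrow> l (the_inv_into {a..b} l t) = t"
    and "t \<in> {a..b} \<Longrightarrow> the_inv_into {a..b} l t \<in> {a..b}"
proof -
  have sm: "strict_mono_on {a..b} l" and c: "continuous_on {a..b} l" and im: "l ` {a..b} = {a..b}"
    using l by (auto simp: time_changes_def)
  have inj: "inj_on l {a..b}" using sm by (rule strict_mono_on_imp_inj_on)
  show 1: "t \<in> {a..b} \<Longrightarrow> l (the_inv_into {a..b} l t) = t" for t
    using f_the_inv_into_f[OF inj] im by blast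
  show 2: "t \<in> {a..b} \<Longrightarrow> the_inv_into {a..b} l t \<in> {a..b}" for t
    using the_inv_into_into[OF inj, of t] im by blast
  have "strict_mono_on {a..b} (the_inv_into {a..b} l)"
  proof (rule strict_mono_onI)
    fix r s assume rs: "r \<in> {a..b}" "s \<in> {a..b}" "r < s"
    show "the_inv_into {a..b} l r < the_inv_into {a..b} l s"
    proof (rule ccontr)
      assume "\<not> ?thesis"
      then have "the_inv_into {a..b} l s \<le> the_inv_into {a..b} l r" by simp
      then have "l (the_inv_into {a..b} l s) \<le> l (the_inv_into {a..b} l r)"
        using strict_mono_on_leD[OF sm 2[OF rs(2)] 2[OF rs(1)]] by blast
      then show False using 1 rs by simp
    qed
  qed
  moreover have "continuous_on {a..b} (the_inv_into {a..b} l)"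
    using continuous_on_inv_into[OF c compact_Icc inj] im by simp
  moreover have "the_inv_into {a..b} l ` {a..b} = {a..b}"
    using the_inv_into_onto[OF inj] im by simp
  ultimately show "the_inv_into {a..b} l \<in> time_changes a b" by (simp add: time_changes_def)
qed

lemma time_changes_comp:
  assumes "l \<in> time_changes a b" "m \<in> time_changes a b"
  shows "(\<lambda>t. m (l t)) \<in> time_changes a b"
proof -
  have "continuous_on {a..b} (\<lambda>t. m (l t))"
    using assms continuous_on_compose2[of "{a..b}" m "{a..b}" l] by (auto simp: time_changes_def)
  moreover have "strict_mono_on {a..b} (\<lambda>t. m (l t))"
    using assms unfolding time_changes_def strict_mono_on_def by blast
  moreover have "(\<lambda>t. m (l t)) ` {a..b} = {a..b}"
  proof -
    have "(\<lambda>t. m (l t)) ` {a..b} = m ` l ` {a..b}" by (simp only: image_image)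
    then show ?thesis using assms by (simp add: time_changes_def)
  qed
  ultimately show ?thesis by (simp add: time_changes_def)
qed

lemma time_changes_endpoint:
  assumes "l \<in> time_changes a b" "a \<le> b" shows "l b = b"
proof -
  have sm: "strict_mono_on {a..b} l" and im: "l ` {a..b} = {a..b}"
    using assms by (auto simp: time_changes_def)
  obtain s where s: "s \<in> {a..b}" "l s = b" using im assms(2) by (metis atLeastAtMost_iff image_iff order_refl)
  have "l s \<le> l b" using strict_mono_on_leD[OF sm s(1)] s assms(2) by auto
  moreover have "l b \<in> {a..b}" using im assms(2) by auto
  ultimately show ?thesis using s by auto
qed

lemma skorohod_close_commute:
  assumes "skorohod_close a b f g e" shows "skorohod_close a b g f e"
proof -
  obtain l where e: "0 < e" and l: "l \<in> time_changes a b"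
    and *: "\<And>t. t \<in> {a..b} \<Longrightarrow> \<bar>l t - t\<bar> \<le> e \<and> \<bar>f t - g (l t)\<bar> \<le> e"
    using assms by (auto simp: skorohod_close_def)
  define m where "m = the_inv_into {a..b} l"
  have "\<bar>m t - t\<bar> \<le> e \<and> \<bar>g t - f (m t)\<bar> \<le> e" if "t \<in> {a..b}" for t
    using *[of "m t"] time_changes_inv(2,3)[OF l that] unfolding m_def by (simp add: abs_minus_commute)
  moreover have "m \<in> time_changes a b" using time_changes_inv(1)[OF l] by (simp add: m_def)
  ultimately show ?thesis using e unfolding skorohod_close_def by blast
qed

lemma skorohod_close_trans:
  assumes "skorohod_close a b f g e" "skorohod_close a b g k e'"
  shows "skorohod_close a b f k (e + e')"
proof -
  obtain l where e: "0 < e" and l: "l \<in> time_changes a b"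
    and *: "\<And>t. t \<in> {a..b} \<Longrightarrow> \<bar>l t - t\<bar> \<le> e \<and> \<bar>f t - g (l t)\<bar> \<le> e"
    using assms by (auto simp: skorohod_close_def)
  obtain m where e': "0 < e'" and m: "m \<in> time_changes a b"
    and **: "\<And>t. t \<in> {a..b} \<Longrightarrow> \<bar>m t - t\<bar> \<le> e' \<and> \<bar>g t - k (m t)\<bar> \<le> e'"
    using assms by (auto simp: skorohod_close_def)
  have "\<bar>m (l t) - t\<bar> \<le> e + e' \<and> \<bar>f t - k (m (l t))\<bar> \<le> e + e'" if t: "t \<in> {a..b}" for t
  proof -
    have "l t \<in> {a..b}" using l t unfolding time_changes_def by blast
    then show ?thesis using *[OF t] **[of "l t"] by linarith
  qed
  then show ?thesis using add_pos_pos[OF e e'] time_changes_comp[OF l m] unfolding skorohod_close_def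
    by (intro conjI bexI[of _ "\<lambda>t. m (l t)"] ballI) blast+
qed

lemma skorohod_close_ex:
  assumes "f \<in> skorohod_space a b" "g \<in> skorohod_space a b"
  shows "\<exists>e. skorohod_close a b f g e"
proof -
  obtain C C' where C: "\<forall>t\<in>{a..b}. \<bar>f t\<bar> \<le> C" "\<forall>t\<in>{a..b}. \<bar>g t\<bar> \<le> C'"
    using assms skorohod_space_bounded by meson
  have "\<bar>t - t\<bar> \<le> \<bar>C\<bar> + \<bar>C'\<bar> + 1 \<and> \<bar>f t - g t\<bar> \<le> \<bar>C\<bar> + \<bar>C'\<bar> + 1" if "t \<in> {a..b}" for t
  proof -
    have "\<bar>f t\<bar> \<le> C" "\<bar>g t\<bar> \<le> C'" using C that by auto
    then show ?thesis by linarith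
  qed
  then have "skorohod_close a b f g (\<bar>C\<bar> + \<bar>C'\<bar> + 1)"
    unfolding skorohod_close_def
    by (intro conjI bexI[of _ "\<lambda>t. t"] ballI time_changes_id) auto
  then show ?thesis ..
qed

lemma skorohod_close_all_eq:
  assumes f: "f \<in> skorohod_space a b" and g: "g \<in> skorohod_space a b"
    and close: "\<And>e. 0 < e \<Longrightarrow> \<exists>e'<e. skorohod_close a b f g e'"
  shows "f = g"
proof (rule extensionalityI[of _ "{a..b}"])
  fix t assume t: "t \<in> {a..b}"
  have "\<bar>f t - g t\<bar> \<le> 3 * e" if e: "0 < e" for e
  proof (cases "t = b")
    case True
    obtain e' l where "e' < e" "l \<in> time_changes a b"
      "\<And>t. t \<in> {a..b} \<Longrightarrow> \<bar>l t - t\<bar> \<le> e' \<and> \<bar>f t - g (l t)\<bar> \<le> e'"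
      using close[OF e] unfolding skorohod_close_def by blast
    then show ?thesis using time_changes_endpoint[of l a b] t True e by fastforce
  next
    case False
    then have tb: "t \<in> {a..<b}" using t by auto
    have "(f \<longlongrightarrow> f t) (at_right t)" "(g \<longlongrightarrow> g t) (at_right t)"
      using f g tb by (auto simp: skorohod_space_def)
    then have "\<forall>\<^sub>F x in at_right t. dist (f x) (f t) < e" "\<forall>\<^sub>F x in at_right t. dist (g x) (g t) < e"
      using e by (auto dest: tendstoD)
    then have "\<forall>\<^sub>F x in at_right t. dist (f x) (f t) < e \<and> dist (g x) (g t) < e" by (rule eventually_conj)
    then obtain y where y: "y > t" "\<And>x. t < x \<Longrightarrow> x < y \<Longrightarrow> \<bar>f x - f t\<bar> < e \<and> \<bar>g x - g t\<bar> < e"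
      unfolding eventually_at_right_field dist_real_def by blast
    define z where "z = min y b"
    define x where "x = (t + z) / 2"
    have z: "t < z" "z \<le> y" "z \<le> b" using y tb by (auto simp: z_def)
    have x: "t < x" "x < z" "x \<in> {a..b}" using z t by (auto simp: x_def)
    obtain e' l where l: "e' < min e ((z - t) / 2)"
      "\<And>t. t \<in> {a..b} \<Longrightarrow> \<bar>l t - t\<bar> \<le> e' \<and> \<bar>f t - g (l t)\<bar> \<le> e'"
      using close[of "min e ((z - t) / 2)"] e z unfolding skorohod_close_def by fastforce
    have lx: "\<bar>l x - x\<bar> < (z - t) / 2" "\<bar>f x - g (l x)\<bar> < e" using l(1) l(2)[OF x(3)] by auto
    then have "t < l x" "l x < z" by (auto simp: x_def abs_if field_simps split: if_splits)
    then have "\<bar>g (l x) - g t\<bar> < e" using y z by auto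
    moreover have "\<bar>f x - f t\<bar> < e" using y(2)[of x] x z by auto
    ultimately show ?thesis using lx by linarith
  qed
  from this[of "\<bar>f t - g t\<bar> / 4"] show "f t = g t" by (cases "f t = g t") auto
qed (use f g in \<open>auto simp: skorohod_space_def\<close>)

lemma Metric_space_skorohod: "Metric_space (skorohod_space a b) (skorohod_dist a b)"
proof
  let ?S = "\<lambda>f g. {e. skorohod_close a b f g e}"
  have bdd: "bdd_below (?S f g)" for f g
    by (rule bdd_belowI[of _ 0]) (auto simp: skorohod_close_def)
  have ne: "?S f g \<noteq> {}" if "f \<in> skorohod_space a b" "g \<in> skorohod_space a b" for f g
    using skorohod_close_ex[OF that] by blast
  show nn: "0 \<le> skorohod_dist a b f g" for f g
  proof (cases "f \<in> skorohod_space a b \<and> g \<in> skorohod_space a b")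
    case True
    then have "0 \<le> Inf (?S f g)"
      by (intro cInf_greatest ne) (auto simp: skorohod_close_def)
    then show ?thesis using True by (simp add: skorohod_dist_def)
  qed (auto simp: skorohod_dist_def)
  show "skorohod_dist a b f g = skorohod_dist a b g f" for f g
  proof -
    have "?S f g = ?S g f" by (auto dest: skorohod_close_commute)
    then show ?thesis by (auto simp: skorohod_dist_def)
  qed
  show "(skorohod_dist a b f g = 0) = (f = g)"
    if f: "f \<in> skorohod_space a b" and g: "g \<in> skorohod_space a b" for f g
  proof
    assume "skorohod_dist a b f g = 0"
    then have "Inf (?S f g) = 0" using f g by (simp add: skorohod_dist_def)
    then have "\<exists>e'<e. skorohod_close a b f g e'" if "0 < e" for e
      using cInf_lessD[OF ne[OF f g], of e] that by auto
    then show "f = g" by (rule skorohod_close_all_eq[OF f g])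
  next
    assume "f = g"
    have "skorohod_dist a b f f \<le> e" if "0 < e" for e
    proof -
      have "skorohod_close a b f f e" unfolding skorohod_close_def
        using that by (intro conjI bexI[of _ "\<lambda>t. t"] ballI time_changes_id) auto
      then show ?thesis using f bdd by (auto simp: skorohod_dist_def intro: cInf_lower)
    qed
    then have "skorohod_dist a b f f \<le> 0" by (meson dense not_le)
    then show "skorohod_dist a b f g = 0" using nn[of f f] \<open>f = g\<close> by simp
  qed
  show "skorohod_dist a b f k \<le> skorohod_dist a b f g + skorohod_dist a b g k"
    if f: "f \<in> skorohod_space a b" and g: "g \<in> skorohod_space a b" and k: "k \<in> skorohod_space a b"
    for f g k
  proof -
    have "Inf (?S f k) - e \<le> Inf (?S g k)" if e: "skorohod_close a b f g e" for e
    proof (rule cInf_greatest[OF ne[OF g k]])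
      fix e' assume "e' \<in> ?S g k"
      then have "e + e' \<in> ?S f k" using skorohod_close_trans[OF e] by simp
      from cInf_lower[OF this bdd] show "Inf (?S f k) - e \<le> e'" by simp
    qed
    then have "Inf (?S f k) - Inf (?S g k) \<le> e" if "e \<in> ?S f g" for e using that by force
    then have "Inf (?S f k) - Inf (?S g k) \<le> Inf (?S f g)" by (rule cInf_greatest[OF ne[OF f g]])
    then show ?thesis using f g k by (simp add: skorohod_dist_def)
  qed
qed


section \<open>Convergence in distribution\<close>

definition borel_of_topology :: "'x topology \<Rightarrow> 'x measure" where
  "borel_of_topology T = sigma (topspace T) {U. openin T U}"

text \<open>Random elements are restricted to \<open>[a,b]\<close> and are required to be measurable with respect to
  the Borel \<open>\<sigma>\<close>-algebra of the Skorohod topology. The random elements of the sequence and of the limit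
  may live on different probability spaces.\<close>

definition weak_conv_D ::
  "real \<Rightarrow> real \<Rightarrow> 'a measure \<Rightarrow> (nat \<Rightarrow> 'a \<Rightarrow> real \<Rightarrow> real) \<Rightarrow> 'b measure \<Rightarrow> ('b \<Rightarrow> real \<Rightarrow> real) \<Rightarrow> bool"
where
  "weak_conv_D a b M X M' Z \<longleftrightarrow>
     (\<forall>N. (\<lambda>\<omega>. restrict (X N \<omega>) {a..b}) \<in> M \<rightarrow>\<^sub>M borel_of_topology (skorohod_topology a b)) \<and>
     (\<lambda>\<omega>. restrict (Z \<omega>) {a..b}) \<in> M' \<rightarrow>\<^sub>M borel_of_topology (skorohod_topology a b) \<and>
     (\<forall>\<phi>. continuous_map (skorohod_topology a b) euclideanreal \<phi> \<and>
          bounded (\<phi> ` skorohod_space a b) \<longrightarrow>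
          (\<lambda>N. \<integral>\<omega>. \<phi> (restrict (X N \<omega>) {a..b}) \<partial>M) \<longlonglongrightarrow> (\<integral>\<omega>. \<phi> (restrict (Z \<omega>) {a..b}) \<partial>M'))"

definition conv_in_dist ::
  "'a measure \<Rightarrow> (nat \<Rightarrow> 'a \<Rightarrow> real) \<Rightarrow> 'b measure \<Rightarrow> ('b \<Rightarrow> real) \<Rightarrow> bool"
where
  "conv_in_dist M X M' Z \<longleftrightarrow>
     (\<forall>N. X N \<in> borel_measurable M) \<and> Z \<in> borel_measurable M' \<and>
     weak_conv_m (\<lambda>N. distr M borel (X N)) (distr M' borel Z)"


section \<open>Brownian motion and stationary time series\<close>

definition standard_brownian_motion :: "'b measure \<Rightarrow> ('b \<Rightarrow> real \<Rightarrow> real) \<Rightarrow> bool" where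
  "standard_brownian_motion M B \<longleftrightarrow>
     prob_space M \<and>
     (\<forall>t\<in>{0..1}. (\<lambda>\<omega>. B \<omega> t) \<in> borel_measurable M) \<and>
     (\<forall>\<omega>\<in>space M. continuous_on {0..1} (B \<omega>)) \<and>
     (AE \<omega> in M. B \<omega> 0 = 0) \<and>
     (\<forall>s t. 0 \<le> s \<and> s < t \<and> t \<le> 1 \<longrightarrow>
        distributed M lborel (\<lambda>\<omega>. B \<omega> t - B \<omega> s) (normal_density 0 (sqrt (t - s)))) \<and>
     (\<forall>n. \<forall>\<tau> :: nat \<Rightarrow> real. (\<forall>i\<le>n. \<tau> i \<in> {0..1}) \<and> (\<forall>i<n. \<tau> i \<le> \<tau> (Suc i)) \<longrightarrow>
        prob_space.indep_vars M (\<lambda>_. borel) (\<lambda>i \<omega>. B \<omega> (\<tau> (Suc i)) - B \<omega> (\<tau> i)) {..<n})"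

definition covariance :: "'a measure \<Rightarrow> ('a \<Rightarrow> real) \<Rightarrow> ('a \<Rightarrow> real) \<Rightarrow> real" where
  "covariance M X Y =
     (\<integral>\<omega>. (X \<omega> - (\<integral>\<omega>'. X \<omega>' \<partial>M)) * (Y \<omega> - (\<integral>\<omega>'. Y \<omega>' \<partial>M)) \<partial>M)"

definition weakly_stationary :: "'a measure \<Rightarrow> (nat \<Rightarrow> 'a \<Rightarrow> real) \<Rightarrow> bool" where
  "weakly_stationary M u \<longleftrightarrow>
     (\<forall>n. u n \<in> borel_measurable M \<and> integrable M (\<lambda>\<omega>. (u n \<omega>)\<^sup>2)) \<and>
     (\<forall>n. (\<integral>\<omega>. u n \<omega> \<partial>M) = (\<integral>\<omega>. u 0 \<omega> \<partial>M)) \<and>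
     (\<forall>n k. covariance M (u n) (u (n + k)) = covariance M (u 0) (u k))"

text \<open>The Brownian motion \<open>B\<close> is a parameter; the notion does not depend on its choice because all
  standard Brownian motions have the same law.\<close>

definition I0_series ::
  "'b measure \<Rightarrow> ('b \<Rightarrow> real \<Rightarrow> real) \<Rightarrow> 'a measure \<Rightarrow> (nat \<Rightarrow> 'a \<Rightarrow> real) \<Rightarrow> bool"
where
  "I0_series M' B M u \<longleftrightarrow>
     (\<exists>\<sigma>>0. weak_conv_D 0 1
        M (\<lambda>N \<omega> s. (\<Sum>i = 1..nat \<lfloor>real N * s\<rfloor>. u i \<omega>) / sqrt (real N))
        M' (\<lambda>\<omega> s. \<sigma> * B \<omega> s))"


section \<open>The monitoring process\<close>

definition admissible_kernel :: "(real \<Rightarrow> real) \<Rightarrow> bool" where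
  "admissible_kernel K \<longleftrightarrow>
     (\<forall>x. 0 \<le> K x) \<and> (\<exists>L. L-lipschitz_on UNIV K) \<and>
     integrable lborel K \<and> (\<integral>x. K x \<partial>lborel) = 1 \<and>
     (\<forall>x. K (- x) = K x) \<and>
     integrable lborel (\<lambda>x. x * K x) \<and> (\<integral>x. x * K x \<partial>lborel) = 0 \<and>
     integrable lborel (\<lambda>x. x\<^sup>2 * K x)"

definition scaled_kernel :: "(real \<Rightarrow> real) \<Rightarrow> real \<Rightarrow> real \<Rightarrow> real" where
  "scaled_kernel K h x = K (x / h) / h"

definition change_point_series ::
  "real \<Rightarrow> real \<Rightarrow> (nat \<Rightarrow> 'a \<Rightarrow> real) \<Rightarrow> nat \<Rightarrow> nat \<Rightarrow> 'a \<Rightarrow> real"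
where
  "change_point_series \<theta> \<eta> u N i \<omega> =
     (if i < nat \<lfloor>real N * \<theta>\<rfloor> then \<Sum>j = 0..i. u j \<omega> else \<eta> * u i \<omega>)"

text \<open>The argument \<open>y\<close> is the realized trajectory of the observations.\<close>

definition U_process :: "(real \<Rightarrow> real) \<Rightarrow> real \<Rightarrow> nat \<Rightarrow> (nat \<Rightarrow> real) \<Rightarrow> real \<Rightarrow> real" where
  "U_process K h N y s =
     (if s < 1 / real N then 0
      else let n = nat \<lfloor>real N * s\<rfloor> in
        ((\<Sum>i = 1..n. (\<Sum>j = 1..i. y j)\<^sup>2 * scaled_kernel K h (real i - real n)) / real n ^ 3) /
        ((\<Sum>j = 1..n. (y j)\<^sup>2) / real n ^ 2))"

definition U_limit :: "(real \<Rightarrow> real) \<Rightarrow> real \<Rightarrow> real \<Rightarrow> (real \<Rightarrow> real) \<Rightarrow> real \<Rightarrow> real" where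
  "U_limit K \<zeta> \<theta> \<beta> s =
     (\<zeta> / s * integral {0..s} (\<lambda>r. (integral {0..min r \<theta>} \<beta>)\<^sup>2 * K (\<zeta> * (r - s)))) /
     integral {0..min s \<theta>} (\<lambda>t. (\<beta> t)\<^sup>2)"

definition monitor_time :: "nat \<Rightarrow> nat \<Rightarrow> real \<Rightarrow> (real \<Rightarrow> real) \<Rightarrow> nat" where
  "monitor_time k N c v =
     (if \<exists>n\<in>{k..N}. v (real n / real N) < c
      then Min {n\<in>{k..N}. v (real n / real N) < c} else N)"

definition first_passage :: "real \<Rightarrow> real \<Rightarrow> (real \<Rightarrow> real) \<Rightarrow> real" where
  "first_passage \<kappa> c v =
     (if \<exists>s\<in>{\<kappa>..1}. v s < c then Inf {s\<in>{\<kappa>..1}. v s < c} else 1)"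

end

theory Submission
  imports Defs
begin

text \<open>
  The \<open>N\<close>-th monitoring process is a functional of the rescaled partial sums \<open>S\<^sub>N\<close>, up to a
  remainder that vanishes in \<open>L\<^sup>1\<close>. Whenever \<open>S\<^sub>N\<close> is close to a continuous path \<open>x\<close> with positive
  denominator, \<open>U\<^sub>N\<close> is uniformly close to the limit functional at \<open>x\<close>, so weak convergence follows
  from an extended continuous mapping theorem. The scale \<open>\<sigma>\<close> cancels in the ratio.

  The stopping times converge as well, because the limit almost surely does not touch the level \<open>c\<close>
  before crossing it. For \<open>c > 0\<close> one has to exclude that the minimum over \<open>[\<kappa>,q]\<close> of
  numerator minus \<open>c\<close> times denominator, a family of quadratic forms in \<open>B\<close>, is zero. Along a narrow
  hat function \<open>\<phi>\<close> all these quadratic forms are strictly concave, hence so is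
  their minimum, and \<open>B + t \<phi>\<close> can hit the value zero for at most two \<open>t\<close>. The laws of the
  \<open>B + t \<phi>\<close> have controlled mutual densities (Cameron--Martin), so the event is null.
  For \<open>c \<le> 0\<close> nothing is ever detected.
\<close>

section \<open>Measurability in the Skorohod space\<close>

text \<open>The obstacle is that the first passage time is discontinuous at paths that touch the
  level without going below it. It is not necessary to know the law of the minimum of the barrier;
  it suffices that 0 is not one of its atoms. Two choices keep the probability elementary. Skorohod
  closeness to a continuous path is uniform closeness, so the estimates are in the supremum norm.
  The direction of the shift is piecewise linear with kinks on every grid in use, so its
  Cameron--Martin density depends on the Brownian path through three values only and is the same for
  all these grids. A shift formula for finitely many independent normal increments is then enough,
  and no stochastic integral has to be constructed. The remainder collects \<open>u 0\<close>, which
  enters the observations before the change but not the partial sums from index 1, and the squares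
  of the series, which bound the part of the denominator after the change.\<close>

lemma lipschitz_continuous_map_mtopology:
  fixes f :: "'x \<Rightarrow> real"
  assumes "Metric_space S d"
    and lip: "\<And>x y. x \<in> S \<Longrightarrow> y \<in> S \<Longrightarrow> f x - f y \<le> L * d x y"
  shows "continuous_map (Metric_space.mtopology S d) euclideanreal f"
proof -
  interpret Metric_space S d by fact
  have "\<exists>\<delta>>0. \<forall>y. y \<in> S \<and> d x y < \<delta> \<longrightarrow> dist (f x) (f y) < e" if "x \<in> S" "0 < e" for x e
  proof (intro exI[of _ "e / (\<bar>L\<bar> + 1)"] conjI allI impI)
    fix y assume y: "y \<in> S \<and> d x y < e / (\<bar>L\<bar> + 1)"
    have "\<bar>f x - f y\<bar> \<le> \<bar>L\<bar> * d x y"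
    proof -
      have "L * d x y \<le> \<bar>L\<bar> * d x y" by (intro mult_right_mono) auto
      then show ?thesis using lip[of x y] lip[of y x] y that commute[of x y] by auto
    qed
    also have "\<dots> \<le> (\<bar>L\<bar> + 1) * d x y" by (intro mult_right_mono) auto
    also have "\<dots> < e" using y by (simp add: field_simps)
    finally show "dist (f x) (f y) < e" by (simp add: dist_real_def)
  qed (use that in auto)
  then show ?thesis
    using metric_continuous_map[OF Met_TC.Metric_space_axioms, of f] by simp
qed

lemma topspace_skorohod [simp]: "topspace (skorohod_topology a b) = skorohod_space a b"
proof -
  interpret Metric_space "skorohod_space a b" "skorohod_dist a b" by (rule Metric_space_skorohod)
  show ?thesis by (simp add: skorohod_topology_def)
qed

lemma space_borel_of_topology [simp]: "space (borel_of_topology T) = topspace T"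
  unfolding borel_of_topology_def by (rule space_measure_of) (auto dest: openin_subset)

lemma sets_borel_of_topology_openI: "openin T U \<Longrightarrow> U \<in> sets (borel_of_topology T)"
  unfolding borel_of_topology_def
  by (subst sets_measure_of) (auto dest: openin_subset)

lemma measurable_borel_of_topologyI:
  assumes "\<And>x. x \<in> space M \<Longrightarrow> f x \<in> topspace T"
    and "\<And>U. openin T U \<Longrightarrow> f -` U \<inter> space M \<in> sets M"
  shows "f \<in> M \<rightarrow>\<^sub>M borel_of_topology T"
  unfolding borel_of_topology_def
  by (rule measurable_sigma_sets[OF sets_measure_of])
     (use assms in \<open>auto dest: openin_subset simp: space_measure_of_conv\<close>)

lemma continuous_map_measurable:
  assumes "continuous_map T euclideanreal f"
  shows "f \<in> borel_measurable (borel_of_topology T)"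
proof (rule borel_measurableI)
  fix S :: "real set" assume "open S"
  then have "openin T {x \<in> topspace T. f x \<in> S}"
    using assms unfolding continuous_map_def by (metis open_openin)
  moreover have "f -` S \<inter> space (borel_of_topology T) = {x \<in> topspace T. f x \<in> S}" by auto
  ultimately show "f -` S \<inter> space (borel_of_topology T) \<in> sets (borel_of_topology T)"
    by (simp add: sets_borel_of_topology_openI)
qed

section \<open>Skorohod distance versus uniform distance\<close>

lemma skorohod_dist_le:
  assumes f: "f \<in> skorohod_space a b" and g: "g \<in> skorohod_space a b"
    and "0 < e" and "\<And>t. t \<in> {a..b} \<Longrightarrow> \<bar>f t - g t\<bar> \<le> e"
  shows "skorohod_dist a b f g \<le> e"
proof -
  have "skorohod_close a b f g e" unfolding skorohod_close_def
    using assms by (intro conjI bexI[of _ "\<lambda>t. t"] ballI time_changes_id) auto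
  moreover have "bdd_below {e. skorohod_close a b f g e}"
    by (rule bdd_belowI[of _ 0]) (auto simp: skorohod_close_def)
  ultimately show ?thesis using f g by (auto simp: skorohod_dist_def intro: cInf_lower)
qed

text \<open>A time change moves each point only a little, and a uniformly continuous
  \<open>g\<close> then changes only a little. This removes time changes from all later
  estimates.\<close>

lemma skorohod_dist_less_imp_uniform:
  assumes g: "g \<in> skorohod_space a b" and cont: "continuous_on {a..b} g" and e: "0 < e"
  obtains \<delta> where "0 < \<delta>"
    and "\<And>f t. f \<in> skorohod_space a b \<Longrightarrow> skorohod_dist a b f g < \<delta> \<Longrightarrow> t \<in> {a..b} \<Longrightarrow> \<bar>f t - g t\<bar> < e"
proof -
  have "uniformly_continuous_on {a..b} g" by (rule compact_uniformly_continuous[OF cont compact_Icc])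
  then obtain d where d: "d > 0" "\<And>x y. x \<in> {a..b} \<Longrightarrow> y \<in> {a..b} \<Longrightarrow> dist x y < d \<Longrightarrow> dist (g x) (g y) < e/2"
    unfolding uniformly_continuous_on_def using e by (metis dist_commute half_gt_zero)
  show ?thesis
  proof (rule that[of "min d (e/2)"])
    show "0 < min d (e/2)" using d e by simp
    fix f t assume f: "f \<in> skorohod_space a b" and fg: "skorohod_dist a b f g < min d (e/2)"
      and t: "t \<in> {a..b}"
    have "{e. skorohod_close a b f g e} \<noteq> {}" using skorohod_close_ex[OF f g] by blast
    then obtain e' where e': "skorohod_close a b f g e'" "e' < min d (e/2)"
      using cInf_lessD[of "{e. skorohod_close a b f g e}" "min d (e/2)"] fg f g by (auto simp: skorohod_dist_def)
    then obtain \<rho> where r: "\<rho> \<in> time_changes a b" "\<bar>\<rho> t - t\<bar> \<le> e'" "\<bar>f t - g (\<rho> t)\<bar> \<le> e'"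
      unfolding skorohod_close_def using t by blast
    have "\<rho> t \<in> {a..b}" using r(1) t unfolding time_changes_def by blast
    then have "dist (g (\<rho> t)) (g t) < e/2" using r e' t by (intro d(2)) (auto simp: dist_real_def)
    then show "\<bar>f t - g t\<bar> < e" using r(3) e' unfolding dist_real_def by linarith
  qed
qed

section \<open>Continuous paths and step paths as random elements\<close>

lemma continuous_in_skorohod_space:
  assumes "continuous_on {a..b} f"
  shows "restrict f {a..b} \<in> skorohod_space a b"
proof -
  have R: "((restrict f {a..b}) \<longlongrightarrow> restrict f {a..b} t) (at_right t)" if "t \<in> {a..<b}" for t
  proof -
    have "(f \<longlongrightarrow> f t) (at t within {a..b})" using assms that by (auto simp: continuous_on_def)
    then have "(f \<longlongrightarrow> f t) (at t within {t..b})" by (rule tendsto_within_subset) (use that in auto)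
    then have "(f \<longlongrightarrow> f t) (at_right t)" using that by (simp add: at_within_Icc_at_right)
    moreover have "\<forall>\<^sub>F x in at_right t. f x = restrict f {a..b} x"
      using eventually_at_right_real[of t b] that by (auto elim!: eventually_mono)
    ultimately show ?thesis using that by (auto intro: Lim_transform_eventually)
  qed
  have L: "((restrict f {a..b}) \<longlongrightarrow> f t) (at_left t)" if "t \<in> {a<..b}" for t
  proof -
    have "(f \<longlongrightarrow> f t) (at t within {a..b})" using assms that by (auto simp: continuous_on_def)
    then have "(f \<longlongrightarrow> f t) (at t within {a..t})" by (rule tendsto_within_subset) (use that in auto)
    then have "(f \<longlongrightarrow> f t) (at_left t)" using that by (simp add: at_within_Icc_at_left)
    moreover have "\<forall>\<^sub>F x in at_left t. f x = restrict f {a..b} x"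
      using eventually_at_left_real[of a t] that by (auto elim!: eventually_mono)
    ultimately show ?thesis by (rule Lim_transform_eventually)
  qed
  then have "\<exists>l. (restrict f {a..b} \<longlongrightarrow> l) (at_left t)" if "t \<in> {a<..b}" for t using that by blast
  then show ?thesis unfolding skorohod_space_def using R by auto
qed

lemma eventually_floor_at_right:
  fixes t :: real
  assumes "0 \<le> c"
  shows "\<forall>\<^sub>F x in at_right t. \<lfloor>c * x\<rfloor> = \<lfloor>c * t\<rfloor>"
proof (cases "c = 0")
  case False
  then have c: "0 < c" using assms by simp
  have "\<forall>\<^sub>F x in at_right t. x \<in> {t<..<(of_int \<lfloor>c * t\<rfloor> + 1) / c}"
  proof (rule eventually_at_right_real)
    have "c * t < of_int \<lfloor>c * t\<rfloor> + 1" by linarith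
    then show "t < (of_int \<lfloor>c * t\<rfloor> + 1) / c" using c by (simp add: field_simps)
  qed
  then show ?thesis
  proof (rule eventually_mono)
    fix x assume x: "x \<in> {t<..<(of_int \<lfloor>c * t\<rfloor> + 1) / c}"
    then have "c * t \<le> c * x" "c * x < of_int \<lfloor>c * t\<rfloor> + 1" using c by (auto simp: field_simps)
    then show "\<lfloor>c * x\<rfloor> = \<lfloor>c * t\<rfloor>" by linarith
  qed
qed auto

lemma eventually_floor_at_left:
  fixes t :: real
  assumes "0 \<le> c"
  shows "\<exists>m. \<forall>\<^sub>F x in at_left t. \<lfloor>c * x\<rfloor> = m"
proof (cases "c = 0")
  case False
  then have c: "0 < c" using assms by simp
  \<comment> \<open>The left limit is the ceiling minus one, not the floor: this also covers integer
    \<open>c * t\<close>, where the floor jumps at \<open>t\<close>.\<close>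
  let ?m = "\<lceil>c * t\<rceil> - 1"
  have "of_int ?m < c * t" by linarith
  then have "\<forall>\<^sub>F x in at_left t. x \<in> {of_int ?m / c<..<t}"
    using c by (intro eventually_at_left_real) (simp add: field_simps)
  then have "\<forall>\<^sub>F x in at_left t. \<lfloor>c * x\<rfloor> = ?m"
  proof (rule eventually_mono)
    fix x assume x: "x \<in> {of_int ?m / c<..<t}"
    then have "of_int ?m < c * x" "c * x < c * t" using c by (auto simp: field_simps)
    then show "\<lfloor>c * x\<rfloor> = ?m" by linarith
  qed
  then show ?thesis by blast
qed auto

lemma step_in_skorohod_space:
  assumes "0 \<le> c"
  shows "restrict (\<lambda>s. v (nat \<lfloor>c * s\<rfloor>)) {a..b} \<in> skorohod_space a b" (is "?f \<in> _")
proof -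
  have R: "(?f \<longlongrightarrow> ?f t) (at_right t)" if t: "t \<in> {a..<b}" for t
  proof (rule tendsto_eventually)
    have "t < b" using t by simp
    from eventually_floor_at_right[OF assms, of t] eventually_at_right_real[OF this]
    show "\<forall>\<^sub>F x in at_right t. ?f x = ?f t"
    proof eventually_elim
      case (elim x) then show ?case using t by auto
    qed
  qed
  have L: "\<exists>l. (?f \<longlongrightarrow> l) (at_left t)" if t: "t \<in> {a<..b}" for t
  proof -
    obtain m where m: "\<forall>\<^sub>F x in at_left t. \<lfloor>c * x\<rfloor> = m" using eventually_floor_at_left[OF assms] by blast
    have "a < t" using t by simp
    from m eventually_at_left_real[OF this]
    have "\<forall>\<^sub>F x in at_left t. ?f x = v (nat m)"
    proof eventually_elim
      case (elim x) then show ?case using t by auto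
    qed
    then show ?thesis by (blast intro: tendsto_eventually)
  qed
  show ?thesis unfolding skorohod_space_def using R L by auto
qed

text \<open>The map from sequences of values to step paths is continuous, so preimages of Skorohod
  open sets are open in the product topology. The Borel sets of that topology are generated by the
  coordinates, hence measurability of each value suffices.\<close>

lemma measurable_step_skorohod:
  fixes v :: "nat \<Rightarrow> 'a \<Rightarrow> real"
  assumes meas: "\<And>n. v n \<in> borel_measurable M" and c: "0 \<le> c"
  shows "(\<lambda>\<omega>. restrict (\<lambda>s. v (nat \<lfloor>c * s\<rfloor>) \<omega>) {a..b}) \<in> M \<rightarrow>\<^sub>M borel_of_topology (skorohod_topology a b)"
proof (rule measurable_borel_of_topologyI)
  interpret Metric_space "skorohod_space a b" "skorohod_dist a b" by (rule Metric_space_skorohod)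
  show "restrict (\<lambda>s. v (nat \<lfloor>c * s\<rfloor>) \<omega>) {a..b} \<in> topspace (skorohod_topology a b)" for \<omega>
    using step_in_skorohod_space[OF c, of "\<lambda>n. v n \<omega>"] by simp
  fix U assume "openin (skorohod_topology a b) U"
  then have U: "U \<subseteq> skorohod_space a b" "\<And>x. x \<in> U \<Longrightarrow> \<exists>r>0. mball x r \<subseteq> U"
    by (auto simp: skorohod_topology_def openin_mtopology)
  define J where "J x = restrict (\<lambda>s. x (nat \<lfloor>c * s\<rfloor>) :: real) {a..b}" for x
  have J: "J x \<in> skorohod_space a b" for x unfolding J_def by (rule step_in_skorohod_space[OF c])
  \<comment> \<open>No index above \<open>k\<close> is visited on \<open>{a..b}\<close>, so finitely
    many coordinates control the path uniformly.\<close>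
  define k where "k = nat \<lfloor>c * b\<rfloor>"
  have "open (J -` U)"
  proof (subst open_subopen, intro ballI)
    fix x assume "x \<in> J -` U"
    then obtain r where r: "r > 0" "mball (J x) r \<subseteq> U" using U(2)[of "J x"] by auto
    let ?W = "{f. \<forall>i\<in>{..k}. f i \<in> ball (x i) (r/2)}"
    have "open ?W"
      using product_topology_basis'[of "{..k}" "\<lambda>i. ball (x i) (r/2)" id] by simp
    moreover have "x \<in> ?W" using r by auto
    moreover have "?W \<subseteq> J -` U"
    proof
      fix y assume y: "y \<in> ?W"
      have "skorohod_dist a b (J x) (J y) \<le> r/2"
      proof (rule skorohod_dist_le[OF J J])
        fix t assume t: "t \<in> {a..b}"
        then have "nat \<lfloor>c * t\<rfloor> \<le> k" unfolding k_def using c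
          by (intro nat_mono floor_mono mult_left_mono) auto
        moreover have "\<And>i. i \<le> k \<Longrightarrow> \<bar>x i - y i\<bar> < r/2" using y by (auto simp: dist_real_def)
        ultimately show "\<bar>J x t - J y t\<bar> \<le> r/2" using t by (auto simp: J_def intro: less_imp_le)
      qed (use r in simp)
      then have "J y \<in> mball (J x) r" using r J by (auto simp: in_mball)
      then show "y \<in> J -` U" using r by auto
    qed
    ultimately show "\<exists>T. open T \<and> x \<in> T \<and> T \<subseteq> J -` U" by blast
  qed
  moreover have "(\<lambda>\<omega> n. v n \<omega>) \<in> borel_measurable M"
    by (rule measurable_coordinatewise_then_product) (use meas in auto)
  ultimately have "(\<lambda>\<omega> n. v n \<omega>) -` (J -` U) \<inter> space M \<in> sets M"
    using measurable_sets borel_open by blast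
  then show "(\<lambda>\<omega>. restrict (\<lambda>s. v (nat \<lfloor>c * s\<rfloor>) \<omega>) {a..b}) -` U \<inter> space M \<in> sets M"
    by (simp add: vimage_def J_def)
qed

text \<open>For open \<open>U\<close>, the distance to the complement is a Lipschitz function whose positivity set is
  \<open>U\<close>; this reduces measurability of a limit to the real-valued case.\<close>

lemma measurable_skorohod_limit:
  assumes meas: "\<And>n. f n \<in> M \<rightarrow>\<^sub>M borel_of_topology (skorohod_topology a b)"
    and g: "\<And>\<omega>. \<omega> \<in> space M \<Longrightarrow> g \<omega> \<in> skorohod_space a b"
    and lim: "\<And>\<omega>. \<omega> \<in> space M \<Longrightarrow> (\<lambda>n. skorohod_dist a b (f n \<omega>) (g \<omega>)) \<longlonglongrightarrow> 0"
  shows "g \<in> M \<rightarrow>\<^sub>M borel_of_topology (skorohod_topology a b)"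
proof (rule measurable_borel_of_topologyI)
  interpret Metric_space "skorohod_space a b" "skorohod_dist a b" by (rule Metric_space_skorohod)
  show "g \<omega> \<in> topspace (skorohod_topology a b)" if "\<omega> \<in> space M" for \<omega> using g[OF that] by simp
  fix U assume "openin (skorohod_topology a b) U"
  then have U: "U \<subseteq> skorohod_space a b" "\<And>x. x \<in> U \<Longrightarrow> \<exists>r>0. mball x r \<subseteq> U"
    by (auto simp: skorohod_topology_def openin_mtopology)
  have f: "f n \<omega> \<in> skorohod_space a b" if "\<omega> \<in> space M" for n \<omega>
    using measurable_space[OF meas that] by simp
  \<comment> \<open>The inserted 1 keeps the infimum meaningful when \<open>U\<close> is the whole
    space; otherwise it only truncates the distance, which does not affect positivity.\<close>
  define \<psi> where "\<psi> x = Inf (insert 1 (skorohod_dist a b x ` (skorohod_space a b - U)))" for x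
  have bdd: "bdd_below (insert 1 (skorohod_dist a b x ` (skorohod_space a b - U)))" for x
    by (rule bdd_belowI[of _ 0]) auto
  have lip: "\<psi> x - \<psi> y \<le> 1 * skorohod_dist a b x y"
    if x: "x \<in> skorohod_space a b" and y: "y \<in> skorohod_space a b" for x y
  proof -
    have "\<psi> x - skorohod_dist a b x y \<le> \<psi> y" unfolding \<psi>_def
    proof (rule cInf_greatest, simp, elim insertE imageE)
      fix z assume "z = (1::real)"
      have "\<psi> x \<le> 1" unfolding \<psi>_def by (rule cInf_lower[OF _ bdd]) simp
      then show "Inf (insert 1 (skorohod_dist a b x ` (skorohod_space a b - U))) - skorohod_dist a b x y \<le> z"
        using \<open>z = 1\<close> nonneg[of x y] unfolding \<psi>_def by linarith
    next
      fix w z assume z: "z = skorohod_dist a b y w" and w: "w \<in> skorohod_space a b - U"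
      have "Inf (insert 1 (skorohod_dist a b x ` (skorohod_space a b - U))) \<le> skorohod_dist a b x w"
        by (rule cInf_lower[OF _ bdd]) (use w in simp)
      also have "\<dots> \<le> skorohod_dist a b x y + skorohod_dist a b y w" using x y w by (intro triangle) auto
      finally show "Inf (insert 1 (skorohod_dist a b x ` (skorohod_space a b - U))) - skorohod_dist a b x y \<le> z"
        using z by simp
    qed
    then show ?thesis by simp
  qed
  have pos: "\<psi> x > 0 \<longleftrightarrow> x \<in> U" if x: "x \<in> skorohod_space a b" for x
  proof
    assume "\<psi> x > 0"
    show "x \<in> U"
    proof (rule ccontr)
      assume "x \<notin> U"
      then have "\<psi> x \<le> skorohod_dist a b x x" unfolding \<psi>_def
        by (intro cInf_lower[OF _ bdd] insertI2 imageI) (use x in auto)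
      then show False using \<open>\<psi> x > 0\<close> x by simp
    qed
  next
    assume "x \<in> U"
    then obtain r where r: "r > 0" "mball x r \<subseteq> U" using U by blast
    have "min 1 r \<le> \<psi> x" unfolding \<psi>_def
    proof (rule cInf_greatest, simp, elim insertE imageE)
      fix w z assume "z = skorohod_dist a b x w" "w \<in> skorohod_space a b - U"
      then show "min 1 r \<le> z" using r x by (force simp: subset_iff in_mball not_less)
    qed auto
    then show "\<psi> x > 0" using r by simp
  qed
  have "continuous_map (skorohod_topology a b) euclideanreal \<psi>"
    unfolding skorohod_topology_def
    by (rule lipschitz_continuous_map_mtopology[OF Metric_space_skorohod lip])
  then have m: "(\<lambda>\<omega>. \<psi> (f n \<omega>)) \<in> borel_measurable M" for n
    using measurable_compose[OF meas continuous_map_measurable] by blast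
  have "(\<lambda>n. \<psi> (f n \<omega>)) \<longlonglongrightarrow> \<psi> (g \<omega>)" if w: "\<omega> \<in> space M" for \<omega>
  proof (rule Lim_transform_bound[where g="\<lambda>n. skorohod_dist a b (f n \<omega>) (g \<omega>)", THEN Lim_null[THEN iffD2]])
    show "\<forall>\<^sub>F n in sequentially. norm (\<psi> (f n \<omega>) - \<psi> (g \<omega>)) \<le> norm (skorohod_dist a b (f n \<omega>) (g \<omega>))"
      using lip[OF f[OF w] g[OF w]] lip[OF g[OF w] f[OF w]] commute[of "g \<omega>"]
      by (intro always_eventually allI) (auto simp: abs_le_iff)
  qed (rule lim[OF w])
  then have "(\<lambda>\<omega>. \<psi> (g \<omega>)) \<in> borel_measurable M"
    by (rule borel_measurable_LIMSEQ_real[OF _ m])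
  then have "{\<omega> \<in> space M. 0 < \<psi> (g \<omega>)} \<in> sets M" by simp
  moreover have "{\<omega> \<in> space M. 0 < \<psi> (g \<omega>)} = g -` U \<inter> space M" using pos g by auto
  ultimately show "g -` U \<inter> space M \<in> sets M" by simp
qed

text \<open>A continuous path is the uniform limit of step paths built from finitely many of its
  values, so measurability of the single values carries over to the path.\<close>

lemma measurable_skorohod_continuous:
  fixes Y :: "'a \<Rightarrow> real \<Rightarrow> real"
  assumes ab: "0 \<le> a" "a \<le> b" and cont: "\<And>\<omega>. \<omega> \<in> space M \<Longrightarrow> continuous_on {a..b} (Y \<omega>)"
    and meas: "\<And>t. t \<in> {a..b} \<Longrightarrow> (\<lambda>\<omega>. Y \<omega> t) \<in> borel_measurable M"
  shows "(\<lambda>\<omega>. restrict (Y \<omega>) {a..b}) \<in> M \<rightarrow>\<^sub>M borel_of_topology (skorohod_topology a b)"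
proof -
  \<comment> \<open>The grid point to the left of \<open>t\<close> may lie below \<open>a\<close>;
    clipping moves it into the interval and no further from \<open>t\<close>.\<close>
  define clip where "clip n i = max a (min b (real i / real (Suc n)))" for n i :: nat
  have clip: "clip n i \<in> {a..b}" for n i using ab by (auto simp: clip_def)
  let ?f = "\<lambda>n \<omega>. restrict (\<lambda>s. Y \<omega> (clip n (nat \<lfloor>real (Suc n) * s\<rfloor>))) {a..b}"
  show ?thesis
  proof (rule measurable_skorohod_limit)
    show "?f n \<in> M \<rightarrow>\<^sub>M borel_of_topology (skorohod_topology a b)" for n
      by (rule measurable_step_skorohod[where v="\<lambda>i \<omega>. Y \<omega> (clip n i)"]) (use meas clip in auto)
    fix \<omega> assume w: "\<omega> \<in> space M"
    show Yin: "restrict (Y \<omega>) {a..b} \<in> skorohod_space a b" by (rule continuous_in_skorohod_space[OF cont[OF w]])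
    interpret Metric_space "skorohod_space a b" "skorohod_dist a b" by (rule Metric_space_skorohod)
    show "(\<lambda>n. skorohod_dist a b (?f n \<omega>) (restrict (Y \<omega>) {a..b})) \<longlonglongrightarrow> 0"
    proof (rule LIMSEQ_I)
      fix e :: real assume e: "0 < e"
      have "uniformly_continuous_on {a..b} (Y \<omega>)" by (rule compact_uniformly_continuous[OF cont[OF w] compact_Icc])
      then obtain d where d: "d > 0"
        "\<And>s t. s \<in> {a..b} \<Longrightarrow> t \<in> {a..b} \<Longrightarrow> dist s t < d \<Longrightarrow> dist (Y \<omega> s) (Y \<omega> t) < e/2"
        unfolding uniformly_continuous_on_def using e by (metis dist_commute half_gt_zero)
      obtain n0 :: nat where n0: "1 / d < real n0" using reals_Archimedean2 by blast
      show "\<exists>n0. \<forall>n\<ge>n0. norm (skorohod_dist a b (?f n \<omega>) (restrict (Y \<omega>) {a..b}) - 0) < e"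
      proof (intro exI[of _ n0] allI impI)
        fix n assume "n0 \<le> n"
        then have "1 / d < real (Suc n)" using n0 by linarith
        then have nd: "1 / real (Suc n) < d" using d(1) by (simp add: field_simps)
        have "skorohod_dist a b (?f n \<omega>) (restrict (Y \<omega>) {a..b}) \<le> e/2"
        proof (rule skorohod_dist_le[OF _ Yin])
          show "?f n \<omega> \<in> skorohod_space a b"
            using step_in_skorohod_space[of "real (Suc n)" "\<lambda>i. Y \<omega> (clip n i)"] by simp
          fix t assume t: "t \<in> {a..b}"
          define j where "j = nat \<lfloor>real (Suc n) * t\<rfloor>"
          have "0 \<le> real (Suc n) * t" using t ab by (intro mult_nonneg_nonneg) auto
          then have j: "real j \<le> real (Suc n) * t" "real (Suc n) * t \<le> real j + 1" unfolding j_def by linarith+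
          then have "real j / real (Suc n) \<le> t" "t \<le> (real j + 1) / real (Suc n)"
            by (simp_all add: pos_divide_le_eq pos_le_divide_eq mult.commute del: of_nat_Suc)
          then have "\<bar>clip n j - t\<bar> \<le> 1 / real (Suc n)"
            unfolding clip_def add_divide_distrib using t by auto
          then have "dist (Y \<omega> (clip n j)) (Y \<omega> t) < e/2"
            using nd by (intro d(2)[OF clip t]) (simp add: dist_real_def)
          moreover have "?f n \<omega> t = Y \<omega> (clip n j)" "restrict (Y \<omega>) {a..b} t = Y \<omega> t"
            using t by (simp_all add: j_def)
          ultimately show "\<bar>?f n \<omega> t - restrict (Y \<omega>) {a..b} t\<bar> \<le> e/2"
            by (simp add: dist_real_def)
        qed (use e in simp)
        then show "norm (skorohod_dist a b (?f n \<omega>) (restrict (Y \<omega>) {a..b}) - 0) < e"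
          using e by simp
      qed
    qed
  qed
qed

section \<open>An extended continuous mapping theorem\<close>

text \<open>The functionals are bounded below by a Lipschitz envelope \<open>g k\<close> of all \<open>\<psi> N\<close> with
  \<open>N \<ge> k\<close>, which is a function of the path alone and hence a legitimate test function; it increases
  to at least \<open>\<xi>\<close> at almost every limit path. No functional needs to be defined on the whole space.\<close>

lemma skorohod_envelope_lower:
  fixes \<psi> :: "nat \<Rightarrow> 'a \<Rightarrow> real" and \<xi> :: "'b \<Rightarrow> real"
  assumes "prob_space M" "prob_space M'"
    and weak: "weak_conv_D a b M X M' Z"
    and \<psi>: "\<And>N. \<psi> N \<in> borel_measurable M" and \<psi>_bdd: "\<And>N \<omega>. \<omega> \<in> space M \<Longrightarrow> \<bar>\<psi> N \<omega>\<bar> \<le> C"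
    and \<xi>: "\<xi> \<in> borel_measurable M'" and \<xi>_bdd: "\<And>\<omega>. \<omega> \<in> space M' \<Longrightarrow> \<bar>\<xi> \<omega>\<bar> \<le> C"
    and r: "\<And>N. integrable M (r N)" and r_nonneg: "\<And>N \<omega>. \<omega> \<in> space M \<Longrightarrow> 0 \<le> r N \<omega>"
    and r_lim: "(\<lambda>N. \<integral>\<omega>. r N \<omega> \<partial>M) \<longlonglongrightarrow> 0"
    and cont: "AE \<omega>' in M'. \<forall>e>0. \<exists>d>0. \<exists>N0. \<forall>N\<ge>N0. \<forall>\<omega>\<in>space M.
       skorohod_dist a b (restrict (X N \<omega>) {a..b}) (restrict (Z \<omega>') {a..b}) < d \<longrightarrow> r N \<omega> < d \<longrightarrow>
       \<xi> \<omega>' - e < \<psi> N \<omega>"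
    and e: "0 < e"
  shows "\<forall>\<^sub>F N in sequentially. (\<integral>\<omega>. \<xi> \<omega> \<partial>M') - e < (\<integral>\<omega>. \<psi> N \<omega> \<partial>M)"
proof -
  interpret M: prob_space M by fact
  interpret M': prob_space M' by fact
  interpret D: Metric_space "skorohod_space a b" "skorohod_dist a b" by (rule Metric_space_skorohod)
  let ?d = "skorohod_dist a b"
  let ?X = "\<lambda>N \<omega>. restrict (X N \<omega>) {a..b}" and ?Z = "\<lambda>\<omega>. restrict (Z \<omega>) {a..b}"
  have X: "?X N \<in> M \<rightarrow>\<^sub>M borel_of_topology (skorohod_topology a b)" for N
    using weak by (simp add: weak_conv_D_def)
  have Z: "?Z \<in> M' \<rightarrow>\<^sub>M borel_of_topology (skorohod_topology a b)"
    using weak by (simp add: weak_conv_D_def)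
  have Xin: "?X N \<omega> \<in> skorohod_space a b" if "\<omega> \<in> space M" for N \<omega>
    using measurable_space[OF X that] by simp
  have Zin: "?Z \<omega> \<in> skorohod_space a b" if "\<omega> \<in> space M'" for \<omega>
    using measurable_space[OF Z that] by simp
  obtain \<omega>0 where \<omega>0: "\<omega>0 \<in> space M" using M.not_empty by blast
  have C: "0 \<le> C" using \<psi>_bdd[OF \<omega>0, of 0] by linarith
  \<comment> \<open>\<open>g k\<close> is an inf-convolution: the penalty is \<open>k\<close> times
    the sum of the distance and the remainder. The extra element \<open>C\<close> caps the envelope
    at the common bound of the functionals.\<close>
  define A where "A k x = insert C ((\<lambda>(N, \<omega>). \<psi> N \<omega> + real k * (?d x (?X N \<omega>) + r N \<omega>)) ` ({k..} \<times> space M))"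
    for k :: nat and x
  define g where "g k x = Inf (A k x)" for k :: nat and x
  have A_ge: "- C \<le> y" if "y \<in> A k x" for k x y
    using that C \<psi>_bdd r_nonneg unfolding A_def
    by (auto simp: abs_le_iff intro!: add_increasing2 mult_nonneg_nonneg add_nonneg_nonneg)
       (metis minus_le_iff)
  have bdd: "bdd_below (A k x)" for k x using A_ge by (intro bdd_belowI) auto
  have ne: "A k x \<noteq> {}" for k x by (simp add: A_def)
  have g_le: "g k x \<le> C" for k x unfolding g_def by (rule cInf_lower[OF _ bdd]) (simp add: A_def)
  have g_ge: "- C \<le> g k x" for k x unfolding g_def by (rule cInf_greatest[OF ne A_ge])
  have lip: "g k x - g k y \<le> real k * ?d x y"
    if x: "x \<in> skorohod_space a b" and y: "y \<in> skorohod_space a b" for k x y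
  proof -
    have "g k x - real k * ?d x y \<le> Inf (A k y)"
    proof (rule cInf_greatest[OF ne])
      fix z assume "z \<in> A k y"
      then consider "z = C" | N \<omega> where "N \<ge> k" "\<omega> \<in> space M"
        "z = \<psi> N \<omega> + real k * (?d y (?X N \<omega>) + r N \<omega>)" by (auto simp: A_def)
      then show "g k x - real k * ?d x y \<le> z"
      proof cases
        case 1
        have "0 \<le> real k * ?d x y" by simp
        then show ?thesis using 1 g_le[of k x] by linarith
      next
        case 2
        have "g k x \<le> \<psi> N \<omega> + real k * (?d x (?X N \<omega>) + r N \<omega>)"
          unfolding g_def by (rule cInf_lower[OF _ bdd]) (use 2 in \<open>auto simp: A_def\<close>)
        also have "\<dots> \<le> \<psi> N \<omega> + real k * (?d x y + ?d y (?X N \<omega>) + r N \<omega>)"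
          using D.triangle[OF x y Xin[OF 2(2)]] by (intro add_left_mono mult_left_mono add_right_mono) auto
        also have "\<dots> = z + real k * ?d x y" using 2 by (simp add: algebra_simps)
        finally show ?thesis by simp
      qed
    qed
    then show ?thesis by (simp add: g_def)
  qed
  have g_cont: "continuous_map (skorohod_topology a b) euclideanreal (g k)" for k
    unfolding skorohod_topology_def
    by (rule lipschitz_continuous_map_mtopology[OF Metric_space_skorohod lip])
  have g_bdd: "bounded (g k ` skorohod_space a b)" for k
    unfolding bounded_iff using g_le g_ge by (auto intro!: exI[of _ C] simp: abs_le_iff minus_le_iff)
  have g_conv: "(\<lambda>N. \<integral>\<omega>. g k (?X N \<omega>) \<partial>M) \<longlonglongrightarrow> (\<integral>\<omega>. g k (?Z \<omega>) \<partial>M')" for k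
    using weak g_cont g_bdd unfolding weak_conv_D_def by blast
  have gX: "(\<lambda>\<omega>. g k (?X N \<omega>)) \<in> borel_measurable M" for k N
    by (rule measurable_compose[OF X continuous_map_measurable[OF g_cont]])
  have gZ: "(\<lambda>\<omega>. g k (?Z \<omega>)) \<in> borel_measurable M'" for k
    by (rule measurable_compose[OF Z continuous_map_measurable[OF g_cont]])
  \<comment> \<open>The pair \<open>(N, \<omega>)\<close> competes in the infimum at its own path,
    where the distance is 0, so only the remainder part of the penalty survives.\<close>
  have below: "(\<integral>\<omega>. g k (?X N \<omega>) \<partial>M) \<le> (\<integral>\<omega>. \<psi> N \<omega> \<partial>M) + real k * (\<integral>\<omega>. r N \<omega> \<partial>M)" if "N \<ge> k" for k N
  proof -
    have i\<psi>: "integrable M (\<psi> N)" by (rule M.integrable_const_bound[of _ C]) (use \<psi> \<psi>_bdd in auto)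
    have "(\<integral>\<omega>. g k (?X N \<omega>) \<partial>M) \<le> (\<integral>\<omega>. \<psi> N \<omega> + real k * r N \<omega> \<partial>M)"
    proof (rule integral_mono)
      show "integrable M (\<lambda>\<omega>. g k (?X N \<omega>))"
        by (rule M.integrable_const_bound[of _ C]) (use gX g_le g_ge in \<open>auto simp: abs_le_iff minus_le_iff\<close>)
      show "integrable M (\<lambda>\<omega>. \<psi> N \<omega> + real k * r N \<omega>)" using i\<psi> r by auto
      fix \<omega> assume w: "\<omega> \<in> space M"
      have "g k (?X N \<omega>) \<le> \<psi> N \<omega> + real k * (?d (?X N \<omega>) (?X N \<omega>) + r N \<omega>)"
        unfolding g_def by (rule cInf_lower[OF _ bdd]) (use w that in \<open>auto simp: A_def\<close>)
      then show "g k (?X N \<omega>) \<le> \<psi> N \<omega> + real k * r N \<omega>" using Xin[OF w, of N] by simp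
    qed
    also have "\<dots> = (\<integral>\<omega>. \<psi> N \<omega> \<partial>M) + real k * (\<integral>\<omega>. r N \<omega> \<partial>M)"
      using i\<psi> r by simp
    finally show ?thesis .
  qed
  \<comment> \<open>The envelope may stay above \<open>\<xi>\<close> at some paths. Taking the
    minimum with \<open>\<xi>\<close> turns the lower bound into convergence, to which dominated
    convergence applies.\<close>
  have lim: "AE \<omega> in M'. (\<lambda>k. min (g k (?Z \<omega>)) (\<xi> \<omega>)) \<longlonglongrightarrow> \<xi> \<omega>"
    using AE_space cont
  proof eventually_elim
    fix \<omega>' assume w': "\<omega>' \<in> space M'" and *: "\<forall>e>0. \<exists>d>0. \<exists>N0. \<forall>N\<ge>N0. \<forall>\<omega>\<in>space M.
       ?d (?X N \<omega>) (?Z \<omega>') < d \<longrightarrow> r N \<omega> < d \<longrightarrow> \<xi> \<omega>' - e < \<psi> N \<omega>"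
    show "(\<lambda>k. min (g k (?Z \<omega>')) (\<xi> \<omega>')) \<longlonglongrightarrow> \<xi> \<omega>'"
    proof (rule LIMSEQ_I)
      have \<xi>_le: "\<xi> \<omega>' \<le> C" using \<xi>_bdd[OF w'] by simp
      fix e :: real assume e: "0 < e"
      obtain d N0 where d: "d > 0" and N0: "\<And>N \<omega>. N \<ge> N0 \<Longrightarrow> \<omega> \<in> space M \<Longrightarrow>
        ?d (?X N \<omega>) (?Z \<omega>') < d \<Longrightarrow> r N \<omega> < d \<Longrightarrow> \<xi> \<omega>' - e/2 < \<psi> N \<omega>"
        using *[rule_format, of "e/2"] e by auto
      \<comment> \<open>For such \<open>k\<close>, a competitor whose distance plus remainder is at
        least \<open>d\<close> has value at least \<open>- C + 2 * C = C\<close>, so it cannot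
        undercut \<open>\<xi>\<close>.\<close>
      obtain k0 where k0: "real k0 \<ge> 2 * C / d" using real_arch_simple by blast
      have "\<xi> \<omega>' - e/2 \<le> g k (?Z \<omega>')" if k: "k \<ge> max N0 k0" for k
        unfolding g_def
      proof (rule cInf_greatest[OF ne])
        fix z assume "z \<in> A k (?Z \<omega>')"
        then consider "z = C" | N \<omega> where "N \<ge> k" "\<omega> \<in> space M"
          "z = \<psi> N \<omega> + real k * (?d (?Z \<omega>') (?X N \<omega>) + r N \<omega>)" by (auto simp: A_def)
        then show "\<xi> \<omega>' - e/2 \<le> z"
        proof cases
          case 1 then show ?thesis using \<xi>_le e by simp
        next
          case 2
          let ?s = "?d (?Z \<omega>') (?X N \<omega>) + r N \<omega>"
          have s: "0 \<le> ?d (?Z \<omega>') (?X N \<omega>)" "0 \<le> r N \<omega>" using r_nonneg 2 by auto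
          show ?thesis
          proof (cases "?s < d")
            case True
            then have "r N \<omega> < d" "?d (?X N \<omega>) (?Z \<omega>') < d"
              using s D.commute[of "?X N \<omega>" "?Z \<omega>'"] by linarith+
            then have "\<xi> \<omega>' - e/2 < \<psi> N \<omega>" using 2 k by (intro N0) auto
            moreover have "0 \<le> real k * ?s" using s by simp
            ultimately show ?thesis using 2 by linarith
          next
            case False
            have "2 * C \<le> real k0 * d" using k0 d by (simp add: field_simps)
            also have "\<dots> \<le> real k * ?s" using False k d by (intro mult_mono) auto
            finally have "C \<le> z" using 2 \<psi>_bdd[OF 2(2), of N] by (auto simp: abs_le_iff)
            then show ?thesis using e \<xi>_le by simp
          qed
        qed
      qed
      then show "\<exists>k0. \<forall>k\<ge>k0. norm (min (g k (?Z \<omega>')) (\<xi> \<omega>') - \<xi> \<omega>') < e"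
        using e by (intro exI[of _ "max N0 k0"]) (fastforce simp: min_def)
    qed
  qed
  have "(\<lambda>k. \<integral>\<omega>. min (g k (?Z \<omega>)) (\<xi> \<omega>) \<partial>M') \<longlonglongrightarrow> (\<integral>\<omega>. \<xi> \<omega> \<partial>M')"
  proof (rule integral_dominated_convergence[where w="\<lambda>_. C"])
    show "AE \<omega> in M'. norm (min (g k (?Z \<omega>)) (\<xi> \<omega>)) \<le> C" for k
    proof (rule AE_I2)
      fix \<omega> assume "\<omega> \<in> space M'"
      then show "norm (min (g k (?Z \<omega>)) (\<xi> \<omega>)) \<le> C"
        using g_le[of k "?Z \<omega>"] g_ge[of k "?Z \<omega>"] \<xi>_bdd[of \<omega>] by auto
    qed
  qed (use gZ \<xi> lim in auto)
  then have "\<forall>\<^sub>F k in sequentially. (\<integral>\<omega>. \<xi> \<omega> \<partial>M') - e/2 < (\<integral>\<omega>. min (g k (?Z \<omega>)) (\<xi> \<omega>) \<partial>M')"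
    by (rule order_tendstoD) (use e in simp)
  then obtain k where "(\<integral>\<omega>. \<xi> \<omega> \<partial>M') - e/2 < (\<integral>\<omega>. min (g k (?Z \<omega>)) (\<xi> \<omega>) \<partial>M')"
    by (auto simp: eventually_sequentially)
  also have "\<dots> \<le> (\<integral>\<omega>. g k (?Z \<omega>) \<partial>M')"
  proof (rule integral_mono)
    show i: "integrable M' (\<lambda>\<omega>. g k (?Z \<omega>))"
      by (rule M'.integrable_const_bound[of _ C]) (use gZ g_le g_ge in \<open>auto simp: abs_le_iff minus_le_iff\<close>)
    have "integrable M' \<xi>" by (rule M'.integrable_const_bound[of _ C]) (use \<xi> \<xi>_bdd in auto)
    with i show "integrable M' (\<lambda>\<omega>. min (g k (?Z \<omega>)) (\<xi> \<omega>))" by simp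
  qed simp
  finally have k: "(\<integral>\<omega>. \<xi> \<omega> \<partial>M') - e/2 < (\<integral>\<omega>. g k (?Z \<omega>) \<partial>M')" .
  \<comment> \<open>\<open>k\<close> is fixed before \<open>N\<close> grows, so the factor
    \<open>k\<close> in front of the remainder does no harm.\<close>
  have "(\<lambda>N. (\<integral>\<omega>. g k (?X N \<omega>) \<partial>M) - real k * (\<integral>\<omega>. r N \<omega> \<partial>M)) \<longlonglongrightarrow> (\<integral>\<omega>. g k (?Z \<omega>) \<partial>M') - real k * 0"
    by (intro tendsto_intros g_conv r_lim)
  then have "\<forall>\<^sub>F N in sequentially. (\<integral>\<omega>. \<xi> \<omega> \<partial>M') - e/2 < (\<integral>\<omega>. g k (?X N \<omega>) \<partial>M) - real k * (\<integral>\<omega>. r N \<omega> \<partial>M)"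
    by (rule order_tendstoD) (use k in simp)
  then show ?thesis using eventually_ge_at_top[of k]
  proof eventually_elim
    case (elim N) then show ?case using below[of k N] e by linarith
  qed
qed

text \<open>The one-sided bound is applied to \<open>\<psi>\<close> and to its negative. The last
  hypothesis is an asymptotic continuity of the family \<open>\<psi> N\<close> at almost every limit
  path, uniform in the sample point, and it may assume that \<open>r\<close> is small.\<close>

lemma skorohod_extended_mapping:
  fixes \<psi> :: "nat \<Rightarrow> 'a \<Rightarrow> real" and \<xi> :: "'b \<Rightarrow> real"
  assumes "prob_space M" "prob_space M'"
    and "weak_conv_D a b M X M' Z"
    and \<psi>: "\<And>N. \<psi> N \<in> borel_measurable M" "\<And>N \<omega>. \<omega> \<in> space M \<Longrightarrow> \<bar>\<psi> N \<omega>\<bar> \<le> C"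
    and \<xi>: "\<xi> \<in> borel_measurable M'" "\<And>\<omega>. \<omega> \<in> space M' \<Longrightarrow> \<bar>\<xi> \<omega>\<bar> \<le> C"
    and "\<And>N. integrable M (r N)" and "\<And>N \<omega>. \<omega> \<in> space M \<Longrightarrow> 0 \<le> r N \<omega>"
    and "(\<lambda>N. \<integral>\<omega>. r N \<omega> \<partial>M) \<longlonglongrightarrow> 0"
    and cont: "AE \<omega>' in M'. \<forall>e>0. \<exists>d>0. \<exists>N0. \<forall>N\<ge>N0. \<forall>\<omega>\<in>space M.
       skorohod_dist a b (restrict (X N \<omega>) {a..b}) (restrict (Z \<omega>') {a..b}) < d \<longrightarrow> r N \<omega> < d \<longrightarrow>
       \<bar>\<psi> N \<omega> - \<xi> \<omega>'\<bar> < e"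
  shows "(\<lambda>N. \<integral>\<omega>. \<psi> N \<omega> \<partial>M) \<longlonglongrightarrow> (\<integral>\<omega>. \<xi> \<omega> \<partial>M')"
proof (rule tendstoI)
  note base = assms(1-3)
  note rest = assms(8-10)
  fix e :: real assume e: "0 < e"
  have "\<forall>\<^sub>F N in sequentially. (\<integral>\<omega>. \<xi> \<omega> \<partial>M') - e < (\<integral>\<omega>. \<psi> N \<omega> \<partial>M)"
  proof (rule skorohod_envelope_lower[OF base \<psi> \<xi> rest _ e])
    show "AE \<omega>' in M'. \<forall>e>0. \<exists>d>0. \<exists>N0. \<forall>N\<ge>N0. \<forall>\<omega>\<in>space M.
       skorohod_dist a b (restrict (X N \<omega>) {a..b}) (restrict (Z \<omega>') {a..b}) < d \<longrightarrow> r N \<omega> < d \<longrightarrow>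
       \<xi> \<omega>' - e < \<psi> N \<omega>"
      using cont by eventually_elim (fastforce simp: abs_less_iff)
  qed auto
  moreover have "\<forall>\<^sub>F N in sequentially. (\<integral>\<omega>. - \<xi> \<omega> \<partial>M') - e < (\<integral>\<omega>. - \<psi> N \<omega> \<partial>M)"
  proof (rule skorohod_envelope_lower[OF base _ _ _ _ rest _ e, where C=C])
    show "AE \<omega>' in M'. \<forall>e>0. \<exists>d>0. \<exists>N0. \<forall>N\<ge>N0. \<forall>\<omega>\<in>space M.
       skorohod_dist a b (restrict (X N \<omega>) {a..b}) (restrict (Z \<omega>') {a..b}) < d \<longrightarrow> r N \<omega> < d \<longrightarrow>
       - \<xi> \<omega>' - e < - \<psi> N \<omega>"
      using cont by eventually_elim (fastforce simp: abs_less_iff)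
  qed (use \<psi> \<xi> in auto)
  ultimately show "\<forall>\<^sub>F N in sequentially. dist (\<integral>\<omega>. \<psi> N \<omega> \<partial>M) (\<integral>\<omega>. \<xi> \<omega> \<partial>M') < e"
    by eventually_elim (simp add: dist_real_def abs_less_iff)
qed

section \<open>Integrals of continuous paths\<close>

lemma integrable_on_path:
  fixes f :: "real \<Rightarrow> real"
  assumes "continuous_on {0..1} f" "0 \<le> a" "b \<le> 1"
  shows "f integrable_on {a..b}"
  by (rule integrable_continuous_real, rule continuous_on_subset[OF assms(1)]) (use assms in auto)

lemma path_bounded:
  fixes f :: "real \<Rightarrow> real"
  assumes "continuous_on {0..1} f"
  obtains C where "0 \<le> C" "\<And>t. t \<in> {0..1} \<Longrightarrow> \<bar>f t\<bar> \<le> C"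
proof -
  have "bounded (f ` {0..1})" by (rule compact_imp_bounded[OF compact_continuous_image[OF assms compact_Icc]])
  then obtain C where "\<forall>x\<in>{0..1}. norm (f x) \<le> C" unfolding bounded_iff by auto
  then show ?thesis by (intro that[of "max 0 C"]) (auto simp: max.coboundedI2)
qed

lemma integral_bound_path:
  fixes f :: "real \<Rightarrow> real"
  assumes "continuous_on {0..1} f" "0 \<le> a" "a \<le> b" "b \<le> 1" "\<And>t. t \<in> {a..b} \<Longrightarrow> \<bar>f t\<bar> \<le> C"
  shows "\<bar>integral {a..b} f\<bar> \<le> C * (b - a)"
  using integral_bound[of a b f C] continuous_on_subset[OF assms(1), of "{a..b}"] assms by auto

lemma integral_path_lipschitz:
  fixes f :: "real \<Rightarrow> real"
  assumes cont: "continuous_on {0..1} f" and "x \<in> {0..1}" "y \<in> {0..1}"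
    and C: "\<And>t. t \<in> {0..1} \<Longrightarrow> \<bar>f t\<bar> \<le> C"
  shows "\<bar>integral {0..y} f - integral {0..x} f\<bar> \<le> C * \<bar>y - x\<bar>"
proof -
  have *: "\<bar>integral {0..y} f - integral {0..x} f\<bar> \<le> C * (y - x)" if "0 \<le> x" "x \<le> y" "y \<le> 1" for x y
  proof -
    have "integral {0..x} f + integral {x..y} f = integral {0..y} f"
      using that by (intro Henstock_Kurzweil_Integration.integral_combine integrable_on_path[OF cont]) auto
    moreover have "\<bar>integral {x..y} f\<bar> \<le> C * (y - x)"
      using that C by (intro integral_bound_path[OF cont]) auto
    ultimately show ?thesis by linarith
  qed
  show ?thesis using *[of x y] *[of y x] assms(2,3) by (cases "x \<le> y") (auto simp: abs_minus_commute)
qed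

text \<open>The values \<open>v i\<close> need not be samples of \<open>f\<close>: each only has to
  be within \<open>e\<close> of \<open>f\<close> on its whole cell. In this form the approximation
  of the path by the walk and the discretization are estimated together.\<close>

lemma riemann_sum_bound:
  fixes f :: "real \<Rightarrow> real"
  assumes "continuous_on {0..real n * \<delta>} f" "0 \<le> \<delta>"
    and "\<And>i r. i \<in> {1..n} \<Longrightarrow> r \<in> {(real i - 1) * \<delta>..real i * \<delta>} \<Longrightarrow> \<bar>v i - f r\<bar> \<le> e"
  shows "\<bar>\<delta> * (\<Sum>i=1..n. v i) - integral {0..real n * \<delta>} f\<bar> \<le> e * (real n * \<delta>)"
  using assms
proof (induction n)
  case (Suc n)
  let ?a = "real n * \<delta>" and ?b = "real (Suc n) * \<delta>"
  have ab: "0 \<le> ?a" "?a \<le> ?b" using Suc.prems by (auto simp: mult_right_mono)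
  have cont: "continuous_on {0..?a} f" "continuous_on {?a..?b} f"
    by (rule continuous_on_subset[OF Suc.prems(1)]; use ab in auto)+
  have "\<bar>\<delta> * (\<Sum>i=1..n. v i) - integral {0..?a} f\<bar> \<le> e * ?a"
    by (rule Suc.IH) (use cont Suc.prems in auto)
  moreover have "\<bar>\<delta> * v (Suc n) - integral {?a..?b} f\<bar> \<le> e * \<delta>"
  proof -
    have "\<bar>integral {?a..?b} (\<lambda>r. v (Suc n) - f r)\<bar> \<le> e * (?b - ?a)"
    proof (rule integral_bound[of ?a ?b "\<lambda>r. v (Suc n) - f r" e, unfolded real_norm_def])
      show "continuous_on {?a..?b} (\<lambda>r. v (Suc n) - f r)" by (intro continuous_intros cont(2))
      show "\<bar>v (Suc n) - f t\<bar> \<le> e" if "t \<in> {?a..?b}" for t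
        using Suc.prems(3)[of "Suc n" t] that by simp
    qed (rule ab(2))
    moreover have "integral {?a..?b} (\<lambda>r. v (Suc n) - f r) = \<delta> * v (Suc n) - integral {?a..?b} f"
      using ab cont(2) by (subst Henstock_Kurzweil_Integration.integral_diff)
        (auto intro!: integrable_continuous_real simp: algebra_simps)
    ultimately show ?thesis by (simp add: algebra_simps)
  qed
  moreover have "integral {0..?a} f + integral {?a..?b} f = integral {0..?b} f"
    by (rule Henstock_Kurzweil_Integration.integral_combine[OF ab integrable_continuous_real[OF Suc.prems(1)]])
  ultimately show ?case by (auto simp: algebra_simps abs_le_iff)
qed auto

text \<open>Cauchy--Schwarz against the constant 1: expand the nonnegative integral of the squared
  deviation from the mean \<open>m\<close>.\<close>

lemma integral_sq_le:
  fixes f :: "real \<Rightarrow> real"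
  assumes cont: "continuous_on {a..b} f" and "a \<le> b"
  shows "(integral {a..b} f)\<^sup>2 \<le> integral {a..b} (\<lambda>t. (f t)\<^sup>2) * (b - a)"
proof (cases "a = b")
  case False
  then have ab: "b - a > 0" using assms by simp
  define m where "m = integral {a..b} f / (b - a)"
  note int = integrable_continuous_real
  have "0 \<le> integral {a..b} (\<lambda>t. (f t - m)\<^sup>2)"
    by (intro Henstock_Kurzweil_Integration.integral_nonneg int continuous_intros cont) auto
  also have "\<dots> = integral {a..b} (\<lambda>t. (f t)\<^sup>2 - 2 * m * f t + m\<^sup>2)"
    by (simp add: power2_diff algebra_simps)
  also have "\<dots> = integral {a..b} (\<lambda>t. (f t)\<^sup>2) - 2 * m * integral {a..b} f + m\<^sup>2 * (b - a)"
    using assms(2)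
    by (simp add: Henstock_Kurzweil_Integration.integral_add Henstock_Kurzweil_Integration.integral_diff
      int continuous_intros cont)
  also have "\<dots> = integral {a..b} (\<lambda>t. (f t)\<^sup>2) - (integral {a..b} f)\<^sup>2 / (b - a)"
  proof -
    have "m * (b - a) = integral {a..b} f" using ab by (simp add: m_def)
    then have "m\<^sup>2 * (b - a) = m * integral {a..b} f" by (simp add: power2_eq_square)
    moreover have "m * integral {a..b} f = (integral {a..b} f)\<^sup>2 / (b - a)"
      by (simp add: m_def power2_eq_square)
    ultimately show ?thesis by simp
  qed
  finally show ?thesis using ab by (simp add: pos_divide_le_eq)
qed simp

text \<open>The integral is a pointwise limit of Riemann sums, each of which involves finitely many
  values of the path.\<close>

lemma borel_measurable_path_integral:
  fixes f :: "'a \<Rightarrow> real \<Rightarrow> real"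
  assumes x: "0 \<le> x" and cont: "\<And>\<omega>. \<omega> \<in> space M \<Longrightarrow> continuous_on {0..x} (f \<omega>)"
    and meas: "\<And>t. t \<in> {0..x} \<Longrightarrow> (\<lambda>\<omega>. f \<omega> t) \<in> borel_measurable M"
  shows "(\<lambda>\<omega>. integral {0..x} (f \<omega>)) \<in> borel_measurable M"
proof (rule borel_measurable_LIMSEQ_real)
  let ?S = "\<lambda>n \<omega>. x / real (Suc n) * (\<Sum>i=1..Suc n. f \<omega> (real i * (x / real (Suc n))))"
  have le: "real i * (x / real (Suc n)) \<in> {0..x}" if "i \<in> {1..Suc n}" for i n
  proof -
    have "real i * x \<le> real (Suc n) * x" using that x by (intro mult_right_mono) auto
    then show ?thesis using x by (simp add: field_simps)
  qed
  show "?S n \<in> borel_measurable M" for n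
    using le by (intro borel_measurable_times borel_measurable_const borel_measurable_sum meas) 
  fix \<omega> assume w: "\<omega> \<in> space M"
  show "(\<lambda>n. ?S n \<omega>) \<longlonglongrightarrow> integral {0..x} (f \<omega>)"
  proof (rule LIMSEQ_I)
    fix e :: real assume e: "0 < e"
    have "uniformly_continuous_on {0..x} (f \<omega>)"
      by (rule compact_uniformly_continuous[OF cont[OF w] compact_Icc])
    \<comment> \<open>Dividing by \<open>x + 1\<close> instead of \<open>x\<close> covers the case
      \<open>x = 0\<close>.\<close>
    then obtain d where d: "d > 0"
      "\<And>s t. s \<in> {0..x} \<Longrightarrow> t \<in> {0..x} \<Longrightarrow> dist s t < d \<Longrightarrow> dist (f \<omega> s) (f \<omega> t) < e / (x + 1)"
      unfolding uniformly_continuous_on_def using e x by (metis add_nonneg_pos dist_commute divide_pos_pos zero_less_one)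
    obtain n0 where n0: "real n0 > x / d" using reals_Archimedean2 by blast
    show "\<exists>n0. \<forall>n\<ge>n0. norm (?S n \<omega> - integral {0..x} (f \<omega>)) < e"
    proof (intro exI[of _ n0] allI impI)
      fix n assume n: "n \<ge> n0"
      let ?\<delta> = "x / real (Suc n)"
      have eq: "real (Suc n) * ?\<delta> = x" by simp
      have \<delta>: "0 \<le> ?\<delta>" using x by simp
      have "x / d < real (Suc n)" using n0 n by linarith
      then have \<delta>d: "?\<delta> < d" using d(1) by (simp add: field_simps)
      have "\<bar>?\<delta> * (\<Sum>i=1..Suc n. f \<omega> (real i * ?\<delta>)) - integral {0..real (Suc n) * ?\<delta>} (f \<omega>)\<bar>
        \<le> e / (x + 1) * (real (Suc n) * ?\<delta>)"
      proof (rule riemann_sum_bound)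
        show "continuous_on {0..real (Suc n) * ?\<delta>} (f \<omega>)" unfolding eq by (rule cont[OF w])
        fix i r assume i: "i \<in> {1..Suc n}" and r: "r \<in> {(real i - 1) * ?\<delta>..real i * ?\<delta>}"
        have "0 \<le> (real i - 1) * ?\<delta>" using i x by (intro mult_nonneg_nonneg) auto
        then have "r \<in> {0..x}" using le[OF i] r by auto
        moreover have "dist (real i * ?\<delta>) r < d"
        proof -
          have "real i * ?\<delta> - r \<le> ?\<delta>" "0 \<le> real i * ?\<delta> - r" using r
            by (simp_all only: left_diff_distrib mult_1 atLeastAtMost_iff) linarith+
          then show ?thesis using \<delta>d unfolding dist_real_def by linarith
        qed
        ultimately show "\<bar>f \<omega> (real i * ?\<delta>) - f \<omega> r\<bar> \<le> e / (x + 1)"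
          using d(2)[OF le[OF i], of r] by (simp add: dist_real_def)
      qed (rule \<delta>)
      also have "\<dots> < e" unfolding eq using e x by (simp add: field_simps)
      finally show "norm (?S n \<omega> - integral {0..x} (f \<omega>)) < e" unfolding eq by simp
    qed
  qed
qed

section \<open>The limit functional\<close>

definition path_int :: "real \<Rightarrow> (real \<Rightarrow> real) \<Rightarrow> real \<Rightarrow> real" where
  "path_int \<theta> \<beta> r = integral {0..min r \<theta>} \<beta>"

text \<open>The factor \<open>\<zeta> / s\<close> is left out, so that the functional is Lipschitz
  on the whole unit interval, including 0.\<close>

definition lim_num :: "(real \<Rightarrow> real) \<Rightarrow> real \<Rightarrow> real \<Rightarrow> (real \<Rightarrow> real) \<Rightarrow> real \<Rightarrow> real" where
  "lim_num K \<zeta> \<theta> \<beta> s = integral {0..s} (\<lambda>r. (path_int \<theta> \<beta> r)\<^sup>2 * K (\<zeta> * (r - s)))"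

definition lim_den :: "real \<Rightarrow> (real \<Rightarrow> real) \<Rightarrow> real \<Rightarrow> real" where
  "lim_den \<theta> \<beta> s = integral {0..min s \<theta>} (\<lambda>t. (\<beta> t)\<^sup>2)"

lemma U_limit_eq: "U_limit K \<zeta> \<theta> \<beta> s = (\<zeta> / s * lim_num K \<zeta> \<theta> \<beta> s) / lim_den \<theta> \<beta> s"
  by (simp add: U_limit_def lim_num_def lim_den_def path_int_def)

lemma U_limit_scale:
  assumes "\<sigma> \<noteq> 0"
  shows "U_limit K \<zeta> \<theta> (\<lambda>t. \<sigma> * \<beta> t) = U_limit K \<zeta> \<theta> \<beta>"
proof
  fix s
  have "lim_num K \<zeta> \<theta> (\<lambda>t. \<sigma> * \<beta> t) s = \<sigma>\<^sup>2 * lim_num K \<zeta> \<theta> \<beta> s"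
    unfolding lim_num_def path_int_def
    by (subst integral_mult_right[symmetric]) (simp add: power_mult_distrib mult.assoc)
  moreover have "lim_den \<theta> (\<lambda>t. \<sigma> * \<beta> t) s = \<sigma>\<^sup>2 * lim_den \<theta> \<beta> s"
    unfolding lim_den_def by (simp add: power_mult_distrib)
  ultimately show "U_limit K \<zeta> \<theta> (\<lambda>t. \<sigma> * \<beta> t) s = U_limit K \<zeta> \<theta> \<beta> s"
    using assms by (simp add: U_limit_eq)
qed

locale monitoring =
  fixes K :: "real \<Rightarrow> real" and L \<zeta> \<theta> :: real
  assumes K_nonneg: "\<And>x. 0 \<le> K x"
    and K_lip: "\<And>x y. \<bar>K x - K y\<bar> \<le> L * \<bar>x - y\<bar>"
    and \<zeta>_pos: "0 < \<zeta>" and \<theta>_pos: "0 < \<theta>" and \<theta>_less: "\<theta> < 1"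
begin

lemma L_nonneg: "0 \<le> L"
  using K_lip[of 0 1] by simp

lemma K_cont: "continuous_on S K"
proof -
  have "L-lipschitz_on S K" using L_nonneg K_lip by (intro lipschitz_onI) (auto simp: dist_real_def)
  then show ?thesis by (rule lipschitz_on_continuous_on)
qed

text \<open>The Lipschitz condition yields this bound on the interval of radius
  \<open>\<zeta>\<close> around 0, which contains \<open>\<zeta> * (r - s)\<close> for all
  \<open>r\<close> and \<open>s\<close> in the unit interval.\<close>

definition Kb :: real where "Kb = K 0 + L * \<zeta>"

lemma Kb_nonneg: "0 \<le> Kb"
  using K_nonneg[of 0] L_nonneg \<zeta>_pos by (simp add: Kb_def)

lemma K_le: "r \<in> {0..1} \<Longrightarrow> s \<in> {0..1} \<Longrightarrow> K (\<zeta> * (r - s)) \<le> Kb"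
proof -
  assume "r \<in> {0..1}" "s \<in> {0..1}"
  then have "\<bar>\<zeta> * (r - s)\<bar> \<le> \<zeta>" using \<zeta>_pos by (auto simp: abs_mult intro!: mult_left_le)
  then have "L * \<bar>\<zeta> * (r - s) - 0\<bar> \<le> L * \<zeta>" using L_nonneg by (intro mult_left_mono) auto
  then show ?thesis using K_lip[of "\<zeta> * (r - s)" 0] unfolding Kb_def by linarith
qed

section \<open>Regularity in time along a fixed continuous path\<close>

context
  fixes \<beta> :: "real \<Rightarrow> real" and C :: real
  assumes \<beta>_cont: "continuous_on {0..1} \<beta>" and \<beta>_le: "\<And>t. t \<in> {0..1} \<Longrightarrow> \<bar>\<beta> t\<bar> \<le> C"
begin

lemma C_nonneg: "0 \<le> C"
  using \<beta>_le[of 0] by simp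

lemma path_int_lip:
  assumes "r \<in> {0..1}" "r' \<in> {0..1}"
  shows "\<bar>path_int \<theta> \<beta> r - path_int \<theta> \<beta> r'\<bar> \<le> C * \<bar>r - r'\<bar>"
proof -
  have "\<bar>path_int \<theta> \<beta> r - path_int \<theta> \<beta> r'\<bar> \<le> C * \<bar>min r \<theta> - min r' \<theta>\<bar>"
    unfolding path_int_def
    by (rule integral_path_lipschitz[OF \<beta>_cont]) (use assms \<beta>_le \<theta>_pos in auto)
  also have "\<dots> \<le> C * \<bar>r - r'\<bar>" using C_nonneg by (intro mult_left_mono) auto
  finally show ?thesis .
qed

lemma path_int_le:
  assumes "r \<in> {0..1}" shows "\<bar>path_int \<theta> \<beta> r\<bar> \<le> C"
proof -
  have "\<bar>path_int \<theta> \<beta> r\<bar> \<le> C * (min r \<theta> - 0)" unfolding path_int_def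
    by (rule integral_bound_path[OF \<beta>_cont]) (use assms \<theta>_pos \<beta>_le in auto)
  also have "\<dots> \<le> C * 1" using C_nonneg assms by (intro mult_left_mono) auto
  finally show ?thesis by simp
qed

lemma path_int_sq_le:
  assumes "r \<in> {0..1}" shows "(path_int \<theta> \<beta> r)\<^sup>2 \<le> C\<^sup>2"
  using path_int_le[OF assms] by (metis abs_ge_zero power2_abs power_mono)

lemma path_int_cont: "continuous_on {0..1} (path_int \<theta> \<beta>)"
proof -
  have "C-lipschitz_on {0..1} (path_int \<theta> \<beta>)"
    using path_int_lip C_nonneg by (intro lipschitz_onI) (auto simp: dist_real_def)
  then show ?thesis by (rule lipschitz_on_continuous_on)
qed

lemma num_integrand_cont: "continuous_on {0..1} (\<lambda>r. (path_int \<theta> \<beta> r)\<^sup>2 * K (\<zeta> * (r - s)))"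
  by (intro continuous_intros path_int_cont continuous_on_compose2[OF K_cont[of UNIV]]) auto

lemma num_integrand_le:
  assumes "r \<in> {0..1}" "s \<in> {0..1}"
  shows "\<bar>(path_int \<theta> \<beta> r)\<^sup>2 * K (\<zeta> * (r - s))\<bar> \<le> C\<^sup>2 * Kb"
proof -
  have "(path_int \<theta> \<beta> r)\<^sup>2 * K (\<zeta> * (r - s)) \<le> C\<^sup>2 * Kb"
    using assms path_int_sq_le K_le K_nonneg by (intro mult_mono) auto
  then show ?thesis using K_nonneg by simp
qed

text \<open>Time enters twice, as the upper limit of integration and inside the kernel. The two
  occurrences are changed one after the other and give the two summands of the constant.\<close>

lemma lim_num_lip:
  assumes s: "s \<in> {0..1}" and s': "s' \<in> {0..1}"
  shows "\<bar>lim_num K \<zeta> \<theta> \<beta> s - lim_num K \<zeta> \<theta> \<beta> s'\<bar> \<le> (C\<^sup>2 * Kb + C\<^sup>2 * L * \<zeta>) * \<bar>s - s'\<bar>"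
proof -
  let ?f = "\<lambda>s r. (path_int \<theta> \<beta> r)\<^sup>2 * K (\<zeta> * (r - s))"
  have 1: "\<bar>integral {0..s} (?f s) - integral {0..s'} (?f s)\<bar> \<le> C\<^sup>2 * Kb * \<bar>s - s'\<bar>"
    by (rule integral_path_lipschitz[OF num_integrand_cont s' s num_integrand_le]) (use s in auto)
  have "\<bar>integral {0..s'} (\<lambda>r. ?f s r - ?f s' r)\<bar> \<le> C\<^sup>2 * L * \<zeta> * \<bar>s - s'\<bar> * (s' - 0)"
  proof (rule integral_bound_path)
    fix r assume r: "r \<in> {0..s'}"
    have "\<bar>?f s r - ?f s' r\<bar> = (path_int \<theta> \<beta> r)\<^sup>2 * \<bar>K (\<zeta> * (r - s)) - K (\<zeta> * (r - s'))\<bar>"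
      by (simp add: abs_mult flip: right_diff_distrib)
    also have "\<dots> \<le> C\<^sup>2 * (L * \<bar>\<zeta> * (r - s) - \<zeta> * (r - s')\<bar>)"
      using r s' by (intro mult_mono path_int_sq_le K_lip) auto
    also have "\<zeta> * (r - s) - \<zeta> * (r - s') = \<zeta> * (s' - s)" by (simp add: algebra_simps)
    also have "C\<^sup>2 * (L * \<bar>\<zeta> * (s' - s)\<bar>) = C\<^sup>2 * L * \<zeta> * \<bar>s - s'\<bar>"
      using \<zeta>_pos by (simp add: abs_mult abs_minus_commute)
    finally show "\<bar>?f s r - ?f s' r\<bar> \<le> C\<^sup>2 * L * \<zeta> * \<bar>s - s'\<bar>" .
  qed (use s' in \<open>auto intro!: continuous_intros num_integrand_cont\<close>)
  also have "integral {0..s'} (\<lambda>r. ?f s r - ?f s' r) = integral {0..s'} (?f s) - integral {0..s'} (?f s')"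
    using s' by (intro Henstock_Kurzweil_Integration.integral_diff integrable_on_path num_integrand_cont) auto
  also have "C\<^sup>2 * L * \<zeta> * \<bar>s - s'\<bar> * (s' - 0) \<le> C\<^sup>2 * L * \<zeta> * \<bar>s - s'\<bar> * 1"
    using s' L_nonneg \<zeta>_pos by (intro mult_left_mono) auto
  finally have 2: "\<bar>integral {0..s'} (?f s) - integral {0..s'} (?f s')\<bar> \<le> C\<^sup>2 * L * \<zeta> * \<bar>s - s'\<bar>" by simp
  have "(C\<^sup>2 * Kb + C\<^sup>2 * L * \<zeta>) * \<bar>s - s'\<bar> = C\<^sup>2 * Kb * \<bar>s - s'\<bar> + C\<^sup>2 * L * \<zeta> * \<bar>s - s'\<bar>"
    by (simp add: algebra_simps)
  then show ?thesis using 1 2 unfolding lim_num_def by linarith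
qed

lemma lim_num_cont: "continuous_on {0..1} (lim_num K \<zeta> \<theta> \<beta>)"
proof -
  have "(C\<^sup>2 * Kb + C\<^sup>2 * L * \<zeta>)-lipschitz_on {0..1} (lim_num K \<zeta> \<theta> \<beta>)"
    using lim_num_lip L_nonneg Kb_nonneg \<zeta>_pos by (intro lipschitz_onI) (auto simp: dist_real_def)
  then show ?thesis by (rule lipschitz_on_continuous_on)
qed

lemma lim_num_nonneg: "s \<in> {0..1} \<Longrightarrow> 0 \<le> lim_num K \<zeta> \<theta> \<beta> s"
  unfolding lim_num_def using K_nonneg
  by (intro Henstock_Kurzweil_Integration.integral_nonneg integrable_on_path num_integrand_cont) auto

lemma sq_cont: "continuous_on {0..1} (\<lambda>t. (\<beta> t)\<^sup>2)"
  by (intro continuous_intros \<beta>_cont)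

lemma sq_le: "t \<in> {0..1} \<Longrightarrow> \<bar>(\<beta> t)\<^sup>2\<bar> \<le> C\<^sup>2"
  using \<beta>_le[of t] by (simp add: abs_le_square_iff[symmetric] C_nonneg)

lemma lim_den_lip:
  assumes "s \<in> {0..1}" "s' \<in> {0..1}"
  shows "\<bar>lim_den \<theta> \<beta> s - lim_den \<theta> \<beta> s'\<bar> \<le> C\<^sup>2 * \<bar>s - s'\<bar>"
proof -
  have "\<bar>lim_den \<theta> \<beta> s - lim_den \<theta> \<beta> s'\<bar> \<le> C\<^sup>2 * \<bar>min s \<theta> - min s' \<theta>\<bar>"
    unfolding lim_den_def
    by (rule integral_path_lipschitz[OF sq_cont _ _ sq_le]) (use assms \<theta>_pos in auto)
  also have "\<dots> \<le> C\<^sup>2 * \<bar>s - s'\<bar>" by (intro mult_left_mono) auto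
  finally show ?thesis .
qed

lemma lim_den_cont: "continuous_on {0..1} (lim_den \<theta> \<beta>)"
proof -
  have "(C\<^sup>2)-lipschitz_on {0..1} (lim_den \<theta> \<beta>)"
    using lim_den_lip by (intro lipschitz_onI) (auto simp: dist_real_def)
  then show ?thesis by (rule lipschitz_on_continuous_on)
qed

lemma lim_den_mono:
  assumes "0 \<le> s" "s \<le> s'" "s' \<le> 1"
  shows "lim_den \<theta> \<beta> s \<le> lim_den \<theta> \<beta> s'"
  unfolding lim_den_def
  by (rule integral_subset_le) (use assms in \<open>auto intro!: integrable_on_path sq_cont\<close>)

lemma lim_den_nonneg: "0 \<le> lim_den \<theta> \<beta> s" if "s \<in> {0..1}"
  unfolding lim_den_def using that
  by (intro Henstock_Kurzweil_Integration.integral_nonneg integrable_on_path sq_cont) auto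

text \<open>Where the denominator vanishes, Cauchy--Schwarz bounds the ratio by the distance to that point,
  so that the value 0 assigned by division by zero is the continuous extension.\<close>

lemma U_limit_near_zero:
  assumes s0: "s0 \<in> {0<..1}" "lim_den \<theta> \<beta> s0 = 0" and s: "s \<in> {0<..1}"
  shows "\<bar>U_limit K \<zeta> \<theta> \<beta> s\<bar> \<le> \<zeta> * Kb * \<bar>s - s0\<bar>"
proof (cases "lim_den \<theta> \<beta> s = 0")
  case True
  then show ?thesis using \<zeta>_pos Kb_nonneg by (simp add: U_limit_eq)
next
  case False
  define m0 where "m0 = min s0 \<theta>"
  have m0: "m0 \<in> {0<..1}" using s0 \<theta>_pos by (auto simp: m0_def)
  have pos: "lim_den \<theta> \<beta> s > 0" using False lim_den_nonneg[of s] s by auto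
  \<comment> \<open>The denominator is nondecreasing in time, so it can be positive only after
    \<open>s0\<close>.\<close>
  have less: "s0 < s" using lim_den_mono[of s s0] s s0 pos by force
  have zero: "\<beta> t = 0" if "t \<in> {0..m0}" for t
  proof -
    have "\<forall>t\<in>{0..m0}. (\<beta> t)\<^sup>2 = 0"
    proof (rule integral_eq_0_iff[THEN iffD1])
      show "continuous_on {0..m0} (\<lambda>t. (\<beta> t)\<^sup>2)" by (rule continuous_on_subset[OF sq_cont]) (use m0 in auto)
      show "integral {0..m0} (\<lambda>t. (\<beta> t)\<^sup>2) = 0" using s0(2) by (simp add: lim_den_def m0_def)
    qed (use m0 in auto)
    then show ?thesis using that by auto
  qed
  \<comment> \<open>Only the stretch of the path after \<open>m0\<close> contributes to its
    integral. That stretch has length at most \<open>s - s0\<close>, and its square integral is part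
    of the denominator at \<open>s\<close>.\<close>
  have A: "(path_int \<theta> \<beta> r)\<^sup>2 \<le> (s - s0) * lim_den \<theta> \<beta> s" if r: "r \<in> {0..s}" for r
  proof (cases "min r \<theta> \<le> m0")
    case True
    have "integral {0..min r \<theta>} \<beta> = integral {0..min r \<theta>} (\<lambda>_. 0)"
      by (rule Henstock_Kurzweil_Integration.integral_cong) (use zero True in auto)
    then show ?thesis using less pos by (simp add: path_int_def)
  next
    case F: False
    let ?m = "min r \<theta>"
    have rm: "m0 \<le> ?m" "?m \<le> 1" "?m \<le> min s \<theta>" using F r s by auto
    have sub: "{m0..?m} \<subseteq> {0..1}" using m0 rm by auto
    have "integral {0..?m} \<beta> = integral {0..m0} \<beta> + integral {m0..?m} \<beta>"
      using m0 rm by (intro Henstock_Kurzweil_Integration.integral_combine[symmetric] integrable_on_path[OF \<beta>_cont]) auto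
    also have "integral {0..m0} \<beta> = integral {0..m0} (\<lambda>_. 0)"
      by (rule Henstock_Kurzweil_Integration.integral_cong) (use zero in auto)
    finally have eq: "path_int \<theta> \<beta> r = integral {m0..?m} \<beta>" by (simp add: path_int_def)
    have "(integral {m0..?m} \<beta>)\<^sup>2 \<le> integral {m0..?m} (\<lambda>t. (\<beta> t)\<^sup>2) * (?m - m0)"
      using rm by (intro integral_sq_le continuous_on_subset[OF \<beta>_cont sub]) auto
    also have "integral {m0..?m} (\<lambda>t. (\<beta> t)\<^sup>2) * (?m - m0) \<le> lim_den \<theta> \<beta> s * (s - s0)"
    proof (rule mult_mono)
      show "integral {m0..?m} (\<lambda>t. (\<beta> t)\<^sup>2) \<le> lim_den \<theta> \<beta> s" unfolding lim_den_def
        using m0 rm s by (intro integral_subset_le integrable_on_path[OF sq_cont]) auto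
      show "?m - m0 \<le> s - s0" using r less F unfolding m0_def by auto
    qed (use rm pos in auto)
    finally show ?thesis unfolding eq by (simp add: mult.commute)
  qed
  have "\<bar>lim_num K \<zeta> \<theta> \<beta> s\<bar> \<le> ((s - s0) * lim_den \<theta> \<beta> s) * Kb * (s - 0)"
    unfolding lim_num_def
  proof (rule integral_bound_path[OF num_integrand_cont])
    fix r assume r: "r \<in> {0..s}"
    have "(path_int \<theta> \<beta> r)\<^sup>2 * K (\<zeta> * (r - s)) \<le> ((s - s0) * lim_den \<theta> \<beta> s) * Kb"
      using A[OF r] r s K_nonneg less pos by (intro mult_mono K_le) auto
    then show "\<bar>(path_int \<theta> \<beta> r)\<^sup>2 * K (\<zeta> * (r - s))\<bar> \<le> ((s - s0) * lim_den \<theta> \<beta> s) * Kb"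
      using K_nonneg by simp
  qed (use s in auto)
  then have "\<zeta> / s * \<bar>lim_num K \<zeta> \<theta> \<beta> s\<bar> \<le> \<zeta> / s * (((s - s0) * lim_den \<theta> \<beta> s) * Kb * s)"
    using \<zeta>_pos s by (intro mult_left_mono) auto
  also have "\<dots> = \<zeta> * Kb * (s - s0) * lim_den \<theta> \<beta> s" using s by simp
  finally have "\<zeta> / s * \<bar>lim_num K \<zeta> \<theta> \<beta> s\<bar> / lim_den \<theta> \<beta> s \<le> \<zeta> * Kb * (s - s0)"
    using pos by (simp only: pos_divide_le_eq)
  moreover have "\<bar>U_limit K \<zeta> \<theta> \<beta> s\<bar> = \<zeta> / s * \<bar>lim_num K \<zeta> \<theta> \<beta> s\<bar> / lim_den \<theta> \<beta> s"
    using \<zeta>_pos s pos by (simp add: U_limit_eq abs_mult)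
  ultimately show ?thesis using less by simp
qed

text \<open>Paths with a vanishing denominator are included on purpose: the limit process has to
  take values in the Skorohod space at every sample point, not merely almost surely.\<close>

lemma U_limit_cont: "continuous_on {0<..1} (U_limit K \<zeta> \<theta> \<beta>)"
  unfolding continuous_on_def
proof
  fix s0 :: real assume s0: "s0 \<in> {0<..1}"
  show "(U_limit K \<zeta> \<theta> \<beta> \<longlongrightarrow> U_limit K \<zeta> \<theta> \<beta> s0) (at s0 within {0<..1})"
  proof (cases "lim_den \<theta> \<beta> s0 = 0")
    case True
    have "(U_limit K \<zeta> \<theta> \<beta> \<longlongrightarrow> 0) (at s0 within {0<..1})"
    proof (rule Lim_null_comparison)
      show "\<forall>\<^sub>F s in at s0 within {0<..1}. norm (U_limit K \<zeta> \<theta> \<beta> s) \<le> \<zeta> * Kb * \<bar>s - s0\<bar>"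
        unfolding eventually_at_filter using U_limit_near_zero[OF _ True] s0 by auto
      have "((\<lambda>s. \<zeta> * Kb * \<bar>s - s0\<bar>) \<longlongrightarrow> \<zeta> * Kb * \<bar>s0 - s0\<bar>) (at s0 within {0<..1})"
        by (intro tendsto_intros)
      then show "((\<lambda>s. \<zeta> * Kb * \<bar>s - s0\<bar>) \<longlongrightarrow> 0) (at s0 within {0<..1})" by simp
    qed
    then show ?thesis using True by (simp add: U_limit_eq)
  next
    case False
    have "{0<..1} \<subseteq> {0..(1::real)}" by auto
    then have "(lim_num K \<zeta> \<theta> \<beta> \<longlongrightarrow> lim_num K \<zeta> \<theta> \<beta> s0) (at s0 within {0<..1})"
      "(lim_den \<theta> \<beta> \<longlongrightarrow> lim_den \<theta> \<beta> s0) (at s0 within {0<..1})"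
      using continuous_on_subset[OF lim_num_cont] continuous_on_subset[OF lim_den_cont] s0
      by (auto simp: continuous_on_def)
    then show ?thesis unfolding U_limit_eq using False s0 by (intro tendsto_intros) auto
  qed
qed

lemma U_limit_nonneg: "s \<in> {0<..1} \<Longrightarrow> 0 \<le> U_limit K \<zeta> \<theta> \<beta> s"
  unfolding U_limit_eq using lim_num_nonneg[of s] lim_den_nonneg[of s] \<zeta>_pos by auto

end

section \<open>Dependence of numerator and denominator on the path\<close>

lemma path_int_diff_le:
  assumes "continuous_on {0..1} f" "continuous_on {0..1} g" "\<And>t. t \<in> {0..1} \<Longrightarrow> \<bar>f t - g t\<bar> \<le> e" "r \<in> {0..1}"
  shows "\<bar>path_int \<theta> f r - path_int \<theta> g r\<bar> \<le> e"
proof -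
  have "path_int \<theta> f r - path_int \<theta> g r = path_int \<theta> (\<lambda>t. f t - g t) r"
    unfolding path_int_def using assms \<theta>_pos
    by (intro Henstock_Kurzweil_Integration.integral_diff[symmetric] integrable_on_path) auto
  also have "\<bar>\<dots>\<bar> \<le> e" by (rule path_int_le) (use assms in \<open>auto intro!: continuous_intros\<close>)
  finally show ?thesis .
qed

lemma sq_diff_le:
  fixes a b :: real
  assumes "\<bar>a - b\<bar> \<le> e" "\<bar>b\<bar> \<le> C"
  shows "\<bar>a\<^sup>2 - b\<^sup>2\<bar> \<le> e * (2 * C + e)"
proof -
  have "\<bar>a\<^sup>2 - b\<^sup>2\<bar> = \<bar>a - b\<bar> * \<bar>a + b\<bar>" by (simp add: power2_eq_square algebra_simps flip: abs_mult)
  also have "\<dots> \<le> e * (2 * C + e)" using assms by (intro mult_mono) auto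
  finally show ?thesis .
qed

lemma lim_num_diff_le:
  assumes f: "continuous_on {0..1} f" and g: "continuous_on {0..1} g"
    and fg: "\<And>t. t \<in> {0..1} \<Longrightarrow> \<bar>f t - g t\<bar> \<le> e"
    and C: "\<And>t. t \<in> {0..1} \<Longrightarrow> \<bar>g t\<bar> \<le> C" and s: "s \<in> {0..1}"
  shows "\<bar>lim_num K \<zeta> \<theta> f s - lim_num K \<zeta> \<theta> g s\<bar> \<le> e * (2 * C + e) * Kb"
proof -
  let ?F = "\<lambda>r. (path_int \<theta> f r)\<^sup>2 * K (\<zeta> * (r - s))" and ?G = "\<lambda>r. (path_int \<theta> g r)\<^sup>2 * K (\<zeta> * (r - s))"
  obtain C' where C': "\<And>t. t \<in> {0..1} \<Longrightarrow> \<bar>f t\<bar> \<le> C'" using path_bounded[OF f] by blast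
  have FG: "continuous_on {0..1} ?F" "continuous_on {0..1} ?G"
    using num_integrand_cont[OF f C'] num_integrand_cont[OF g C] by auto
  have e: "0 \<le> e" "0 \<le> C" using fg[of 0] C[of 0] by auto
  have "\<bar>integral {0..s} (\<lambda>r. ?F r - ?G r)\<bar> \<le> e * (2 * C + e) * Kb * (s - 0)"
  proof (rule integral_bound_path)
    fix r assume r: "r \<in> {0..s}"
    have "\<bar>?F r - ?G r\<bar> = \<bar>(path_int \<theta> f r)\<^sup>2 - (path_int \<theta> g r)\<^sup>2\<bar> * K (\<zeta> * (r - s))"
      using K_nonneg by (simp add: abs_mult flip: left_diff_distrib)
    also have "\<dots> \<le> e * (2 * C + e) * Kb"
      using r s K_nonneg e
      by (intro mult_mono sq_diff_le path_int_diff_le[OF f g fg] path_int_le[OF g C] K_le) auto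
    finally show "\<bar>?F r - ?G r\<bar> \<le> e * (2 * C + e) * Kb" .
  qed (use s in \<open>auto intro!: continuous_intros FG\<close>)
  also have "integral {0..s} (\<lambda>r. ?F r - ?G r) = lim_num K \<zeta> \<theta> f s - lim_num K \<zeta> \<theta> g s"
    unfolding lim_num_def
    using s by (intro Henstock_Kurzweil_Integration.integral_diff integrable_on_path FG) auto
  also have "e * (2 * C + e) * Kb * (s - 0) \<le> e * (2 * C + e) * Kb * 1"
    using s e Kb_nonneg by (intro mult_left_mono) auto
  finally show ?thesis by simp
qed

lemma lim_den_diff_le:
  assumes f: "continuous_on {0..1} f" and g: "continuous_on {0..1} g"
    and fg: "\<And>t. t \<in> {0..1} \<Longrightarrow> \<bar>f t - g t\<bar> \<le> e"
    and C: "\<And>t. t \<in> {0..1} \<Longrightarrow> \<bar>g t\<bar> \<le> C" and s: "s \<in> {0..1}"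
  shows "\<bar>lim_den \<theta> f s - lim_den \<theta> g s\<bar> \<le> e * (2 * C + e)"
proof -
  have e: "0 \<le> e" "0 \<le> C" using fg[of 0] C[of 0] by auto
  have cont: "continuous_on {0..1} (\<lambda>t. (f t)\<^sup>2)" "continuous_on {0..1} (\<lambda>t. (g t)\<^sup>2)"
    by (intro continuous_intros f g)+
  have "\<bar>integral {0..min s \<theta>} (\<lambda>t. (f t)\<^sup>2 - (g t)\<^sup>2)\<bar> \<le> e * (2 * C + e) * (min s \<theta> - 0)"
    by (rule integral_bound_path) (use s \<theta>_pos fg C in \<open>auto intro!: continuous_intros cont sq_diff_le\<close>)
  also have "integral {0..min s \<theta>} (\<lambda>t. (f t)\<^sup>2 - (g t)\<^sup>2) = lim_den \<theta> f s - lim_den \<theta> g s"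
    unfolding lim_den_def
    using s by (intro Henstock_Kurzweil_Integration.integral_diff integrable_on_path cont) auto
  also have "e * (2 * C + e) * (min s \<theta> - 0) \<le> e * (2 * C + e) * 1"
    using s e by (intro mult_left_mono) auto
  finally show ?thesis by simp
qed

end

section \<open>Convergence of the discrete functionals\<close>

text \<open>The best bound at each index serves as \<open>E\<close>. One null function in place of a
  separate statement for each tolerance lets explicit error terms be combined and sent to zero by
  limit rules.\<close>

lemma eventually_uniform_bound:
  fixes g :: "'i \<Rightarrow> 's \<Rightarrow> real"
  assumes "\<And>e. 0 < e \<Longrightarrow> \<forall>\<^sub>F i in F. \<forall>s\<in>S i. \<bar>g i s\<bar> \<le> e"
  obtains E where "(E \<longlongrightarrow> 0) F" "\<forall>\<^sub>F i in F. 0 \<le> E i \<and> (\<forall>s\<in>S i. \<bar>g i s\<bar> \<le> E i)"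
proof -
  define A where "A i = {e. 0 \<le> e \<and> (\<forall>s\<in>S i. \<bar>g i s\<bar> \<le> e)}" for i
  have bdd: "bdd_below (A i)" for i by (rule bdd_belowI[of _ 0]) (auto simp: A_def)
  have ne: "\<forall>\<^sub>F i in F. A i \<noteq> {}"
    using assms[OF zero_less_one] 
  proof eventually_elim
    case (elim i)
    then have "1 \<in> A i" by (simp add: A_def)
    then show ?case by blast
  qed
  show ?thesis
  proof (rule that[of "\<lambda>i. Inf (A i)"])
    show "\<forall>\<^sub>F i in F. 0 \<le> Inf (A i) \<and> (\<forall>s\<in>S i. \<bar>g i s\<bar> \<le> Inf (A i))"
      using ne by eventually_elim (auto intro!: cInf_greatest simp: A_def)
    show "((\<lambda>i. Inf (A i)) \<longlongrightarrow> 0) F"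
    proof (rule tendstoI)
      fix e :: real assume e: "0 < e"
      then have "\<forall>\<^sub>F i in F. \<forall>s\<in>S i. \<bar>g i s\<bar> \<le> e/2" by (intro assms) simp
      then show "\<forall>\<^sub>F i in F. dist (Inf (A i)) 0 < e" using ne
      proof eventually_elim
        case (elim i)
        then have "Inf (A i) \<le> e/2" using e by (intro cInf_lower[OF _ bdd]) (auto simp: A_def)
        moreover have "0 \<le> Inf (A i)" by (rule cInf_greatest[OF elim(2)]) (auto simp: A_def)
        ultimately show ?case using e by simp
      qed
    qed
  qed
qed

lemma nat_floor_grid: "1 \<le> N \<Longrightarrow> nat \<lfloor>real N * (real j / real N)\<rfloor> = j"
  by simp

context monitoring
begin

text \<open>The change-point model read along a single trajectory \<open>v\<close>, so that
  convergence can be proved for deterministic sequences.\<close>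

definition obs :: "nat \<Rightarrow> real \<Rightarrow> (nat \<Rightarrow> real) \<Rightarrow> nat \<Rightarrow> real" where
  "obs N \<eta> v j = (if j < nat \<lfloor>real N * \<theta>\<rfloor> then \<Sum>k=0..j. v k else \<eta> * v j)"

section \<open>Deterministic error bounds at one sample size, with a single tolerance
  \<open>e\<close>\<close>

context
  fixes N :: nat and v :: "nat \<Rightarrow> real" and x :: "real \<Rightarrow> real" and e C \<eta> :: real and m :: nat
  assumes N: "1 \<le> N" and m_def: "m = nat \<lfloor>real N * \<theta>\<rfloor>" and m: "1 \<le> m"
    and x_cont: "continuous_on {0..1} x"
    and x_le: "\<And>s. s \<in> {0..1} \<Longrightarrow> \<bar>x s\<bar> \<le> C"
    and S: "\<And>s. s \<in> {0..1} \<Longrightarrow> \<bar>(\<Sum>j=1..nat \<lfloor>real N * s\<rfloor>. v j) / sqrt (real N) - x s\<bar> \<le> e"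
    and v0: "\<bar>v 0\<bar> / sqrt (real N) \<le> e"
    and modulus: "\<And>s t. s \<in> {0..1} \<Longrightarrow> t \<in> {0..1} \<Longrightarrow> \<bar>s - t\<bar> \<le> 1 / real N \<Longrightarrow> \<bar>x s - x t\<bar> \<le> e"
begin

lemma e_C_nonneg: "0 \<le> e" "0 \<le> C"
  using modulus[of 0 0] x_le[of 0] by auto

lemma m_bounds: "real m / real N \<le> \<theta>" "\<theta> \<le> (real m + 1) / real N" "m \<le> N"
proof -
  have p: "0 \<le> real N * \<theta>" using \<theta>_pos by simp
  then have m': "real m \<le> real N * \<theta>" "real N * \<theta> < real m + 1" unfolding m_def by linarith+
  then show "real m / real N \<le> \<theta>" "\<theta> \<le> (real m + 1) / real N" using N by (auto simp: field_simps)
  have "real N * \<theta> \<le> real N" using \<theta>_less by (simp add: mult_left_le)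
  then show "m \<le> N" using m' by linarith
qed

text \<open>\<open>m\<close> is the first index after the change, so the first block stops at
  \<open>m - 1\<close>; the second block is empty as long as \<open>n < m\<close>.\<close>

lemma sum_split:
  fixes f g :: "nat \<Rightarrow> real"
  assumes "\<And>j. j < m \<Longrightarrow> y j = f j" "\<And>j. m \<le> j \<Longrightarrow> y j = g j"
  shows "(\<Sum>j=1..n. y j) = (\<Sum>j=1..min n (m - 1). f j) + (\<Sum>j=m..n. g j)"
proof -
  have "{1..n} = {1..min n (m - 1)} \<union> {m..n}" using m by auto
  then have "(\<Sum>j=1..n. y j) = (\<Sum>j=1..min n (m - 1). y j) + (\<Sum>j=m..n. y j)"
    by (simp only:) (rule sum.union_disjoint, use m in auto)
  moreover have "(\<Sum>j=1..min n (m - 1). y j) = (\<Sum>j=1..min n (m - 1). f j)"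
    by (rule sum.cong) (use assms m in auto)
  moreover have "(\<Sum>j=m..n. y j) = (\<Sum>j=m..n. g j)" by (rule sum.cong) (use assms in auto)
  ultimately show ?thesis by simp
qed

text \<open>One \<open>1 / N\<close> accounts for rounding \<open>\<theta>\<close> to the grid, the
  other for the last index \<open>m - 1\<close> in place of \<open>m\<close>.\<close>

lemma grid_min_diff:
  assumes "n \<le> N"
  shows "\<bar>real (min n (m - 1)) / real N - min (real n / real N) \<theta>\<bar> \<le> 2 / real N"
proof (cases "n < m")
  case True
  then have "real n / real N \<le> real m / real N" using N by (intro divide_right_mono) auto
  then have "real n / real N \<le> \<theta>" using m_bounds by linarith
  moreover have "min n (m - 1) = n" using True by auto
  ultimately show ?thesis by simp
next
  case False
  then have k: "real (min n (m - 1)) = real m - 1" using m by (simp add: min_def)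
  have "real m / real N \<le> real n / real N" using False N by (intro divide_right_mono) auto
  then have "real m / real N \<le> min (real n / real N) \<theta>" "min (real n / real N) \<theta> \<le> (real m + 1) / real N"
    using m_bounds by auto
  then show ?thesis unfolding k diff_divide_distrib add_divide_distrib by linarith
qed

lemma integral_grid_min_diff:
  assumes f: "continuous_on {0..1} f" and b: "\<And>s. s \<in> {0..1} \<Longrightarrow> \<bar>f s\<bar> \<le> b" and n: "n \<le> N"
  shows "\<bar>integral {0..real (min n (m - 1)) / real N} f - integral {0..min (real n / real N) \<theta>} f\<bar> \<le> 2 * b / real N"
proof -
  have b0: "0 \<le> b" using b[of 0] by simp
  have "\<bar>integral {0..real (min n (m - 1)) / real N} f - integral {0..min (real n / real N) \<theta>} f\<bar>
    \<le> b * \<bar>real (min n (m - 1)) / real N - min (real n / real N) \<theta>\<bar>"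
    by (rule integral_path_lipschitz[OF f _ _ b]) (use n N \<theta>_pos \<theta>_less in \<open>auto simp: field_simps min_def\<close>)
  also have "\<dots> \<le> b * (2 / real N)" by (rule mult_left_mono[OF grid_min_diff[OF n] b0])
  finally show ?thesis by (simp add: mult.commute)
qed

text \<open>The walk starts at index 0 and \<open>r\<close> is any point of the cell. The three
  errors are \<open>v 0\<close>, the approximation at the grid point, and the oscillation of
  \<open>x\<close> within the cell.\<close>

lemma grid_walk_diff:
  assumes j: "j \<in> {1..N}" and r: "r \<in> {(real j - 1) * (1 / real N)..real j * (1 / real N)}"
  shows "r \<in> {0..1}" "\<bar>(\<Sum>k=0..j. v k) / sqrt (real N) - x r\<bar> \<le> 3 * e"
proof -
  have j1: "real j / real N \<in> {0..1}" using j N by (auto simp: field_simps)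
  have "0 \<le> (real j - 1) * (1 / real N)" using j by (intro mult_nonneg_nonneg) auto
  then show r1: "r \<in> {0..1}" using r j1 by auto
  have "(\<Sum>k=0..j. v k) = v 0 + (\<Sum>k=1..j. v k)" by (simp add: sum.atLeast_Suc_atMost)
  then have "(\<Sum>k=0..j. v k) / sqrt (real N) = v 0 / sqrt (real N) + (\<Sum>k=1..j. v k) / sqrt (real N)"
    by (simp add: add_divide_distrib)
  moreover have "\<bar>v 0 / sqrt (real N)\<bar> \<le> e" using v0 by (simp add: abs_divide)
  moreover have "\<bar>(\<Sum>k=1..j. v k) / sqrt (real N) - x (real j / real N)\<bar> \<le> e"
    using S[OF j1] N by simp
  moreover have "\<bar>real j / real N - r\<bar> \<le> 1 / real N" using r by (auto simp: left_diff_distrib diff_divide_distrib abs_le_iff)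
  then have "\<bar>x (real j / real N) - x r\<bar> \<le> e" by (rule modulus[OF j1 r1])
  ultimately show "\<bar>(\<Sum>k=0..j. v k) / sqrt (real N) - x r\<bar> \<le> 3 * e" by linarith
qed

lemma walk_le:
  assumes "n \<le> N" shows "\<bar>\<Sum>k=1..n. v k\<bar> / sqrt (real N) \<le> C + e"
proof -
  have n: "real n / real N \<in> {0..1}" using assms N by (auto simp: field_simps)
  then show ?thesis using S[OF n] x_le[OF n] N by (auto simp: abs_divide simp flip: nat_floor_grid)
qed

text \<open>The sum after the change is a difference of two partial sums, each bounded by
  \<open>walk_le\<close>.\<close>

lemma tail_le:
  assumes n: "n \<le> N" shows "\<bar>\<Sum>k=m..n. v k\<bar> / sqrt (real N) \<le> 2 * (C + e)"
proof (cases "m \<le> n")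
  case True
  have "(\<Sum>k=1..n. v k) = (\<Sum>k=1..min n (m - 1). v k) + (\<Sum>k=m..n. v k)"
    by (rule sum_split) auto
  then have "\<bar>\<Sum>k=m..n. v k\<bar> \<le> \<bar>\<Sum>k=1..n. v k\<bar> + \<bar>\<Sum>k=1..min n (m - 1). v k\<bar>" by linarith
  then have "\<bar>\<Sum>k=m..n. v k\<bar> / sqrt (real N) \<le> (\<bar>\<Sum>k=1..n. v k\<bar> + \<bar>\<Sum>k=1..min n (m - 1). v k\<bar>) / sqrt (real N)"
    by (intro divide_right_mono) auto
  moreover have "min n (m - 1) \<le> N" using n by simp
  ultimately show ?thesis using walk_le[OF n] walk_le[of "min n (m - 1)"]
    unfolding add_divide_distrib distrib_left by linarith
qed (use e_C_nonneg in simp)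

text \<open>The errors are those of the Riemann sum before the change, of the cutoff
  \<open>m - 1\<close> against \<open>\<theta>\<close>, and of the observations after the change.
  The latter add up to order \<open>sqrt N\<close> only and are divided by
  \<open>N * sqrt N\<close>; this is why the limiting integral stops growing at
  \<open>\<theta>\<close>.\<close>

lemma discrete_path_int:
  assumes n: "n \<le> N"
  shows "\<bar>(\<Sum>j=1..n. obs N \<eta> v j) / (real N * sqrt (real N)) - path_int \<theta> x (real n / real N)\<bar>
    \<le> 3 * e + 2 * C / real N + \<bar>\<eta>\<bar> * (2 * (C + e)) / real N"
proof -
  define k where "k = min n (m - 1)"
  have k: "k \<le> N" using n by (simp add: k_def)
  have kN: "real k * (1 / real N) \<le> 1" using k N by (simp add: field_simps)
  have sum: "(\<Sum>j=1..n. obs N \<eta> v j) = (\<Sum>j=1..k. \<Sum>i=0..j. v i) + (\<Sum>j=m..n. \<eta> * v j)"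
    unfolding k_def by (rule sum_split) (auto simp: obs_def m_def)
  have "\<bar>1 / real N * (\<Sum>j=1..k. (\<Sum>i=0..j. v i) / sqrt (real N)) - integral {0..real k * (1 / real N)} x\<bar>
    \<le> 3 * e * (real k * (1 / real N))"
  proof (rule riemann_sum_bound)
    show "continuous_on {0..real k * (1 / real N)} x"
      by (rule continuous_on_subset[OF x_cont]) (use kN in auto)
  qed (use k grid_walk_diff in auto)
  also have "\<dots> \<le> 3 * e" using kN e_C_nonneg by (intro mult_left_le) auto
  finally have 1: "\<bar>(\<Sum>j=1..k. \<Sum>i=0..j. v i) / (real N * sqrt (real N)) - integral {0..real k / real N} x\<bar> \<le> 3 * e"
    by (simp add: sum_divide_distrib mult.commute)
  have 2: "\<bar>integral {0..real k / real N} x - path_int \<theta> x (real n / real N)\<bar> \<le> 2 * C / real N"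
    unfolding path_int_def k_def by (rule integral_grid_min_diff[OF x_cont x_le n])
  have "\<bar>(\<Sum>j=m..n. \<eta> * v j) / (real N * sqrt (real N))\<bar> = \<bar>\<eta>\<bar> * (\<bar>\<Sum>k=m..n. v k\<bar> / sqrt (real N)) / real N"
    by (simp add: abs_mult flip: sum_distrib_left)
  also have "\<dots> \<le> \<bar>\<eta>\<bar> * (2 * (C + e)) / real N"
    by (intro divide_right_mono mult_left_mono tail_le n) auto
  finally show ?thesis using 1 2 unfolding sum add_divide_distrib by linarith
qed

text \<open>Squares are nonnegative, so those after the change are dominated by the sum over the
  whole series, which \<open>sq\<close> controls.\<close>

lemma discrete_den:
  assumes n: "n \<le> N" and sq: "(\<Sum>j=1..N. (v j)\<^sup>2) / (real N)\<^sup>2 \<le> e"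
  shows "\<bar>(\<Sum>j=1..n. (obs N \<eta> v j)\<^sup>2) / (real N)\<^sup>2 - lim_den \<theta> x (real n / real N)\<bar>
    \<le> 3 * e * (2 * C + 3 * e) + 2 * C\<^sup>2 / real N + \<eta>\<^sup>2 * e"
proof -
  define k where "k = min n (m - 1)"
  have k: "k \<le> N" using n by (simp add: k_def)
  have kN: "real k * (1 / real N) \<le> 1" using k N by (simp add: field_simps)
  have sum: "(\<Sum>j=1..n. (obs N \<eta> v j)\<^sup>2) = (\<Sum>j=1..k. (\<Sum>i=0..j. v i)\<^sup>2) + (\<Sum>j=m..n. (\<eta> * v j)\<^sup>2)"
    unfolding k_def by (rule sum_split) (auto simp: obs_def m_def)
  note x2 = continuous_on_power[OF x_cont, of 2]
  have "\<bar>1 / real N * (\<Sum>j=1..k. ((\<Sum>i=0..j. v i) / sqrt (real N))\<^sup>2) - integral {0..real k * (1 / real N)} (\<lambda>t. (x t)\<^sup>2)\<bar>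
    \<le> 3 * e * (2 * C + 3 * e) * (real k * (1 / real N))"
  proof (rule riemann_sum_bound)
    show "continuous_on {0..real k * (1 / real N)} (\<lambda>t. (x t)\<^sup>2)"
      by (rule continuous_on_subset[OF x2]) (use kN in auto)
    fix j r assume "j \<in> {1..k}" "r \<in> {(real j - 1) * (1 / real N)..real j * (1 / real N)}"
    then show "\<bar>((\<Sum>i=0..j. v i) / sqrt (real N))\<^sup>2 - (x r)\<^sup>2\<bar> \<le> 3 * e * (2 * C + 3 * e)"
      using k grid_walk_diff[of j r] by (intro sq_diff_le x_le) auto
  qed simp
  also have "\<dots> \<le> 3 * e * (2 * C + 3 * e)" using kN e_C_nonneg by (intro mult_left_le) auto
  finally have 1: "\<bar>(\<Sum>j=1..k. (\<Sum>i=0..j. v i)\<^sup>2) / (real N)\<^sup>2 - integral {0..real k / real N} (\<lambda>t. (x t)\<^sup>2)\<bar>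
      \<le> 3 * e * (2 * C + 3 * e)"
    using N by (simp add: power_divide power2_eq_square[of "real N"] flip: sum_divide_distrib)
  have x2_le: "\<bar>(x s)\<^sup>2\<bar> \<le> C\<^sup>2" if "s \<in> {0..1}" for s by (rule sq_le[OF x_cont x_le that])
  have 2: "\<bar>integral {0..real k / real N} (\<lambda>t. (x t)\<^sup>2) - lim_den \<theta> x (real n / real N)\<bar> \<le> 2 * C\<^sup>2 / real N"
    unfolding lim_den_def k_def by (rule integral_grid_min_diff[OF x2 x2_le n])
  have "\<bar>(\<Sum>j=m..n. (\<eta> * v j)\<^sup>2) / (real N)\<^sup>2\<bar> = \<eta>\<^sup>2 * ((\<Sum>j=m..n. (v j)\<^sup>2) / (real N)\<^sup>2)"
    by (simp add: power_mult_distrib sum_nonneg flip: sum_distrib_left)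
  also have "\<dots> \<le> \<eta>\<^sup>2 * ((\<Sum>j=1..N. (v j)\<^sup>2) / (real N)\<^sup>2)"
    using m n by (intro mult_left_mono divide_right_mono sum_mono2) auto
  also have "\<dots> \<le> \<eta>\<^sup>2 * e" by (intro mult_left_mono sq) auto
  finally show ?thesis using 1 2 unfolding sum add_divide_distrib by linarith
qed

end

text \<open>\<open>a\<close> stands for the rescaled cumulative sums of the observations and
  \<open>H\<close> for \<open>N / h\<close>. \<open>e1\<close> bounds the error of \<open>a\<close>
  anywhere in a cell, \<open>e2\<close> that of the argument of the kernel.\<close>

lemma discrete_num:
  fixes a :: "nat \<Rightarrow> real"
  assumes N: "1 \<le> N" and n: "n \<le> N" and x: "continuous_on {0..1} x"
    and C: "\<And>s. s \<in> {0..1} \<Longrightarrow> \<bar>x s\<bar> \<le> C"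
    and a: "\<And>i. i \<le> N \<Longrightarrow> \<bar>a i - path_int \<theta> x (real i / real N)\<bar> \<le> e"
    and H: "\<bar>H - \<zeta>\<bar> \<le> e"
    and e1_def: "e1 = e + C / real N" and e2_def: "e2 = e + \<zeta> / real N"
  shows "\<bar>(\<Sum>i=1..n. H / real N * (a i)\<^sup>2 * K (H / real N * (real i - real n))) - \<zeta> * lim_num K \<zeta> \<theta> x (real n / real N)\<bar>
    \<le> e * ((C + e1)\<^sup>2 * (Kb + L * e2)) + \<zeta> * (e1 * (2 * C + e1) * (Kb + L * e2)) + \<zeta> * (C\<^sup>2 * (L * e2))"
    (is "_ \<le> ?E")
proof -
  let ?s = "real n / real N"
  have C0: "0 \<le> C" using C[of 0] by simp
  have e0: "0 \<le> e" using H by simp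
  have e1: "0 \<le> e1" "0 \<le> e2" using e0 C0 \<zeta>_pos by (auto simp: e1_def e2_def)
  have s: "?s \<in> {0..1}" using n N by (auto simp: field_simps)
  let ?f = "\<lambda>r. \<zeta> * ((path_int \<theta> x r)\<^sup>2 * K (\<zeta> * (r - ?s)))"
  let ?v = "\<lambda>i. H * (a i)\<^sup>2 * K (H / real N * (real i - real n))"
  have E0: "0 \<le> ?E"
    using e0 e1 C0 \<zeta>_pos Kb_nonneg L_nonneg by (intro add_nonneg_nonneg mult_nonneg_nonneg zero_le_power2) auto
  have f_cont: "continuous_on {0..1} ?f" by (intro continuous_intros num_integrand_cont[OF x C]) auto
  have "\<bar>1 / real N * (\<Sum>i=1..n. ?v i) - integral {0..real n * (1 / real N)} ?f\<bar> \<le> ?E * (real n * (1 / real N))"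
  proof (rule riemann_sum_bound)
    show "continuous_on {0..real n * (1 / real N)} ?f"
      by (rule continuous_on_subset[OF f_cont]) (use s in auto)
    fix i r assume i: "i \<in> {1..n}" and r: "r \<in> {(real i - 1) * (1 / real N)..real i * (1 / real N)}"
    have i1: "real i / real N \<in> {0..1}" using i n N by (auto simp: field_simps)
    have "0 \<le> (real i - 1) * (1 / real N)" using i by (intro mult_nonneg_nonneg) auto
    then have r1: "r \<in> {0..1}" using r i1 by auto
    have ir: "\<bar>real i / real N - r\<bar> \<le> 1 / real N"
      using r by (auto simp: left_diff_distrib diff_divide_distrib abs_le_iff)
    let ?A = "path_int \<theta> x r"
    have "\<bar>path_int \<theta> x (real i / real N) - ?A\<bar> \<le> C * \<bar>real i / real N - r\<bar>"
      by (rule path_int_lip[OF x C i1 r1])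
    also have "\<dots> \<le> C * (1 / real N)" using ir C0 by (intro mult_left_mono) auto
    finally have aA: "\<bar>a i - ?A\<bar> \<le> e1" using a[of i] i n unfolding e1_def by auto
    have A: "\<bar>?A\<bar> \<le> C" by (rule path_int_le[OF x C r1])
    have "\<bar>a i\<bar> \<le> C + e1" using aA A by linarith
    then have a2: "(a i)\<^sup>2 \<le> (C + e1)\<^sup>2" by (metis abs_ge_zero power2_abs power_mono)
    have aA2: "\<bar>(a i)\<^sup>2 - ?A\<^sup>2\<bar> \<le> e1 * (2 * C + e1)" by (rule sq_diff_le[OF aA A])
    let ?K1 = "K (H / real N * (real i - real n))" and ?K2 = "K (\<zeta> * (r - ?s))"
    have "\<bar>H / real N * (real i - real n) - \<zeta> * (r - ?s)\<bar> \<le> e2"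
    proof -
      have eq: "H / real N * (real i - real n) - \<zeta> * (r - ?s)
        = (H - \<zeta>) * (real i / real N - ?s) + \<zeta> * (real i / real N - r)"
        using N by (simp add: field_simps)
      have "\<bar>real i / real N - ?s\<bar> \<le> 1" using i1 s unfolding atLeastAtMost_iff abs_le_iff by linarith
      then have "\<bar>(H - \<zeta>) * (real i / real N - ?s)\<bar> \<le> e * 1"
        unfolding abs_mult using H by (intro mult_mono) auto
      moreover have "\<bar>\<zeta> * (real i / real N - r)\<bar> \<le> \<zeta> * (1 / real N)"
        unfolding abs_mult using ir \<zeta>_pos by (intro mult_mono) auto
      ultimately show ?thesis unfolding eq e2_def by auto
    qed
    then have KK: "\<bar>?K1 - ?K2\<bar> \<le> L * e2" using K_lip L_nonneg by (meson mult_left_mono order_trans)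
    have K2: "?K2 \<le> Kb" by (rule K_le[OF r1 s])
    have K1: "?K1 \<le> Kb + L * e2" using KK K2 by linarith
    \<comment> \<open>\<open>H\<close>, the square and the kernel value are replaced one at a time;
      the three differences give the three terms of \<open>?E\<close>.\<close>
    have "?v i - ?f r = (H - \<zeta>) * ((a i)\<^sup>2 * ?K1) + \<zeta> * (((a i)\<^sup>2 - ?A\<^sup>2) * ?K1) + \<zeta> * (?A\<^sup>2 * (?K1 - ?K2))"
      by (simp add: algebra_simps)
    also have "\<bar>\<dots>\<bar> \<le> \<bar>(H - \<zeta>) * ((a i)\<^sup>2 * ?K1)\<bar> + \<bar>\<zeta> * (((a i)\<^sup>2 - ?A\<^sup>2) * ?K1)\<bar> + \<bar>\<zeta> * (?A\<^sup>2 * (?K1 - ?K2))\<bar>"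
      by linarith
    also have "\<dots> \<le> ?E"
    proof (intro add_mono)
      show "\<bar>(H - \<zeta>) * ((a i)\<^sup>2 * ?K1)\<bar> \<le> e * ((C + e1)\<^sup>2 * (Kb + L * e2))"
        unfolding abs_mult using H a2 K1 K_nonneg e0 by (intro mult_mono) auto
      show "\<bar>\<zeta> * (((a i)\<^sup>2 - ?A\<^sup>2) * ?K1)\<bar> \<le> \<zeta> * (e1 * (2 * C + e1) * (Kb + L * e2))"
        unfolding abs_mult using aA2 K1 K_nonneg \<zeta>_pos e1 C0 by (intro mult_mono) auto
      show "\<bar>\<zeta> * (?A\<^sup>2 * (?K1 - ?K2))\<bar> \<le> \<zeta> * (C\<^sup>2 * (L * e2))"
        unfolding abs_mult using KK \<zeta>_pos path_int_sq_le[OF x C r1] by (intro mult_mono) auto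
    qed
    finally show "\<bar>?v i - ?f r\<bar> \<le> ?E" .
  qed simp
  also have "\<dots> \<le> ?E" using s E0 by (intro mult_left_le) auto
  also have "integral {0..real n * (1 / real N)} ?f = \<zeta> * lim_num K \<zeta> \<theta> x ?s"
    by (simp add: lim_num_def)
  also have "1 / real N * (\<Sum>i=1..n. ?v i) = (\<Sum>i=1..n. H / real N * (a i)\<^sup>2 * K (H / real N * (real i - real n)))"
    by (simp add: sum_distrib_left)
  finally show ?thesis .
qed

lemma uniform_limit_boundI:
  fixes f :: "'i \<Rightarrow> 's \<Rightarrow> real"
  assumes "(E \<longlongrightarrow> 0) F" "\<forall>\<^sub>F i in F. \<forall>s\<in>S. \<bar>f i s - l s\<bar> \<le> E i"
  shows "uniform_limit S f l F"
proof (rule uniform_limitI)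
  fix e :: real assume "0 < e"
  with assms(1) have "\<forall>\<^sub>F i in F. E i < e" by (rule order_tendstoD)
  then show "\<forall>\<^sub>F i in F. \<forall>s\<in>S. dist (f i s) (l s) < e"
    using assms(2) by eventually_elim (force simp: dist_real_def)
qed

text \<open>Numerator and denominator are brought to the common scale \<open>N ^ 3\<close>. The
  cubic and quadratic powers of \<open>n\<close> leave one factor \<open>n\<close>, which becomes
  the \<open>n / N\<close> in the denominator and tends to \<open>s\<close>.\<close>

lemma U_process_obs_eq:
  assumes N: "1 \<le> N" and h: "h > 0" and s: "1 / real N \<le> s" and n: "n = nat \<lfloor>real N * s\<rfloor>"
  shows "U_process K h N y s =
    (\<Sum>i=1..n. (real N / h) / real N * ((\<Sum>j=1..i. y j) / (real N * sqrt (real N)))\<^sup>2 *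
       K ((real N / h) / real N * (real i - real n))) /
    (real n / real N * ((\<Sum>j=1..n. (y j)\<^sup>2) / (real N)\<^sup>2))"
proof -
  have "1 \<le> real N * s" using s N by (simp add: field_simps)
  then have n1: "1 \<le> n" unfolding n by linarith
  have hN: "real N / h / real N = 1 / h" using N by simp
  have sq: "(a / (real N * sqrt (real N)))\<^sup>2 = a\<^sup>2 / real N ^ 3" for a
    using N by (simp add: power_divide power_mult_distrib power2_eq_square power3_eq_cube)
  have num: "(\<Sum>i=1..n. (real N / h) / real N * ((\<Sum>j=1..i. y j) / (real N * sqrt (real N)))\<^sup>2 *
       K ((real N / h) / real N * (real i - real n)))
     = (\<Sum>i=1..n. (\<Sum>j=1..i. y j)\<^sup>2 * scaled_kernel K h (real i - real n)) / real N ^ 3"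
    unfolding hN sq unfolding sum_divide_distrib by (rule sum.cong) (auto simp: scaled_kernel_def)
  show ?thesis
    unfolding num using N n1 s
    by (simp add: U_process_def Let_def flip: n)
      (simp add: field_simps power2_eq_square power3_eq_cube)
qed

text \<open>Index type and filter are arbitrary because the lemma is later applied to pairs of a
  sample size and a sample point; convergence then holds uniformly over all sample points whose walk
  is close to \<open>x\<close>.\<close>

lemma U_process_uniform_limit:
  fixes F :: "'i filter" and N :: "'i \<Rightarrow> nat" and v :: "'i \<Rightarrow> nat \<Rightarrow> real"
  assumes N_top: "filterlim N at_top F"
    and h: "\<And>n. 1 \<le> n \<Longrightarrow> h n > 0" and h_lim: "(\<lambda>n. real n / h n) \<longlonglongrightarrow> \<zeta>"
    and x_cont: "continuous_on {0..1} x"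
    and S: "\<And>e. 0 < e \<Longrightarrow> \<forall>\<^sub>F i in F. \<forall>s\<in>{0..1}.
        \<bar>(\<Sum>j=1..nat \<lfloor>real (N i) * s\<rfloor>. v i j) / sqrt (real (N i)) - x s\<bar> \<le> e"
    and R: "(R \<longlongrightarrow> 0) F" "\<forall>\<^sub>F i in F. \<bar>v i 0\<bar> / sqrt (real (N i)) \<le> R i"
      "\<forall>\<^sub>F i in F. (\<Sum>j=1..N i. (v i j)\<^sup>2) / (real (N i))\<^sup>2 \<le> R i"
    and \<kappa>: "0 < \<kappa>" "\<kappa> \<le> 1" and pos: "0 < lim_den \<theta> x \<kappa>"
  shows "uniform_limit {\<kappa>..1} (\<lambda>i. U_process K (h (N i)) (N i) (obs (N i) \<eta> (v i))) (U_limit K \<zeta> \<theta> x) F"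
proof -
  obtain C where C0: "0 \<le> C" and C: "\<And>t. t \<in> {0..1} \<Longrightarrow> \<bar>x t\<bar> \<le> C" using path_bounded[OF x_cont] by blast
  have real_N: "filterlim (\<lambda>i. real (N i)) at_top F"
    by (rule filterlim_compose[OF filterlim_real_sequentially N_top])
  have IN: "((\<lambda>i. 1 / real (N i)) \<longlongrightarrow> 0) F"
    by (rule tendsto_divide_0[OF tendsto_const filterlim_at_top_imp_at_infinity[OF real_N]])
  have H_lim: "((\<lambda>i. real (N i) / h (N i)) \<longlongrightarrow> \<zeta>) F"
    by (rule filterlim_compose[OF h_lim N_top])
  obtain E1 where E1: "(E1 \<longlongrightarrow> 0) F" "\<forall>\<^sub>F i in F. 0 \<le> E1 i \<and> (\<forall>s\<in>{0..1}.
        \<bar>(\<Sum>j=1..nat \<lfloor>real (N i) * s\<rfloor>. v i j) / sqrt (real (N i)) - x s\<bar> \<le> E1 i)"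
    using eventually_uniform_bound[where S="\<lambda>_. {0..1}", OF S] by blast
  have "\<forall>\<^sub>F i in F. \<forall>p\<in>{(s, t). s \<in> {0..1} \<and> t \<in> {0..1} \<and> \<bar>s - t\<bar> \<le> 1 / real (N i)}.
      \<bar>x (fst p) - x (snd p)\<bar> \<le> e" if e: "0 < e" for e
  proof -
    have "uniformly_continuous_on {0..1} x" by (rule compact_uniformly_continuous[OF x_cont compact_Icc])
    then obtain d where d: "d > 0"
      "\<And>s t. s \<in> {0..1} \<Longrightarrow> t \<in> {0..1} \<Longrightarrow> dist s t < d \<Longrightarrow> dist (x s) (x t) < e"
      unfolding uniformly_continuous_on_def using e by (metis dist_commute)
    have "\<forall>\<^sub>F i in F. 1 / real (N i) < d" by (rule order_tendstoD(2)[OF IN d(1)])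
    then show ?thesis
    proof eventually_elim
      case (elim i)
      have "\<bar>x s - x t\<bar> \<le> e" if "s \<in> {0..1}" "t \<in> {0..1}" "\<bar>s - t\<bar> \<le> 1 / real (N i)" for s t
        using d(2)[OF that(1,2)] that(3) elim unfolding dist_real_def by linarith
      then show ?case by auto
    qed
  qed
  then obtain E2 where E2: "(E2 \<longlongrightarrow> 0) F" "\<forall>\<^sub>F i in F. 0 \<le> E2 i \<and> (\<forall>p\<in>{(s, t). s \<in> {0..1} \<and> t \<in> {0..1} \<and> \<bar>s - t\<bar> \<le> 1 / real (N i)}.
      \<bar>x (fst p) - x (snd p)\<bar> \<le> E2 i)"
    by (rule eventually_uniform_bound) blast
  \<comment> \<open>One tolerance for the distance of the walk to \<open>x\<close>, the modulus of
    \<open>x\<close> at scale \<open>1 / N\<close>, and the remainder.\<close>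
  define e where "e i = E1 i + E2 i + \<bar>R i\<bar>" for i
  define EA where "EA i = 3 * e i + 2 * C * (1 / real (N i)) + \<bar>\<eta>\<bar> * (2 * (C + e i)) * (1 / real (N i))" for i
  define ED where "ED i = 3 * e i * (2 * C + 3 * e i) + 2 * C\<^sup>2 * (1 / real (N i)) + \<eta>\<^sup>2 * e i" for i
  define e' where "e' i = EA i + \<bar>real (N i) / h (N i) - \<zeta>\<bar>" for i
  define e1 where "e1 i = e' i + C * (1 / real (N i))" for i
  define e2 where "e2 i = e' i + \<zeta> * (1 / real (N i))" for i
  define EN where "EN i = e' i * ((C + e1 i)\<^sup>2 * (Kb + L * e2 i)) + \<zeta> * (e1 i * (2 * C + e1 i) * (Kb + L * e2 i))
    + \<zeta> * (C\<^sup>2 * (L * e2 i))" for i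
  have "(e \<longlongrightarrow> 0 + 0 + \<bar>0\<bar>) F"
    unfolding e_def[abs_def] by (intro tendsto_intros E1(1) E2(1) R(1))
  then have e_lim: "(e \<longlongrightarrow> 0) F" by simp
  have "(EA \<longlongrightarrow> 3 * 0 + 2 * C * 0 + \<bar>\<eta>\<bar> * (2 * (C + 0)) * 0) F"
    unfolding EA_def[abs_def] by (intro tendsto_intros e_lim IN)
  then have EA_lim: "(EA \<longlongrightarrow> 0) F" by simp
  have "(ED \<longlongrightarrow> 3 * 0 * (2 * C + 3 * 0) + 2 * C\<^sup>2 * 0 + \<eta>\<^sup>2 * 0) F"
    unfolding ED_def[abs_def] by (intro tendsto_intros e_lim IN)
  then have ED_lim: "(ED \<longlongrightarrow> 0) F" by simp
  have "(e' \<longlongrightarrow> 0 + \<bar>\<zeta> - \<zeta>\<bar>) F"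
    unfolding e'_def[abs_def] by (intro tendsto_intros EA_lim H_lim)
  then have e'_lim: "(e' \<longlongrightarrow> 0) F" by simp
  have "(e1 \<longlongrightarrow> 0 + C * 0) F"
    unfolding e1_def[abs_def] by (intro tendsto_intros e'_lim IN)
  then have e1_lim: "(e1 \<longlongrightarrow> 0) F" by simp
  have "(e2 \<longlongrightarrow> 0 + \<zeta> * 0) F"
    unfolding e2_def[abs_def] by (intro tendsto_intros e'_lim IN)
  then have e2_lim: "(e2 \<longlongrightarrow> 0) F" by simp
  have "(EN \<longlongrightarrow> 0 * ((C + 0)\<^sup>2 * (Kb + L * 0)) + \<zeta> * (0 * (2 * C + 0) * (Kb + L * 0)) + \<zeta> * (C\<^sup>2 * (L * 0))) F"
    unfolding EN_def[abs_def] by (intro tendsto_intros e'_lim e1_lim e2_lim)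
  then have EN_lim: "(EN \<longlongrightarrow> 0) F" by simp
  define Cn where "Cn = C\<^sup>2 * Kb + C\<^sup>2 * L * \<zeta>"
  have Cn: "0 \<le> Cn" using Kb_nonneg L_nonneg \<zeta>_pos by (simp add: Cn_def)
  let ?n = "\<lambda>i s. nat \<lfloor>real (N i) * s\<rfloor>"
  let ?num = "\<lambda>i s. \<Sum>k=1..?n i s. (real (N i) / h (N i)) / real (N i) *
     ((\<Sum>j=1..k. obs (N i) \<eta> (v i) j) / (real (N i) * sqrt (real (N i))))\<^sup>2 *
     K ((real (N i) / h (N i)) / real (N i) * (real k - real (?n i s)))"
  let ?den = "\<lambda>i s. real (?n i s) / real (N i) * ((\<Sum>j=1..?n i s. (obs (N i) \<eta> (v i) j)\<^sup>2) / (real (N i))\<^sup>2)"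
  \<comment> \<open>Beyond these thresholds the index of the change is at least 1, and no
    \<open>s \<ge> \<kappa>\<close> falls under the default value 0 of
    \<open>U_process\<close>.\<close>
  have "\<forall>\<^sub>F i in F. 1 / \<theta> \<le> real (N i)" using real_N by (simp add: filterlim_at_top)
  moreover have "\<forall>\<^sub>F i in F. 1 / \<kappa> \<le> real (N i)" using real_N by (simp add: filterlim_at_top)
  moreover have "\<forall>\<^sub>F i in F. 1 \<le> N i" using N_top by (simp add: filterlim_at_top)
  ultimately have main: "\<forall>\<^sub>F i in F. 1 \<le> N i \<and> 1 / \<kappa> \<le> real (N i) \<and> (\<forall>s\<in>{\<kappa>..1}.
      \<bar>?num i s - \<zeta> * lim_num K \<zeta> \<theta> x s\<bar> \<le> EN i + \<zeta> * (Cn * (1 / real (N i))) \<and>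
      \<bar>?den i s - s * lim_den \<theta> x s\<bar> \<le> ED i + C\<^sup>2 * (1 / real (N i)) + C\<^sup>2 * (1 / real (N i)))"
    using E1(2) E2(2) R(2,3)
  proof eventually_elim
    case (elim i)
    let ?N = "N i"
    have N: "1 \<le> ?N" by fact
    have m: "1 \<le> nat \<lfloor>real ?N * \<theta>\<rfloor>"
    proof -
      have "1 \<le> real ?N * \<theta>" using elim(1) \<theta>_pos by (simp add: field_simps)
      then show ?thesis by linarith
    qed
    have Sb: "\<bar>(\<Sum>j=1..nat \<lfloor>real ?N * s\<rfloor>. v i j) / sqrt (real ?N) - x s\<bar> \<le> e i" if "s \<in> {0..1}" for s
    proof -
      have "\<bar>(\<Sum>j=1..nat \<lfloor>real ?N * s\<rfloor>. v i j) / sqrt (real ?N) - x s\<bar> \<le> E1 i" using elim(4) that by blast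
      then show ?thesis using elim(5) unfolding e_def by linarith
    qed
    have v0: "\<bar>v i 0\<bar> / sqrt (real ?N) \<le> e i" using elim(4-6) unfolding e_def by linarith
    have sq: "(\<Sum>j=1..?N. (v i j)\<^sup>2) / (real ?N)\<^sup>2 \<le> e i" using elim(4,5,7) unfolding e_def by linarith
    have md: "\<bar>x s - x t\<bar> \<le> e i" if "s \<in> {0..1}" "t \<in> {0..1}" "\<bar>s - t\<bar> \<le> 1 / real ?N" for s t
    proof -
      have "(s, t) \<in> {(s, t). s \<in> {0..1} \<and> t \<in> {0..1} \<and> \<bar>s - t\<bar> \<le> 1 / real ?N}" using that by simp
      then have "\<bar>x (fst (s, t)) - x (snd (s, t))\<bar> \<le> E2 i" using elim(5) by blast
      then show ?thesis using elim(4) unfolding e_def by auto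
    qed
    have A: "\<bar>(\<Sum>j=1..k. obs ?N \<eta> (v i) j) / (real ?N * sqrt (real ?N)) - path_int \<theta> x (real k / real ?N)\<bar> \<le> e' i"
      if "k \<le> ?N" for k
      using discrete_path_int[OF N refl m x_cont C Sb v0 md that, of \<eta>] by (simp add: e'_def EA_def)
    have EA_nonneg: "0 \<le> EA i" using A[of 0] discrete_path_int[OF N refl m x_cont C Sb v0 md, of 0 \<eta>]
      by (simp add: EA_def)
    have "\<bar>?num i s - \<zeta> * lim_num K \<zeta> \<theta> x s\<bar> \<le> EN i + \<zeta> * (Cn * (1 / real ?N)) \<and>
      \<bar>?den i s - s * lim_den \<theta> x s\<bar> \<le> ED i + C\<^sup>2 * (1 / real ?N) + C\<^sup>2 * (1 / real ?N)" if s: "s \<in> {\<kappa>..1}" for s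
    proof -
      define n where "n = ?n i s"
      have s1: "s \<in> {0..1}" using s \<kappa> by auto
      have Ns: "0 \<le> real ?N * s" "real ?N * s \<le> real ?N * 1" using s1 by (simp, intro mult_left_mono) auto
      have nb: "real n \<le> real ?N * s" "real ?N * s \<le> real n + 1" using Ns unfolding n_def by linarith+
      then have nN: "n \<le> ?N" using Ns by linarith
      have nN1: "real n / real ?N \<in> {0..1}" using nN N by (auto simp: field_simps)
      have diff: "\<bar>real n / real ?N - s\<bar> \<le> 1 / real ?N"
      proof -
        have "real n / real ?N \<le> s" "s \<le> (real n + 1) / real ?N"
          using nb N by (simp_all add: pos_divide_le_eq pos_le_divide_eq mult.commute)
        then show ?thesis unfolding add_divide_distrib by linarith
      qed
      have 1: "\<bar>?num i s - \<zeta> * lim_num K \<zeta> \<theta> x (real n / real ?N)\<bar> \<le> EN i"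
        unfolding EN_def n_def[symmetric]
        by (rule discrete_num[OF N nN x_cont C A]) (use EA_nonneg in \<open>auto simp: e'_def e1_def e2_def\<close>)
      have "\<bar>lim_num K \<zeta> \<theta> x (real n / real ?N) - lim_num K \<zeta> \<theta> x s\<bar> \<le> Cn * \<bar>real n / real ?N - s\<bar>"
        unfolding Cn_def by (rule lim_num_lip[OF x_cont C nN1 s1])
      also have "\<dots> \<le> Cn * (1 / real ?N)" by (rule mult_left_mono[OF diff Cn])
      finally have "\<zeta> * \<bar>lim_num K \<zeta> \<theta> x (real n / real ?N) - lim_num K \<zeta> \<theta> x s\<bar> \<le> \<zeta> * (Cn * (1 / real ?N))"
        using \<zeta>_pos by (intro mult_left_mono) auto
      then have 2: "\<bar>\<zeta> * lim_num K \<zeta> \<theta> x (real n / real ?N) - \<zeta> * lim_num K \<zeta> \<theta> x s\<bar> \<le> \<zeta> * (Cn * (1 / real ?N))"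
        using \<zeta>_pos by (simp add: abs_mult flip: right_diff_distrib)
      let ?b = "(\<Sum>j=1..n. (obs ?N \<eta> (v i) j)\<^sup>2) / (real ?N)\<^sup>2"
      have "\<bar>?b - lim_den \<theta> x (real n / real ?N)\<bar> \<le> ED i"
        using discrete_den[OF N refl m x_cont C Sb v0 md nN sq, of \<eta>] by (simp add: ED_def)
      moreover have "\<bar>lim_den \<theta> x (real n / real ?N) - lim_den \<theta> x s\<bar> \<le> C\<^sup>2 * (1 / real ?N)"
        using lim_den_lip[OF x_cont C nN1 s1] mult_left_mono[OF diff, of "C\<^sup>2"] by simp
      ultimately have b: "\<bar>?b - lim_den \<theta> x s\<bar> \<le> ED i + C\<^sup>2 * (1 / real ?N)" by linarith
      have "\<bar>lim_den \<theta> x s\<bar> \<le> C\<^sup>2"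
      proof -
        have "\<bar>lim_den \<theta> x s - lim_den \<theta> x 0\<bar> \<le> C\<^sup>2 * \<bar>s - 0\<bar>"
          by (rule lim_den_lip[OF x_cont C s1]) auto
        also have "\<dots> \<le> C\<^sup>2 * 1" using s1 by (intro mult_left_mono) auto
        finally show ?thesis using \<theta>_pos by (simp add: lim_den_def)
      qed
      then have p1: "\<bar>(real n / real ?N - s) * lim_den \<theta> x s\<bar> \<le> 1 / real ?N * C\<^sup>2"
        unfolding abs_mult using diff by (intro mult_mono) auto
      have p2: "\<bar>real n / real ?N * (?b - lim_den \<theta> x s)\<bar> \<le> 1 * (ED i + C\<^sup>2 * (1 / real ?N))"
        unfolding abs_mult using nN1 b by (intro mult_mono) auto
      have eq: "?den i s - s * lim_den \<theta> x s
        = real n / real ?N * (?b - lim_den \<theta> x s) + (real n / real ?N - s) * lim_den \<theta> x s"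
        unfolding n_def[symmetric] by (simp add: algebra_simps)
      have "\<bar>?den i s - s * lim_den \<theta> x s\<bar> \<le> 1 * (ED i + C\<^sup>2 * (1 / real ?N)) + 1 / real ?N * C\<^sup>2"
        unfolding eq by (rule order_trans[OF abs_triangle_ineq add_mono[OF p2 p1]])
      then have "\<bar>?den i s - s * lim_den \<theta> x s\<bar> \<le> ED i + C\<^sup>2 * (1 / real ?N) + C\<^sup>2 * (1 / real ?N)"
        by (simp only: mult_1 mult.commute)
      then show ?thesis using 1 2 by linarith
    qed
    then show ?case using elim by blast
  qed
  have sub: "{\<kappa>..1} \<subseteq> {0..1}" using \<kappa> by auto
  have "uniform_limit {\<kappa>..1} (\<lambda>i s. ?num i s / ?den i s) (\<lambda>s. (\<zeta> * lim_num K \<zeta> \<theta> x s) / (s * lim_den \<theta> x s)) F"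
  proof (rule uniform_lim_divide)
    show "uniform_limit {\<kappa>..1} ?num (\<lambda>s. \<zeta> * lim_num K \<zeta> \<theta> x s) F"
    proof (rule uniform_limit_boundI)
      have "((\<lambda>i. EN i + \<zeta> * (Cn * (1 / real (N i)))) \<longlongrightarrow> 0 + \<zeta> * (Cn * 0)) F"
        by (intro tendsto_intros EN_lim IN)
      then show "((\<lambda>i. EN i + \<zeta> * (Cn * (1 / real (N i)))) \<longlongrightarrow> 0) F" by simp
      show "\<forall>\<^sub>F i in F. \<forall>s\<in>{\<kappa>..1}. \<bar>?num i s - \<zeta> * lim_num K \<zeta> \<theta> x s\<bar> \<le> EN i + \<zeta> * (Cn * (1 / real (N i)))"
        using main by eventually_elim blast
    qed
    show "uniform_limit {\<kappa>..1} ?den (\<lambda>s. s * lim_den \<theta> x s) F"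
    proof (rule uniform_limit_boundI)
      have "((\<lambda>i. ED i + C\<^sup>2 * (1 / real (N i)) + C\<^sup>2 * (1 / real (N i))) \<longlongrightarrow> 0 + C\<^sup>2 * 0 + C\<^sup>2 * 0) F"
        by (intro tendsto_intros ED_lim IN)
      then show "((\<lambda>i. ED i + C\<^sup>2 * (1 / real (N i)) + C\<^sup>2 * (1 / real (N i))) \<longlongrightarrow> 0) F" by simp
      show "\<forall>\<^sub>F i in F. \<forall>s\<in>{\<kappa>..1}. \<bar>?den i s - s * lim_den \<theta> x s\<bar> \<le> ED i + C\<^sup>2 * (1 / real (N i)) + C\<^sup>2 * (1 / real (N i))"
        using main by eventually_elim blast
    qed
    have "continuous_on {\<kappa>..1} (\<lambda>s. \<zeta> * lim_num K \<zeta> \<theta> x s)"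
      by (intro continuous_intros continuous_on_subset[OF lim_num_cont[OF x_cont C] sub])
    then show "bounded ((\<lambda>s. \<zeta> * lim_num K \<zeta> \<theta> x s) ` {\<kappa>..1})"
      by (intro compact_imp_bounded compact_continuous_image) auto
    \<comment> \<open>Both factors are nondecreasing in \<open>s\<close>, so their product at
      \<open>\<kappa>\<close> keeps the denominator uniformly away from 0.\<close>
    show "\<kappa> * lim_den \<theta> x \<kappa> \<le> norm (s * lim_den \<theta> x s)" if "s \<in> {\<kappa>..1}" for s
    proof -
      have "lim_den \<theta> x \<kappa> \<le> lim_den \<theta> x s" by (rule lim_den_mono[OF x_cont C]) (use that \<kappa> in auto)
      then have "\<kappa> * lim_den \<theta> x \<kappa> \<le> s * lim_den \<theta> x s" using that \<kappa> pos by (intro mult_mono) auto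
      then show ?thesis by simp
    qed
    show "0 < \<kappa> * lim_den \<theta> x \<kappa>" using \<kappa> pos by simp
  qed
  moreover have "\<forall>\<^sub>F i in F. \<forall>s\<in>{\<kappa>..1}. U_process K (h (N i)) (N i) (obs (N i) \<eta> (v i)) s = ?num i s / ?den i s"
    using main
  proof eventually_elim
    case (elim i)
    show ?case
    proof
      fix s assume s: "s \<in> {\<kappa>..1}"
      have "1 \<le> N i" "1 / \<kappa> \<le> real (N i)" using elim by auto
      then have "1 / real (N i) \<le> \<kappa>" using \<kappa>(1) by (simp add: divide_le_eq mult.commute)
      then have "1 / real (N i) \<le> s" using s by simp
      then show "U_process K (h (N i)) (N i) (obs (N i) \<eta> (v i)) s = ?num i s / ?den i s"
        using elim by (intro U_process_obs_eq h) auto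
    qed
  qed
  ultimately show ?thesis
    using uniform_limit_cong[where f="\<lambda>i. U_process K (h (N i)) (N i) (obs (N i) \<eta> (v i))"
        and g="\<lambda>i s. ?num i s / ?den i s" and h="U_limit K \<zeta> \<theta> x"
        and i="\<lambda>s. (\<zeta> * lim_num K \<zeta> \<theta> x s) / (s * lim_den \<theta> x s)" and F=F and X="{\<kappa>..1}"]
    by (simp only:) (simp add: U_limit_eq)
qed

end

section \<open>Shifts of Gaussian increments\<close>

abbreviation gauss :: "real \<Rightarrow> real measure" where
  "gauss s \<equiv> density lborel (\<lambda>x. ennreal (normal_density 0 s x))"

text \<open>Lebesgue measure is translation invariant, and the exponential is the quotient of the
  normal densities at \<open>x + a\<close> and at \<open>x\<close>.\<close>

lemma nn_integral_gauss_shift: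
  fixes f :: "real \<Rightarrow> ennreal"
  assumes [measurable]: "f \<in> borel_measurable borel" and s: "0 < s"
  shows "(\<integral>\<^sup>+x. f x \<partial>gauss s) = (\<integral>\<^sup>+x. f (x + a) * ennreal (exp (- (2 * a * x + a\<^sup>2) / (2 * s\<^sup>2))) \<partial>gauss s)"
proof -
  have nd: "normal_density 0 s (a + x) = normal_density 0 s x * exp (- (2 * a * x + a\<^sup>2) / (2 * s\<^sup>2))" for x
  proof -
    have "exp (- (a + x)\<^sup>2 / (2 * s\<^sup>2)) = exp (- x\<^sup>2 / (2 * s\<^sup>2) + - (2 * a * x + a\<^sup>2) / (2 * s\<^sup>2))"
    proof -
      have "- (a + x)\<^sup>2 = - x\<^sup>2 + - (2 * a * x + a\<^sup>2)" by (simp add: power2_sum algebra_simps)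
      then show ?thesis by (simp only: add_divide_distrib)
    qed
    also have "\<dots> = exp (- x\<^sup>2 / (2 * s\<^sup>2)) * exp (- (2 * a * x + a\<^sup>2) / (2 * s\<^sup>2))" by (rule exp_add)
    finally show ?thesis by (simp only: normal_density_def diff_0_right mult.assoc)
  qed
  have "(\<integral>\<^sup>+x. f x \<partial>gauss s) = (\<integral>\<^sup>+x. ennreal (normal_density 0 s x) * f x \<partial>lborel)"
    by (rule nn_integral_density) auto
  also have "\<dots> = (\<integral>\<^sup>+x. ennreal (normal_density 0 s (a + x)) * f (a + x) \<partial>lborel)"
    using nn_integral_real_affine[of "\<lambda>x. ennreal (normal_density 0 s x) * f x" 1 a] by simp
  also have "\<dots> = (\<integral>\<^sup>+x. ennreal (normal_density 0 s x) * (f (x + a) * ennreal (exp (- (2 * a * x + a\<^sup>2) / (2 * s\<^sup>2)))) \<partial>lborel)"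
    unfolding nd using s by (simp add: ennreal_mult mult_ac add.commute)
  also have "\<dots> = (\<integral>\<^sup>+x. f (x + a) * ennreal (exp (- (2 * a * x + a\<^sup>2) / (2 * s\<^sup>2))) \<partial>gauss s)"
    by (rule nn_integral_density[symmetric]) auto
  finally show ?thesis .
qed

text \<open>One coordinate at a time: the inner integral over coordinate \<open>i\<close> is shifted
  by the one-dimensional formula, the remaining coordinates by the induction hypothesis.\<close>

lemma nn_integral_PiM_gauss_shift:
  fixes f :: "('i \<Rightarrow> real) \<Rightarrow> ennreal"
  assumes "finite I" and s: "0 < s" and "f \<in> borel_measurable (PiM I (\<lambda>_. borel))"
  shows "(\<integral>\<^sup>+x. f x \<partial>PiM I (\<lambda>_. gauss s)) =
    (\<integral>\<^sup>+x. f (\<lambda>i\<in>I. x i + a i) * (\<Prod>i\<in>I. ennreal (exp (- (2 * a i * x i + (a i)\<^sup>2) / (2 * s\<^sup>2)))) \<partial>PiM I (\<lambda>_. gauss s))"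
  using assms(1,3)
proof (induction I arbitrary: f rule: finite_induct)
  case empty
  then show ?case by (simp add: PiM_empty nn_integral_count_space_finite restrict_def)
next
  case (insert i I)
  have ps: "prob_space (gauss s)" by (rule prob_space_normal_density[OF s])
  interpret product_sigma_finite "\<lambda>_. gauss s"
    by (rule product_sigma_finite.intro) (metis ps prob_space_imp_sigma_finite)
  have sets: "sets (PiM J (\<lambda>_. gauss s)) = sets (PiM J (\<lambda>_. borel))" for J :: "'i set"
    by (rule sets_PiM_cong) auto
  define w where "w i y = ennreal (exp (- (2 * a i * y + (a i)\<^sup>2) / (2 * s\<^sup>2)))" for i y
  have w[measurable]: "w i \<in> borel_measurable borel" for i unfolding w_def by measurable
  have f[measurable]: "f \<in> borel_measurable (PiM (insert i I) (\<lambda>_. borel))" by fact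
  have upd: "(\<lambda>p. (fst p)(i := snd p + b)) \<in> PiM I (\<lambda>_. borel) \<Otimes>\<^sub>M borel \<rightarrow>\<^sub>M PiM (insert i I) (\<lambda>_. borel)" for b :: real
    by (rule measurable_fun_upd[where J=I]) auto
  have fupd: "(\<lambda>p. f ((fst p)(i := snd p + b))) \<in> borel_measurable (PiM I (\<lambda>_. borel) \<Otimes>\<^sub>M borel)" for b
    by (rule measurable_compose[OF upd f])
  have fupd1: "(\<lambda>y. f (x(i := y + b))) \<in> borel_measurable borel" if "x \<in> space (PiM I (\<lambda>_. borel))" for b x
    using measurable_compose[OF measurable_Pair1'[OF that] fupd[of b]] by simp
  \<comment> \<open>The function left for the induction hypothesis, after coordinate
    \<open>i\<close> has been shifted and integrated out.\<close>
  define g where "g x = (\<integral>\<^sup>+y. f (x(i := y + a i)) * w i y \<partial>gauss s)" for x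
  have "(\<lambda>p. f ((fst p)(i := snd p + a i)) * w i (snd p)) \<in> borel_measurable (PiM I (\<lambda>_. borel) \<Otimes>\<^sub>M borel)"
    using fupd[of "a i"] by measurable
  then have "(\<lambda>p. f ((fst p)(i := snd p + a i)) * w i (snd p)) \<in> borel_measurable (PiM I (\<lambda>_. borel) \<Otimes>\<^sub>M gauss s)"
    by (simp cong: measurable_cong_sets sets_pair_measure_cong)
  then have g: "g \<in> borel_measurable (PiM I (\<lambda>_. borel))"
    unfolding g_def
    by (intro sigma_finite_measure.borel_measurable_nn_integral[OF prob_space_imp_sigma_finite[OF ps]])
      (simp add: split_def)
  have f': "f \<in> borel_measurable (PiM (insert i I) (\<lambda>_. gauss s))"
    using f by (simp cong: measurable_cong_sets add: sets)
  have sp: "space (PiM I (\<lambda>_. gauss s)) = space (PiM I (\<lambda>_. borel))"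
    using sets_eq_imp_space_eq[OF sets] .
  have sh: "(\<lambda>j\<in>I. x j + a j)(i := y + a i) = (\<lambda>j\<in>insert i I. (x(i := y)) j + a j)" for x y
    using insert.hyps by (auto simp: fun_eq_iff)
  let ?h = "\<lambda>x. f (\<lambda>j\<in>insert i I. x j + a j) * (\<Prod>j\<in>insert i I. w j (x j))"
  have h: "?h \<in> borel_measurable (PiM (insert i I) (\<lambda>_. gauss s))"
  proof -
    have "(\<lambda>x. \<lambda>j\<in>insert i I. x j + a j) \<in> PiM (insert i I) (\<lambda>_. borel) \<rightarrow>\<^sub>M PiM (insert i I) (\<lambda>_. borel)"
      by (rule measurable_restrict) measurable
    from measurable_compose[OF this f] have "?h \<in> borel_measurable (PiM (insert i I) (\<lambda>_. borel))"
      by measurable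
    then show ?thesis by (simp cong: measurable_cong_sets add: sets)
  qed
  have "(\<integral>\<^sup>+x. f x \<partial>PiM (insert i I) (\<lambda>_. gauss s)) = (\<integral>\<^sup>+x. \<integral>\<^sup>+y. f (x(i := y)) \<partial>gauss s \<partial>PiM I (\<lambda>_. gauss s))"
    by (rule product_nn_integral_insert[OF insert.hyps f'])
  also have "\<dots> = (\<integral>\<^sup>+x. g x \<partial>PiM I (\<lambda>_. gauss s))"
  proof (rule nn_integral_cong)
    fix x assume "x \<in> space (PiM I (\<lambda>_. gauss s))"
    then have "(\<lambda>y. f (x(i := y))) \<in> borel_measurable borel" using fupd1[of x 0] by (simp add: sp)
    then show "(\<integral>\<^sup>+y. f (x(i := y)) \<partial>gauss s) = g x"
      unfolding g_def w_def by (rule nn_integral_gauss_shift[OF _ s])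
  qed
  also have "\<dots> = (\<integral>\<^sup>+x. g (\<lambda>j\<in>I. x j + a j) * (\<Prod>j\<in>I. w j (x j)) \<partial>PiM I (\<lambda>_. gauss s))"
    unfolding w_def by (rule insert.IH[OF g])
  also have "\<dots> = (\<integral>\<^sup>+x. \<integral>\<^sup>+y. ?h (x(i := y)) \<partial>gauss s \<partial>PiM I (\<lambda>_. gauss s))"
  proof (rule nn_integral_cong)
    fix x assume x: "x \<in> space (PiM I (\<lambda>_. gauss s))"
    have x': "(\<lambda>j\<in>I. x j + a j) \<in> space (PiM I (\<lambda>_. borel))" by (simp add: space_PiM)
    have pr: "(\<Prod>j\<in>insert i I. w j ((x(i := y)) j)) = w i y * (\<Prod>j\<in>I. w j (x j))" for y
    proof -
      have "(\<Prod>j\<in>I. w j ((x(i := y)) j)) = (\<Prod>j\<in>I. w j (x j))"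
        by (rule prod.cong) (use insert.hyps in auto)
      then show ?thesis using insert.hyps by simp
    qed
    have "g (\<lambda>j\<in>I. x j + a j) * (\<Prod>j\<in>I. w j (x j))
      = (\<integral>\<^sup>+y. (f ((\<lambda>j\<in>I. x j + a j)(i := y + a i)) * w i y) * (\<Prod>j\<in>I. w j (x j)) \<partial>gauss s)"
      unfolding g_def using fupd1[OF x', of "a i"] by (intro nn_integral_multc[symmetric]) simp
    also have "\<dots> = (\<integral>\<^sup>+y. ?h (x(i := y)) \<partial>gauss s)"
      unfolding sh pr by (simp add: mult_ac)
    finally show "g (\<lambda>j\<in>I. x j + a j) * (\<Prod>j\<in>I. w j (x j)) = (\<integral>\<^sup>+y. ?h (x(i := y)) \<partial>gauss s)" .
  qed
  also have "\<dots> = (\<integral>\<^sup>+x. ?h x \<partial>PiM (insert i I) (\<lambda>_. gauss s))"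
    by (rule product_nn_integral_insert[OF insert.hyps h, symmetric])
  finally show ?case unfolding w_def .
qed

definition grid_incr :: "nat \<Rightarrow> (real \<Rightarrow> real) \<Rightarrow> nat \<Rightarrow> real" where
  "grid_incr n \<beta> i = \<beta> (real (Suc i) / real n) - \<beta> (real i / real n)"

lemma grid_points:
  assumes "1 \<le> n" "i \<le> n" shows "real i / real n \<in> {0..1}"
  using assms by (auto simp: field_simps)

lemma distr_grid_incr:
  assumes B: "standard_brownian_motion M B" and n: "1 \<le> n"
  shows "distr M (PiM {..<n} (\<lambda>_. borel)) (\<lambda>\<omega>. \<lambda>i\<in>{..<n}. grid_incr n (B \<omega>) i) = PiM {..<n} (\<lambda>_. gauss (sqrt (1 / real n)))"
proof -
  interpret prob_space M using B by (simp add: standard_brownian_motion_def)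
  have meas: "(\<lambda>\<omega>. B \<omega> t) \<in> borel_measurable M" if "t \<in> {0..1}" for t
    using B that by (simp add: standard_brownian_motion_def)
  have X: "(\<lambda>\<omega>. grid_incr n (B \<omega>) i) \<in> borel_measurable M" if "i < n" for i
    unfolding grid_incr_def using that n by (intro borel_measurable_diff meas grid_points) auto
  have "indep_vars (\<lambda>_. borel) (\<lambda>i \<omega>. B \<omega> (real (Suc i) / real n) - B \<omega> (real i / real n)) {..<n}"
  proof -
    have *: "\<And>n. \<forall>\<tau>. (\<forall>i\<le>n. \<tau> i \<in> {0..1}) \<and> (\<forall>i<n. \<tau> i \<le> \<tau> (Suc i)) \<longrightarrow>
        indep_vars (\<lambda>_. borel) (\<lambda>i \<omega>. B \<omega> (\<tau> (Suc i)) - B \<omega> (\<tau> i)) {..<n}"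
      using B unfolding standard_brownian_motion_def by blast
    show ?thesis
      using *[of n, THEN spec, of "\<lambda>i. real i / real n"] n grid_points[OF n] by (auto simp: divide_right_mono)
  qed
  then have "indep_vars (\<lambda>_. borel) (\<lambda>i \<omega>. grid_incr n (B \<omega>) i) {..<n}" by (simp add: grid_incr_def)
  moreover have "0 \<in> {..<n}" using n by simp
  then have "{..<n} \<noteq> {}" by blast
  ultimately have "distr M (PiM {..<n} (\<lambda>_. borel)) (\<lambda>\<omega>. \<lambda>i\<in>{..<n}. grid_incr n (B \<omega>) i)
      = PiM {..<n} (\<lambda>i. distr M borel (\<lambda>\<omega>. grid_incr n (B \<omega>) i))"
    using X by (subst (asm) indep_vars_iff_distr_eq_PiM') auto
  also have "\<dots> = PiM {..<n} (\<lambda>_. gauss (sqrt (1 / real n)))"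
  proof (rule PiM_cong)
    fix i assume i: "i \<in> {..<n}"
    have "distributed M lborel (\<lambda>\<omega>. B \<omega> (real (Suc i) / real n) - B \<omega> (real i / real n))
        (normal_density 0 (sqrt (real (Suc i) / real n - real i / real n)))"
    proof -
      have *: "\<forall>s t. 0 \<le> s \<and> s < t \<and> t \<le> 1 \<longrightarrow>
        distributed M lborel (\<lambda>\<omega>. B \<omega> t - B \<omega> s) (normal_density 0 (sqrt (t - s)))"
        using B unfolding standard_brownian_motion_def by blast
      show ?thesis using n i grid_points[OF n, of "Suc i"]
        by (intro *[rule_format]) (auto simp: divide_strict_right_mono)
    qed
    moreover have "real (Suc i) / real n - real i / real n = 1 / real n" by (simp add: add_divide_distrib)
    ultimately have "distr M lborel (\<lambda>\<omega>. grid_incr n (B \<omega>) i) = gauss (sqrt (1 / real n))"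
      by (simp only: distributed_distr_eq_density[symmetric] grid_incr_def)
    moreover have "distr M borel (\<lambda>\<omega>. grid_incr n (B \<omega>) i) = distr M lborel (\<lambda>\<omega>. grid_incr n (B \<omega>) i)"
      by (rule distr_cong) auto
    ultimately show "distr M borel (\<lambda>\<omega>. grid_incr n (B \<omega>) i) = gauss (sqrt (1 / real n))" by simp
  qed simp
  finally show ?thesis .
qed

lemma grid_incr_measurable:
  assumes B: "standard_brownian_motion M B" and n: "1 \<le> n"
  shows "(\<lambda>\<omega>. \<lambda>i\<in>{..<n}. grid_incr n (B \<omega>) i + a i) \<in> M \<rightarrow>\<^sub>M PiM {..<n} (\<lambda>_. borel)"
proof (rule measurable_restrict)
  fix i assume "i \<in> {..<n}"
  then have "real (Suc i) / real n \<in> {0..1}" "real i / real n \<in> {0..1}" using grid_points[OF n] by auto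
  then show "(\<lambda>\<omega>. grid_incr n (B \<omega>) i + a i) \<in> borel_measurable M"
    using B unfolding grid_incr_def standard_brownian_motion_def
    by (intro borel_measurable_add borel_measurable_diff borel_measurable_const) blast+
qed

text \<open>The Cameron--Martin formula on a grid. The increments have variance
  \<open>1 / n\<close>, which turns the exponent into \<open>n\<close> times sums; when
  \<open>a\<close> consists of the increments of a function, \<open>n\<close> times the sum of
  squares is its discrete Dirichlet energy.\<close>

lemma brownian_grid_shift:
  fixes f :: "(nat \<Rightarrow> real) \<Rightarrow> ennreal"
  assumes B: "standard_brownian_motion M B" and n: "1 \<le> n"
    and f: "f \<in> borel_measurable (PiM {..<n} (\<lambda>_. borel))"
  shows "(\<integral>\<^sup>+\<omega>. f (\<lambda>i\<in>{..<n}. grid_incr n (B \<omega>) i) \<partial>M) =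
    (\<integral>\<^sup>+\<omega>. f (\<lambda>i\<in>{..<n}. grid_incr n (B \<omega>) i + a i) *
       ennreal (exp (- (real n * (\<Sum>i<n. a i * grid_incr n (B \<omega>) i) + real n * (\<Sum>i<n. (a i)\<^sup>2) / 2))) \<partial>M)"
proof -
  let ?P = "PiM {..<n} (\<lambda>_. borel)" and ?X = "\<lambda>\<omega>. \<lambda>i\<in>{..<n}. grid_incr n (B \<omega>) i"
  let ?s = "sqrt (1 / real n)"
  let ?w = "\<lambda>x. \<Prod>i\<in>{..<n}. ennreal (exp (- (2 * a i * x i + (a i)\<^sup>2) / (2 * ?s\<^sup>2)))"
  have X: "?X \<in> M \<rightarrow>\<^sub>M ?P" using grid_incr_measurable[OF B n, of "\<lambda>_. 0"] by simp
  have s: "0 < ?s" using n by simp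
  have "(\<lambda>x. \<lambda>j\<in>{..<n}. x j + a j) \<in> ?P \<rightarrow>\<^sub>M ?P" by (rule measurable_restrict) measurable
  from measurable_compose[OF this f]
  have fs: "(\<lambda>x. f (\<lambda>j\<in>{..<n}. x j + a j) * ?w x) \<in> borel_measurable ?P" by measurable
  have w: "?w (?X \<omega>) = ennreal (exp (- (real n * (\<Sum>i<n. a i * grid_incr n (B \<omega>) i) + real n * (\<Sum>i<n. (a i)\<^sup>2) / 2)))" for \<omega>
  proof -
    have "?w (?X \<omega>) = ennreal (exp (\<Sum>i<n. - (2 * a i * grid_incr n (B \<omega>) i + (a i)\<^sup>2) / (2 * ?s\<^sup>2)))"
      by (simp add: prod_ennreal exp_sum)
    also have "(\<Sum>i<n. - (2 * a i * grid_incr n (B \<omega>) i + (a i)\<^sup>2) / (2 * ?s\<^sup>2))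
      = - (real n * (\<Sum>i<n. a i * grid_incr n (B \<omega>) i) + real n * (\<Sum>i<n. (a i)\<^sup>2) / 2)"
      unfolding sum_distrib_left sum_divide_distrib sum.distrib[symmetric] sum_negf[symmetric]
      by (rule sum.cong) (use n in \<open>auto simp: field_simps\<close>)
    finally show ?thesis .
  qed
  have "(\<integral>\<^sup>+\<omega>. f (?X \<omega>) \<partial>M) = (\<integral>\<^sup>+x. f x \<partial>PiM {..<n} (\<lambda>_. gauss ?s))"
    unfolding distr_grid_incr[OF B n, symmetric] using X f by (simp add: nn_integral_distr)
  also have "\<dots> = (\<integral>\<^sup>+x. f (\<lambda>i\<in>{..<n}. x i + a i) * ?w x \<partial>PiM {..<n} (\<lambda>_. gauss ?s))"
    by (rule nn_integral_PiM_gauss_shift[OF _ s f]) simp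
  also have "\<dots> = (\<integral>\<^sup>+\<omega>. f (\<lambda>i\<in>{..<n}. ?X \<omega> i + a i) * ?w (?X \<omega>) \<partial>M)"
    unfolding distr_grid_incr[OF B n, symmetric] using X fs by (simp add: nn_integral_distr)
  also have "\<dots> = (\<integral>\<^sup>+\<omega>. f (\<lambda>i\<in>{..<n}. grid_incr n (B \<omega>) i + a i) *
       ennreal (exp (- (real n * (\<Sum>i<n. a i * grid_incr n (B \<omega>) i) + real n * (\<Sum>i<n. (a i)\<^sup>2) / 2))) \<partial>M)"
    unfolding w by (simp cong: restrict_cong)
  finally show ?thesis .
qed

section \<open>Piecewise linear interpolation\<close>

text \<open>\<open>x\<close> holds increments, not values. The weight of \<open>x i\<close> rises
  from 0 to 1 across cell \<open>i\<close>, so this is the linear interpolation of the partial sums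
  of \<open>x\<close>, starting at 0.\<close>

definition interp :: "nat \<Rightarrow> (nat \<Rightarrow> real) \<Rightarrow> real \<Rightarrow> real" where
  "interp n x t = (\<Sum>i<n. x i * max 0 (min 1 (real n * t - real i)))"

lemma interp_cong: "(\<And>i. i < n \<Longrightarrow> x i = y i) \<Longrightarrow> interp n x = interp n y"
  by (auto simp: interp_def fun_eq_iff intro!: sum.cong)

lemma interp_cont: "continuous_on S (interp n x)"
  unfolding interp_def by (intro continuous_intros)

lemma interp_diff_le: "\<bar>interp n x t - interp n y t\<bar> \<le> (\<Sum>i<n. \<bar>x i - y i\<bar>)"
proof -
  have "interp n x t - interp n y t = (\<Sum>i<n. (x i - y i) * max 0 (min 1 (real n * t - real i)))"
    by (simp add: interp_def sum_subtractf left_diff_distrib)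
  also have "\<bar>\<dots>\<bar> \<le> (\<Sum>i<n. \<bar>(x i - y i) * max 0 (min 1 (real n * t - real i))\<bar>)" by (rule sum_abs)
  also have "\<dots> \<le> (\<Sum>i<n. \<bar>x i - y i\<bar>)" by (rule sum_mono) (auto simp: abs_mult intro!: mult_left_le)
  finally show ?thesis .
qed

text \<open>One \<open>e\<close> is for the distance from \<open>t\<close> to the grid point on its
  left, the other for the part of the next increment that has already been added.\<close>

lemma interp_grid_incr_bound:
  assumes n: "1 \<le> n" and zero: "\<beta> 0 = 0" and t: "t \<in> {0..1}"
    and e: "\<And>s t. s \<in> {0..1} \<Longrightarrow> t \<in> {0..1} \<Longrightarrow> \<bar>s - t\<bar> \<le> 1 / real n \<Longrightarrow> \<bar>\<beta> s - \<beta> t\<bar> \<le> e"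
  shows "\<bar>interp n (grid_incr n \<beta>) t - \<beta> t\<bar> \<le> 2 * e"
proof -
  have e0: "0 \<le> e" using e[of 0 0] by simp
  define j where "j = nat \<lfloor>real n * t\<rfloor>"
  have nt: "0 \<le> real n * t" "real n * t \<le> real n" using t n by (auto simp: mult_left_le)
  have j: "real j \<le> real n * t" "real n * t < real j + 1" using nt unfolding j_def by linarith+
  have jn: "j \<le> n" using nt j by linarith
  have tele: "(\<Sum>i<m. grid_incr n \<beta> i) = \<beta> (real m / real n)" for m
  proof -
    have "(\<Sum>i<m. grid_incr n \<beta> i) = \<beta> (real m / real n) - \<beta> (real 0 / real n)"
      unfolding grid_incr_def by (rule sum_lessThan_telescope)
    then show ?thesis using zero by simp
  qed
  have head: "(\<Sum>i<j. grid_incr n \<beta> i * max 0 (min 1 (real n * t - real i))) = \<beta> (real j / real n)"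
  proof -
    have "(\<Sum>i<j. grid_incr n \<beta> i * max 0 (min 1 (real n * t - real i))) = (\<Sum>i<j. grid_incr n \<beta> i)"
    proof (rule sum.cong)
      fix i assume "i \<in> {..<j}"
      then have "real i + 1 \<le> real j" by auto
      then have "1 \<le> real n * t - real i" using j by linarith
      then show "grid_incr n \<beta> i * max 0 (min 1 (real n * t - real i)) = grid_incr n \<beta> i" by simp
    qed simp
    then show ?thesis by (simp add: tele)
  qed
  have jt: "\<bar>real j / real n - t\<bar> \<le> 1 / real n" 
  proof -
    have "real j / real n \<le> t" "t \<le> (real j + 1) / real n"
      using j n by (simp_all add: pos_divide_le_eq pos_le_divide_eq mult.commute)
    then show ?thesis unfolding add_divide_distrib by linarith
  qed
  have bj: "\<bar>\<beta> (real j / real n) - \<beta> t\<bar> \<le> e"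
    by (rule e[OF grid_points[OF n jn] t jt])
  show ?thesis
  proof (cases "j < n")
    case True
    have split: "{..<n} = {..<j} \<union> ({j} \<union> {Suc j..<n})" using True by auto
    have tail: "(\<Sum>i\<in>{Suc j..<n}. grid_incr n \<beta> i * max 0 (min 1 (real n * t - real i))) = 0"
    proof (rule sum.neutral, intro ballI)
      fix i assume "i \<in> {Suc j..<n}"
      then have "real j + 1 \<le> real i" by auto
      then show "grid_incr n \<beta> i * max 0 (min 1 (real n * t - real i)) = 0" using j by simp
    qed
    have "interp n (grid_incr n \<beta>) t = \<beta> (real j / real n) + grid_incr n \<beta> j * max 0 (min 1 (real n * t - real j))"
      unfolding interp_def split
      by (subst sum.union_disjoint; (subst sum.union_disjoint)?) (auto simp: head tail)
    moreover have "\<bar>grid_incr n \<beta> j\<bar> \<le> e" unfolding grid_incr_def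
      using True n by (intro e grid_points) (auto simp: add_divide_distrib)
    then have "\<bar>grid_incr n \<beta> j * max 0 (min 1 (real n * t - real j))\<bar> \<le> e * 1"
      unfolding abs_mult by (intro mult_mono) (auto simp: e0)
    ultimately show ?thesis using bj by linarith
  next
    \<comment> \<open>This happens only at \<open>t = 1\<close>, where no cell remains to the
      right.\<close>
    case False
    then have "j = n" using jn by simp
    then have "interp n (grid_incr n \<beta>) t = \<beta> (real j / real n)" unfolding interp_def using head by simp
    then show ?thesis using bj e0 by linarith
  qed
qed

lemma uniform_limit_interp:
  fixes \<beta> :: "real \<Rightarrow> real"
  assumes cont: "continuous_on {0..1} \<beta>" and zero: "\<beta> 0 = 0" and k: "filterlim k at_top F"
  shows "uniform_limit {0..1} (\<lambda>m. interp (k m) (grid_incr (k m) \<beta>)) \<beta> F"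
proof (rule uniform_limitI)
  fix e :: real assume e: "0 < e"
  have "uniformly_continuous_on {0..1} \<beta>" by (rule compact_uniformly_continuous[OF cont compact_Icc])
  then obtain d where d: "d > 0" "\<And>s t. s \<in> {0..1} \<Longrightarrow> t \<in> {0..1} \<Longrightarrow> dist s t < d \<Longrightarrow> dist (\<beta> s) (\<beta> t) < e/3"
    unfolding uniformly_continuous_on_def using e by (metis dist_commute zero_less_divide_iff zero_less_numeral)
  obtain n0 :: nat where n0: "1 / d < real n0" using reals_Archimedean2 by blast
  have "\<forall>\<^sub>F m in F. max 1 n0 \<le> k m" using k unfolding filterlim_at_top by blast
  then show "\<forall>\<^sub>F m in F. \<forall>t\<in>{0..1}. dist (interp (k m) (grid_incr (k m) \<beta>) t) (\<beta> t) < e"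
  proof (eventually_elim, intro ballI)
    fix m and t :: real assume m: "max 1 n0 \<le> k m" and t: "t \<in> {0..1}"
    have "1 / d < real (k m)" using m n0 by linarith
    then have kd: "1 / real (k m) < d" using d(1) m by (simp add: field_simps)
    have "\<bar>interp (k m) (grid_incr (k m) \<beta>) t - \<beta> t\<bar> \<le> 2 * (e/3)"
    proof (rule interp_grid_incr_bound[where \<beta>=\<beta>, OF _ zero t])
      fix s t :: real assume "s \<in> {0..1}" "t \<in> {0..1}" "\<bar>s - t\<bar> \<le> 1 / real (k m)"
      then show "\<bar>\<beta> s - \<beta> t\<bar> \<le> e/3" using d(2)[of s t] kd unfolding dist_real_def by linarith
    qed (use m in simp)
    then show "dist (interp (k m) (grid_incr (k m) \<beta>) t) (\<beta> t) < e" using e unfolding dist_real_def by linarith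
  qed
qed

section \<open>The barrier functional\<close>

context monitoring
begin

text \<open>Where the denominator is positive, this has the sign of \<open>U_limit\<close> minus
  \<open>c\<close>.\<close>

definition barrier :: "real \<Rightarrow> (real \<Rightarrow> real) \<Rightarrow> real \<Rightarrow> real" where
  "barrier c \<beta> s = \<zeta> / s * lim_num K \<zeta> \<theta> \<beta> s - c * lim_den \<theta> \<beta> s"

definition barrier_min :: "real \<Rightarrow> real \<Rightarrow> real \<Rightarrow> (real \<Rightarrow> real) \<Rightarrow> real" where
  "barrier_min c a q \<beta> = (INF s\<in>{a..q}. barrier c \<beta> s)"

section \<open>Continuity and measurability of the minimal barrier\<close>

context
  fixes c a q :: real
  assumes c: "0 < c" and a: "0 < a" and aq: "a \<le> q" and q: "q \<le> 1"
begin

lemma barrier_cont: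
  assumes \<beta>: "continuous_on {0..1} \<beta>"
  shows "continuous_on {a..q} (barrier c \<beta>)"
proof -
  obtain C where C: "\<And>t. t \<in> {0..1} \<Longrightarrow> \<bar>\<beta> t\<bar> \<le> C" using path_bounded[OF \<beta>] by blast
  have sub: "{a..q} \<subseteq> {0..1}" using a q by auto
  show ?thesis unfolding barrier_def
    by (intro continuous_intros continuous_on_subset[OF lim_num_cont[OF \<beta> C] sub]
        continuous_on_subset[OF lim_den_cont[OF \<beta> C] sub]) (use a in auto)
qed

lemma barrier_min_attained:
  assumes \<beta>: "continuous_on {0..1} \<beta>"
  obtains s where "s \<in> {a..q}" "barrier_min c a q \<beta> = barrier c \<beta> s"
    "\<And>r. r \<in> {a..q} \<Longrightarrow> barrier c \<beta> s \<le> barrier c \<beta> r"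
proof -
  obtain s where s: "s \<in> {a..q}" "\<And>r. r \<in> {a..q} \<Longrightarrow> barrier c \<beta> s \<le> barrier c \<beta> r"
    using continuous_attains_inf[OF compact_Icc _ barrier_cont[OF \<beta>]] aq by auto
  have "barrier_min c a q \<beta> = barrier c \<beta> s" unfolding barrier_min_def
    by (rule cInf_eq_minimum) (use s in auto)
  with s show ?thesis by (intro that)
qed

lemma barrier_diff_le:
  assumes f: "continuous_on {0..1} f" and g: "continuous_on {0..1} g"
    and fg: "\<And>t. t \<in> {0..1} \<Longrightarrow> \<bar>f t - g t\<bar> \<le> e"
    and C: "\<And>t. t \<in> {0..1} \<Longrightarrow> \<bar>g t\<bar> \<le> C" and s: "s \<in> {a..q}"
  shows "\<bar>barrier c f s - barrier c g s\<bar> \<le> (\<zeta> / a * Kb + c) * (e * (2 * C + e))"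
proof -
  have s1: "s \<in> {0..1}" and s0: "0 < s" using s a q by auto
  have e: "0 \<le> e" "0 \<le> C" using fg[of 0] C[of 0] by auto
  have "\<bar>\<zeta> / s * (lim_num K \<zeta> \<theta> f s - lim_num K \<zeta> \<theta> g s)\<bar> \<le> \<zeta> / a * (e * (2 * C + e) * Kb)"
    unfolding abs_mult using lim_num_diff_le[OF f g fg C s1] s a s0 \<zeta>_pos
    by (intro mult_mono) (auto intro!: divide_left_mono)
  moreover have "\<bar>c * (lim_den \<theta> f s - lim_den \<theta> g s)\<bar> \<le> c * (e * (2 * C + e))"
    unfolding abs_mult using lim_den_diff_le[OF f g fg C s1] c by (intro mult_mono) auto
  moreover have "barrier c f s - barrier c g s = \<zeta> / s * (lim_num K \<zeta> \<theta> f s - lim_num K \<zeta> \<theta> g s)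
      - c * (lim_den \<theta> f s - lim_den \<theta> g s)" by (simp add: barrier_def algebra_simps)
  moreover have "(\<zeta> / a * Kb + c) * (e * (2 * C + e)) = \<zeta> / a * (e * (2 * C + e) * Kb) + c * (e * (2 * C + e))"
    by (simp add: algebra_simps)
  ultimately show ?thesis by linarith
qed

text \<open>Each of the two minimizers is a competitor in the other minimum.\<close>

lemma barrier_min_diff_le:
  assumes f: "continuous_on {0..1} f" and g: "continuous_on {0..1} g"
    and fg: "\<And>t. t \<in> {0..1} \<Longrightarrow> \<bar>f t - g t\<bar> \<le> e"
    and C: "\<And>t. t \<in> {0..1} \<Longrightarrow> \<bar>g t\<bar> \<le> C"
  shows "\<bar>barrier_min c a q f - barrier_min c a q g\<bar> \<le> (\<zeta> / a * Kb + c) * (e * (2 * C + e))"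
proof -
  obtain s where s: "s \<in> {a..q}" "barrier_min c a q f = barrier c f s" "\<And>r. r \<in> {a..q} \<Longrightarrow> barrier c f s \<le> barrier c f r"
    using barrier_min_attained[OF f] by blast
  obtain r where r: "r \<in> {a..q}" "barrier_min c a q g = barrier c g r" "\<And>s. s \<in> {a..q} \<Longrightarrow> barrier c g r \<le> barrier c g s"
    using barrier_min_attained[OF g] by blast
  show ?thesis
    using barrier_diff_le[OF f g fg C s(1)] barrier_diff_le[OF f g fg C r(1)] s(3)[OF r(1)] r(3)[OF s(1)]
    unfolding s(2) r(2) by linarith
qed

lemma tendsto_barrier_min:
  fixes F :: "'i filter"
  assumes lim: "uniform_limit {0..1} f g F" and f: "\<And>i. continuous_on {0..1} (f i)" and g: "continuous_on {0..1} g"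
  shows "((\<lambda>i. barrier_min c a q (f i)) \<longlongrightarrow> barrier_min c a q g) F"
proof (rule tendstoI)
  fix e :: real assume e: "0 < e"
  obtain C where C: "0 \<le> C" "\<And>t. t \<in> {0..1} \<Longrightarrow> \<bar>g t\<bar> \<le> C" using path_bounded[OF g] by blast
  have "((\<lambda>d. (\<zeta> / a * Kb + c) * (d * (2 * C + d))) \<longlongrightarrow> (\<zeta> / a * Kb + c) * (0 * (2 * C + 0))) (at_right 0)"
    by (intro tendsto_intros)
  then have "\<forall>\<^sub>F d in at_right 0. (\<zeta> / a * Kb + c) * (d * (2 * C + d)) < e"
    by (rule order_tendstoD) (use e in simp)
  moreover have "\<forall>\<^sub>F d in at_right (0::real). 0 < d" by (rule eventually_at_right_less)
  ultimately have "\<forall>\<^sub>F d in at_right (0::real). 0 < d \<and> (\<zeta> / a * Kb + c) * (d * (2 * C + d)) < e"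
    by eventually_elim simp
  then obtain d where d: "0 < d" "(\<zeta> / a * Kb + c) * (d * (2 * C + d)) < e"
    using eventually_happens'[OF trivial_limit_at_right_real] by blast
  from uniform_limitD[OF lim d(1)]
  show "\<forall>\<^sub>F i in F. dist (barrier_min c a q (f i)) (barrier_min c a q g) < e"
  proof eventually_elim
    case (elim i)
    then have "\<And>t. t \<in> {0..1} \<Longrightarrow> \<bar>f i t - g t\<bar> \<le> d" by (auto simp: dist_real_def less_imp_le)
    from barrier_min_diff_le[OF f g this C(2)] show ?case using d unfolding dist_real_def by linarith
  qed
qed

lemma borel_measurable_barrier_min_interp:
  "(\<lambda>x. barrier_min c a q (interp n x)) \<in> borel_measurable (PiM {..<n} (\<lambda>_. borel))"
proof -
  have "continuous_on UNIV (\<lambda>x. barrier_min c a q (interp n x))"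
    unfolding continuous_on_def
  proof
    fix x :: "nat \<Rightarrow> real"
    show "((\<lambda>y. barrier_min c a q (interp n y)) \<longlongrightarrow> barrier_min c a q (interp n x)) (at x)"
    proof (rule tendsto_barrier_min)
      show "uniform_limit {0..1} (interp n) (interp n x) (at x)"
      proof (rule uniform_limitI)
        fix e :: real assume e: "0 < e"
        have "continuous_on UNIV (\<lambda>y::nat \<Rightarrow> real. \<Sum>i<n. \<bar>y i - x i\<bar>)"
          by (intro continuous_intros continuous_on_product_coordinates)
        then have "((\<lambda>y. \<Sum>i<n. \<bar>y i - x i\<bar>) \<longlongrightarrow> (\<Sum>i<n. \<bar>x i - x i\<bar>)) (at x)"
          unfolding continuous_on_def by blast
        then have "\<forall>\<^sub>F y in at x. (\<Sum>i<n. \<bar>y i - x i\<bar>) < e" by (rule order_tendstoD) (use e in simp)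
        then show "\<forall>\<^sub>F y in at x. \<forall>t\<in>{0..1}. dist (interp n y t) (interp n x t) < e"
        proof eventually_elim
          case (elim y)
          then show ?case using interp_diff_le[of n y _ x] unfolding dist_real_def by (blast intro: le_less_trans)
        qed
      qed
    qed (rule interp_cont)+
  qed
  then have m: "(\<lambda>x. barrier_min c a q (interp n x)) \<in> borel_measurable borel"
    by (rule borel_measurable_continuous_onI)
  \<comment> \<open>Padding with zeros leads from the finite product to the space of all sequences,
    on which the functional is continuous; \<open>interp n\<close> does not see the padding.\<close>
  have "(\<lambda>x i. if i < n then x i else 0 :: real) \<in> PiM {..<n} (\<lambda>_. borel) \<rightarrow>\<^sub>M borel"
  proof (rule measurable_coordinatewise_then_product)
    show "(\<lambda>x. if i < n then x i else 0) \<in> borel_measurable (PiM {..<n} (\<lambda>_. borel :: real measure))" for i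
      using measurable_component_singleton[of i "{..<n}" "\<lambda>_. borel :: real measure"]
      by (cases "i < n") simp_all
  qed
  from measurable_compose[OF this m]
  have "(\<lambda>x. barrier_min c a q (interp n (\<lambda>i. if i < n then x i else 0))) \<in> borel_measurable (PiM {..<n} (\<lambda>_. borel))" .
  moreover have "interp n (\<lambda>i. if i < n then x i else 0) = interp n x" for x by (rule interp_cong) simp
  ultimately show ?thesis by simp
qed

text \<open>A quadratic form satisfies
  \<open>Q(b + t\<^sub>2 \<phi>) = (1-l) Q(b + t\<^sub>1 \<phi>) + l Q(b + t\<^sub>3 \<phi>) - l (1-l) (t\<^sub>3 - t\<^sub>1)\<^sup>2 Q(\<phi>)\<close> for
  \<open>t\<^sub>2 = (1-l) t\<^sub>1 + l t\<^sub>3\<close>; the barrier is one.\<close>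

lemma barrier_quadratic:
  assumes b: "continuous_on {0..1} b" and p: "continuous_on {0..1} \<phi>" and s: "s \<in> {a..q}"
    and t2: "t2 = (1 - l) * t1 + l * t3"
  shows "barrier c (\<lambda>t. b t + t2 * \<phi> t) s = (1 - l) * barrier c (\<lambda>t. b t + t1 * \<phi> t) s
    + l * barrier c (\<lambda>t. b t + t3 * \<phi> t) s - l * (1 - l) * (t3 - t1)\<^sup>2 * barrier c \<phi> s"
proof -
  have s1: "s \<in> {0..1}" using s a q by auto
  define D where "D = l * (1 - l) * (t3 - t1)\<^sup>2"
  \<comment> \<open>The pointwise identity behind the quadratic form. Numerator and denominator
    integrate squares of linear functionals of the path with weights that do not involve the path,
    so it passes through the integrals.\<close>
  have alg: "(x + t2 * y)\<^sup>2 = (1 - l) * (x + t1 * y)\<^sup>2 + l * (x + t3 * y)\<^sup>2 - D * y\<^sup>2" for x y :: real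
    unfolding t2 D_def by (simp add: power2_eq_square algebra_simps)
  have cont: "continuous_on {0..1} (\<lambda>t. b t + u * \<phi> t)" for u by (intro continuous_intros b p)
  have lin: "integral {0..r} (\<lambda>t. (1 - l) * f t + l * g t - D * k t)
      = (1 - l) * integral {0..r} f + l * integral {0..r} g - D * integral {0..r} k"
    if "continuous_on {0..1} f" "continuous_on {0..1} g" "continuous_on {0..1} k" "r \<in> {0..1}"
    for r and f g k :: "real \<Rightarrow> real"
  proof -
    have "(f has_integral integral {0..r} f) {0..r}" "(g has_integral integral {0..r} g) {0..r}"
      "(k has_integral integral {0..r} k) {0..r}"
      using that by (auto intro!: integrable_integral integrable_on_path)
    then show ?thesis
      by (intro integral_unique has_integral_diff has_integral_add has_integral_mult_right)
  qed
  have A: "path_int \<theta> (\<lambda>t. b t + u * \<phi> t) r = path_int \<theta> b r + u * path_int \<theta> \<phi> r" if "r \<in> {0..1}" for u r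
  proof -
    have "(b has_integral path_int \<theta> b r) {0..min r \<theta>}" "(\<phi> has_integral path_int \<theta> \<phi> r) {0..min r \<theta>}"
      unfolding path_int_def using that b p by (auto intro!: integrable_integral integrable_on_path)
    then show ?thesis unfolding path_int_def
      by (intro integral_unique has_integral_add has_integral_mult_right) (auto simp: path_int_def)
  qed
  have nc: "continuous_on {0..1} (\<lambda>r. (path_int \<theta> f r)\<^sup>2 * K (\<zeta> * (r - s)))" if f: "continuous_on {0..1} f" for f
  proof -
    obtain C where "\<And>t. t \<in> {0..1} \<Longrightarrow> \<bar>f t\<bar> \<le> C" using path_bounded[OF f] by blast
    from num_integrand_cont[OF f this] show ?thesis .
  qed
  have num: "lim_num K \<zeta> \<theta> (\<lambda>t. b t + t2 * \<phi> t) s = (1 - l) * lim_num K \<zeta> \<theta> (\<lambda>t. b t + t1 * \<phi> t) s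
    + l * lim_num K \<zeta> \<theta> (\<lambda>t. b t + t3 * \<phi> t) s - D * lim_num K \<zeta> \<theta> \<phi> s"
    unfolding lim_num_def
    by (subst lin[OF nc[OF cont] nc[OF cont] nc[OF p] s1, symmetric],
        rule Henstock_Kurzweil_Integration.integral_cong)
       (use s1 in \<open>auto simp: A alg algebra_simps\<close>)
  have den: "lim_den \<theta> (\<lambda>t. b t + t2 * \<phi> t) s = (1 - l) * lim_den \<theta> (\<lambda>t. b t + t1 * \<phi> t) s
    + l * lim_den \<theta> (\<lambda>t. b t + t3 * \<phi> t) s - D * lim_den \<theta> \<phi> s"
    unfolding lim_den_def
    by (subst lin[symmetric], use s1 \<theta>_pos in \<open>auto simp: alg intro!: continuous_intros b p\<close>)
  define z where "z = \<zeta> / s"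
  show ?thesis unfolding barrier_def num den D_def[symmetric] z_def[symmetric] by (simp add: algebra_simps)
qed

text \<open>At a minimizer for the middle shift the barriers of the outer shifts are nonnegative,
  and strict concavity would make the middle one positive.\<close>

lemma barrier_min_no_three_zeros:
  assumes b: "continuous_on {0..1} b" and p: "continuous_on {0..1} \<phi>"
    and neg: "\<And>s. s \<in> {a..q} \<Longrightarrow> barrier c \<phi> s < 0"
    and t: "t1 < t2" "t2 < t3"
    and z: "barrier_min c a q (\<lambda>t. b t + t1 * \<phi> t) = 0" "barrier_min c a q (\<lambda>t. b t + t2 * \<phi> t) = 0"
      "barrier_min c a q (\<lambda>t. b t + t3 * \<phi> t) = 0"
  shows False
proof -
  define l where "l = (t2 - t1) / (t3 - t1)"
  have l: "0 < l" "l < 1" using t by (auto simp: l_def field_simps)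
  have "l * (t3 - t1) = t2 - t1" using t by (simp add: l_def)
  then have t2: "t2 = (1 - l) * t1 + l * t3" by (simp add: algebra_simps)
  have cont: "continuous_on {0..1} (\<lambda>t. b t + u * \<phi> t)" for u by (intro continuous_intros b p)
  obtain s where s: "s \<in> {a..q}" "barrier c (\<lambda>t. b t + t2 * \<phi> t) s = 0"
    using barrier_min_attained[OF cont[of t2]] z(2) by metis
  have nn: "0 \<le> barrier c (\<lambda>t. b t + u * \<phi> t) s" if "barrier_min c a q (\<lambda>t. b t + u * \<phi> t) = 0" for u
    using barrier_min_attained[OF cont[of u]] that s(1) by metis
  have "0 \<le> (1 - l) * barrier c (\<lambda>t. b t + t1 * \<phi> t) s" "0 \<le> l * barrier c (\<lambda>t. b t + t3 * \<phi> t) s"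
    using nn[OF z(1)] nn[OF z(3)] l by auto
  moreover have "l * (1 - l) * (t3 - t1)\<^sup>2 * barrier c \<phi> s < 0"
    using neg[OF s(1)] l t by (intro mult_pos_neg) auto
  ultimately show False using barrier_quadratic[OF b p s(1) t2] s(2) by linarith
qed

text \<open>A tent from 0 to \<open>2 / p\<close> with peak 1 at \<open>1 / p\<close>. It vanishes
  at 0, so adding a multiple of it preserves the starting value of a path.\<close>

definition hat :: "real \<Rightarrow> real \<Rightarrow> real" where
  "hat p t = max 0 (1 - \<bar>p * t - 1\<bar>)"

lemma hat_cont: "continuous_on S (hat p)"
  unfolding hat_def by (intro continuous_intros)

text \<open>On a hat of width of order \<open>1/p\<close>, the denominator is of order \<open>1/p\<close>, but the numerator, built
  from the integrated path, is of order \<open>1/p\<^sup>2\<close>.\<close>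

lemma hat_barrier_neg:
  assumes p: "0 < p" "2 / p \<le> a" "2 / p \<le> \<theta>" "16 * \<zeta> * Kb / (a * c) < p" and s: "s \<in> {a..q}"
  shows "barrier c (hat p) s < 0"
proof -
  have s1: "s \<in> {0..1}" and s0: "0 < s" using s a q by auto
  have p1: "2 / p \<le> 1" using p \<theta>_less by linarith
  have le1: "\<bar>hat p t\<bar> \<le> 1" for t by (simp add: hat_def)
  have nn: "0 \<le> hat p t" for t by (simp add: hat_def)
  have zero: "hat p t = 0" if "2 / p \<le> t" for t
    using that p(1) by (simp add: hat_def field_simps)
  have tot: "integral {0..1} (hat p) \<le> 2 / p"
  proof -
    have "integral {0..1} (hat p) = integral {0..2/p} (hat p) + integral {2/p..1} (hat p)"
      using p p1 by (intro Henstock_Kurzweil_Integration.integral_combine[symmetric] integrable_on_path hat_cont) auto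
    also have "integral {2/p..1} (hat p) = integral {2/p..1} (\<lambda>_. 0)"
      by (rule Henstock_Kurzweil_Integration.integral_cong) (simp add: zero)
    finally have "integral {0..1} (hat p) = integral {0..2/p} (hat p)" by simp
    moreover have "\<bar>integral {0..2/p} (hat p)\<bar> \<le> 1 * (2/p - 0)"
      using p p1 by (intro integral_bound_path hat_cont le1) auto
    ultimately show ?thesis by simp
  qed
  have A: "\<bar>path_int \<theta> (hat p) r\<bar> \<le> 2 / p" if "r \<in> {0..1}" for r
  proof -
    have "0 \<le> path_int \<theta> (hat p) r" unfolding path_int_def using that nn
      by (intro Henstock_Kurzweil_Integration.integral_nonneg integrable_on_path hat_cont) auto
    moreover have "path_int \<theta> (hat p) r \<le> integral {0..1} (hat p)" unfolding path_int_def
      using that nn by (intro integral_subset_le integrable_on_path hat_cont) auto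
    ultimately show ?thesis using tot by simp
  qed
  have "\<bar>lim_num K \<zeta> \<theta> (hat p) s\<bar> \<le> (2 / p)\<^sup>2 * Kb * (s - 0)" unfolding lim_num_def
  proof (rule integral_bound_path[OF num_integrand_cont[OF hat_cont le1]])
    fix r assume r: "r \<in> {0..s}"
    then have r1: "r \<in> {0..1}" using s1 by auto
    have "(path_int \<theta> (hat p) r)\<^sup>2 \<le> (2 / p)\<^sup>2"
      using A[OF r1] by (metis abs_ge_zero power2_abs power_mono)
    then have "(path_int \<theta> (hat p) r)\<^sup>2 * K (\<zeta> * (r - s)) \<le> (2 / p)\<^sup>2 * Kb"
      using K_nonneg by (intro mult_mono K_le r1 s1) auto
    then show "\<bar>(path_int \<theta> (hat p) r)\<^sup>2 * K (\<zeta> * (r - s))\<bar> \<le> (2 / p)\<^sup>2 * Kb" using K_nonneg by simp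
  qed (use s1 in auto)
  then have "\<zeta> / s * lim_num K \<zeta> \<theta> (hat p) s \<le> \<zeta> / s * ((2 / p)\<^sup>2 * Kb * s)"
    using \<zeta>_pos s0 by (intro mult_left_mono) auto
  also have "\<dots> = \<zeta> * Kb * 4 / p\<^sup>2" using s0 by (simp add: power_divide)
  finally have num: "\<zeta> / s * lim_num K \<zeta> \<theta> (hat p) s \<le> \<zeta> * Kb * 4 / p\<^sup>2" .
  \<comment> \<open>On the middle half of its support, of length \<open>1 / p\<close>, the hat is at
    least \<open>1/2\<close>.\<close>
  have "1 / (4 * p) \<le> lim_den \<theta> (hat p) s"
  proof -
    have sub: "{1 / (2 * p)..3 / (2 * p)} \<subseteq> {0..min s \<theta>}"
    proof -
      have "3 / (2 * p) \<le> 2 / p" using p(1) by (simp add: field_simps)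
      then show ?thesis using p s by auto
    qed
    have cont: "continuous_on S (\<lambda>t. (hat p t)\<^sup>2)" for S by (intro continuous_intros hat_cont)
    have "1 / (4 * p) = integral {1 / (2 * p)..3 / (2 * p)} (\<lambda>_. (1/2)\<^sup>2 :: real)"
      using p(1) by (simp add: field_simps power2_eq_square)
    also have "\<dots> \<le> integral {1 / (2 * p)..3 / (2 * p)} (\<lambda>t. (hat p t)\<^sup>2)"
    proof (rule integral_le)
      fix t assume t: "t \<in> {1 / (2 * p)..3 / (2 * p)}"
      then have "1/2 \<le> p * t" "p * t \<le> 3/2" using p(1) by (auto simp: field_simps)
      then have "\<bar>p * t - 1\<bar> \<le> 1/2" by linarith
      then have "1/2 \<le> 1 - \<bar>p * t - 1\<bar>" by linarith
      then have "1/2 \<le> hat p t" unfolding hat_def by linarith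
      then show "(1/2)\<^sup>2 \<le> (hat p t)\<^sup>2" by (intro power_mono) auto
    qed (auto intro!: integrable_continuous_real cont)
    also have "\<dots> \<le> lim_den \<theta> (hat p) s" unfolding lim_den_def
      by (rule integral_subset_le[OF sub]) (auto intro!: integrable_continuous_real cont)
    finally show ?thesis .
  qed
  then have den: "c * (1 / (4 * p)) \<le> c * lim_den \<theta> (hat p) s" using c by (intro mult_left_mono) auto
  \<comment> \<open>This comparison is the origin of the constant 16; the additional
    \<open>a\<close> in the lower bound for \<open>p\<close> only strengthens it, since
    \<open>a \<le> 1\<close>.\<close>
  have "\<zeta> * Kb * 4 / p\<^sup>2 < c * (1 / (4 * p))"
  proof -
    have "\<zeta> * Kb * 16 < p * (a * c)" using p(4) a c by (simp add: field_simps)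
    also have "\<dots> \<le> p * (1 * c)" using p(1) a aq q c by (intro mult_left_mono mult_right_mono) auto
    finally show ?thesis using p(1) c by (simp add: field_simps power2_eq_square)
  qed
  then show ?thesis using num den unfolding barrier_def by linarith
qed

text \<open>With mesh \<open>1 / (p * k)\<close> the peak and the right end of the hat are the grid
  points number \<open>k\<close> and \<open>2 * k\<close>, so no cell contains a kink in its
  interior.\<close>

lemma grid_incr_hat:
  assumes p: "1 \<le> p" and k: "1 \<le> k"
  shows "grid_incr (p * k) (hat (real p)) i = (if i < k then 1 / real k else if i < 2 * k then - 1 / real k else 0)"
proof -
  define y z where "y = real i / real k" and "z = 1 / real k"
  have pt: "hat (real p) (real j / real (p * k)) = max 0 (1 - \<bar>real j / real k - 1\<bar>)" for j
    using p k by (simp add: hat_def)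
  have "real (Suc i) / real k = y + z" by (simp add: add_divide_distrib y_def z_def)
  then have incr: "grid_incr (p * k) (hat (real p)) i = max 0 (1 - \<bar>y + z - 1\<bar>) - max 0 (1 - \<bar>y - 1\<bar>)"
    unfolding grid_incr_def pt by (simp only: y_def)
  have yz: "0 \<le> y" "0 \<le> z" by (simp_all add: y_def z_def)
  have "real (Suc i) \<le> real k" if "i < k" using that by simp
  then have 1: "y + z \<le> 1" if "i < k" using that k by (simp add: y_def z_def flip: add_divide_distrib)
  have 2: "1 \<le> y" if "\<not> i < k" using that k by (simp add: y_def)
  have "real (Suc i) \<le> 2 * real k" if "i < 2 * k" using that by linarith
  then have 3: "y + z \<le> 2" if "i < 2 * k"
    using that k by (simp add: y_def z_def pos_divide_le_eq flip: add_divide_distrib)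
  have "2 * real k \<le> real i" if "\<not> i < 2 * k" using that by linarith
  then have 4: "2 \<le> y" if "\<not> i < 2 * k" using that k by (simp add: y_def pos_le_divide_eq)
  show ?thesis unfolding incr minus_divide_left[symmetric] z_def[symmetric]
    using yz 1 2 3 4 by (cases "i < k"; cases "i < 2 * k") (simp_all add: abs_if max_def)
qed

text \<open>When \<open>X\<close> consists of the increments of a path, the first sum telescopes to
  the values at 0, \<open>1 / p\<close> and \<open>2 / p\<close>. After multiplication by
  \<open>p * k\<close>, as in the shift formula, neither sum depends on \<open>k\<close>: the
  density is the same on all grids and survives their refinement.\<close>

lemma sum_hat_incr:
  fixes X :: "nat \<Rightarrow> real"
  assumes p: "2 \<le> p" and k: "1 \<le> k"
  shows "(\<Sum>i<p * k. grid_incr (p * k) (hat (real p)) i * X i) = (2 * (\<Sum>i<k. X i) - (\<Sum>i<2 * k. X i)) / real k"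
    and "(\<Sum>i<p * k. (grid_incr (p * k) (hat (real p)) i)\<^sup>2) = 2 / real k"
proof -
  have d: "grid_incr (p * k) (hat (real p)) i = (if i < k then 1 / real k else if i < 2 * k then - 1 / real k else 0)" for i
    using grid_incr_hat[of p k i] p k by simp
  have un: "{..<2 * k} = {..<k} \<union> {k..<2 * k}" by auto
  have two: "(\<Sum>i<2 * k. f i) = (\<Sum>i<k. f i) + (\<Sum>i=k..<2 * k. f i)" for f :: "nat \<Rightarrow> real"
    unfolding un by (rule sum.union_disjoint) auto
  have split: "(\<Sum>i<p * k. f i) = (\<Sum>i<k. f i) + (\<Sum>i=k..<2 * k. f i)" if "\<And>i. 2 * k \<le> i \<Longrightarrow> f i = 0" for f :: "nat \<Rightarrow> real"
  proof -
    have "2 * k \<le> p * k" using p by simp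
    then have "(\<Sum>i<p * k. f i) = (\<Sum>i<2 * k. f i)" using that by (intro sum.mono_neutral_right) auto
    then show ?thesis by (simp only: two)
  qed
  let ?d = "grid_incr (p * k) (hat (real p))"
  have "(\<Sum>i<p * k. ?d i * X i) = (\<Sum>i<k. ?d i * X i) + (\<Sum>i=k..<2 * k. ?d i * X i)"
    by (rule split) (simp add: d)
  also have "(\<Sum>i<k. ?d i * X i) = (\<Sum>i<k. X i) / real k"
    unfolding sum_divide_distrib by (rule sum.cong) (simp_all add: d)
  also have "(\<Sum>i=k..<2 * k. ?d i * X i) = - ((\<Sum>i=k..<2 * k. X i) / real k)"
    unfolding sum_divide_distrib sum_negf[symmetric] by (rule sum.cong) (simp_all add: d)
  finally show "(\<Sum>i<p * k. ?d i * X i) = (2 * (\<Sum>i<k. X i) - (\<Sum>i<2 * k. X i)) / real k"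
    unfolding two by (simp add: diff_divide_distrib add_divide_distrib)
  have "(\<Sum>i<p * k. (?d i)\<^sup>2) = (\<Sum>i<k. (?d i)\<^sup>2) + (\<Sum>i=k..<2 * k. (?d i)\<^sup>2)"
    by (rule split) (simp add: d)
  also have "(\<Sum>i<k. (?d i)\<^sup>2) = (\<Sum>i<k. (1 / real k)\<^sup>2)"
    by (rule sum.cong) (simp_all add: d)
  also have "(\<Sum>i=k..<2 * k. (?d i)\<^sup>2) = (\<Sum>i=k..<2 * k. (1 / real k)\<^sup>2)"
    by (rule sum.cong) (simp_all add: d)
  finally show "(\<Sum>i<p * k. (?d i)\<^sup>2) = 2 / real k"
    using k by (simp add: power2_eq_square field_simps)
qed

text \<open>By the shift formula, the event for \<open>B\<close> has the probability of the event for
  \<open>B + t \<phi>\<close>, weighted by a density that is bounded uniformly in \<open>t \<in> [0,1]\<close>. For each path, at most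
  two of the events with \<open>t = 1/J, 2/J, \<dots>, 1\<close> occur, so the probability is of order \<open>1/J\<close>.\<close>

lemma AE_barrier_min_nonzero:
  assumes B: "standard_brownian_motion M B"
  shows "AE \<omega> in M. barrier_min c a q (B \<omega>) \<noteq> 0"
proof -
  interpret prob_space M using B by (simp add: standard_brownian_motion_def)
  have B_cont: "continuous_on {0..1} (B \<omega>)" if "\<omega> \<in> space M" for \<omega>
    using B that by (simp add: standard_brownian_motion_def)
  have B_meas: "(\<lambda>\<omega>. B \<omega> t) \<in> borel_measurable M" if "t \<in> {0..1}" for t
    using B that by (simp add: standard_brownian_motion_def)
  \<comment> \<open>The bound 2 serves \<open>sum_hat_incr\<close>; the other three are what
    \<open>hat_barrier_neg\<close> asks for.\<close>
  obtain p :: nat where p: "max 2 (max (2 / a) (max (2 / \<theta>) (16 * \<zeta> * Kb / (a * c)))) < real p"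
    using reals_Archimedean2 by blast
  then have p2: "2 \<le> p" and pr: "0 < real p" by linarith+
  define \<phi> where "\<phi> = hat (real p)"
  have \<phi>_cont: "continuous_on {0..1} \<phi>" unfolding \<phi>_def by (rule hat_cont)
  have neg: "barrier c \<phi> s < 0" if "s \<in> {a..q}" for s
    unfolding \<phi>_def by (rule hat_barrier_neg[OF pr _ _ _ that]) (use p pr a \<theta>_pos in \<open>auto simp: field_simps\<close>)
  \<comment> \<open>\<open>B\<close> starts at 0 only almost surely, whereas interpolation from
    increments always does; recentring makes the convergence below hold at every sample
    point.\<close>
  define b where "b \<omega> t = B \<omega> t - B \<omega> 0" for \<omega> t
  have b_cont: "continuous_on {0..1} (b \<omega>)" if "\<omega> \<in> space M" for \<omega>
    unfolding b_def by (intro continuous_intros B_cont that)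
  define G where "G t \<omega> = barrier_min c a q (\<lambda>s. b \<omega> s + t * \<phi> s)" for t \<omega>
  \<comment> \<open>The Wiener integral of the derivative of \<open>\<phi>\<close>, which is
    \<open>p\<close> and then \<open>- p\<close> on the two flanks of the hat. Half the integral of
    the squared derivative is \<open>p\<close>, which explains the second term in
    \<open>D\<close>.\<close>
  define \<xi> where "\<xi> \<omega> = real p * (2 * B \<omega> (1 / real p) - B \<omega> (2 / real p) - B \<omega> 0)" for \<omega>
  define D where "D t \<omega> = exp (- (t * \<xi> \<omega> + t\<^sup>2 * real p))" for t \<omega>
  have \<xi>_meas[measurable]: "\<xi> \<in> borel_measurable M"
    unfolding \<xi>_def using p2 by (intro borel_measurable_times borel_measurable_diff borel_measurable_const B_meas) auto
  have D_meas[measurable]: "D t \<in> borel_measurable M" for t unfolding D_def by measurable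
  \<comment> \<open>Multiples of \<open>p\<close>, so that the kinks of the hat are grid
    points.\<close>
  define n where "n k = p * Suc k" for k
  have n1: "1 \<le> n k" for k using p2 by (simp add: n_def)
  define X where "X k t \<omega> = (\<lambda>i\<in>{..<n k}. grid_incr (n k) (B \<omega>) i + t * grid_incr (n k) \<phi> i)" for k t \<omega>
  have X_meas: "X k t \<in> M \<rightarrow>\<^sub>M PiM {..<n k} (\<lambda>_. borel)" for k t
    unfolding X_def by (rule grid_incr_measurable[OF B n1])
  define H where "H k t \<omega> = barrier_min c a q (interp (n k) (X k t \<omega>))" for k t \<omega>
  have H_meas[measurable]: "H k t \<in> borel_measurable M" for k t
    unfolding H_def by (rule measurable_compose[OF X_meas borel_measurable_barrier_min_interp])
  have n_top: "filterlim n at_top sequentially"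
  proof (rule filterlim_at_top_mono[OF filterlim_ident], intro always_eventually allI)
    fix k
    have "1 * Suc k \<le> p * Suc k" using p2 by (intro mult_right_mono) auto
    then show "k \<le> n k" by (simp add: n_def)
  qed
  have H_lim: "(\<lambda>k. H k t \<omega>) \<longlonglongrightarrow> G t \<omega>" if w: "\<omega> \<in> space M" for t \<omega>
  proof -
    have cont: "continuous_on {0..1} (\<lambda>s. b \<omega> s + t * \<phi> s)" by (intro continuous_intros b_cont[OF w] \<phi>_cont)
    have eq: "interp (n k) (X k t \<omega>) = interp (n k) (grid_incr (n k) (\<lambda>s. b \<omega> s + t * \<phi> s))" for k
      by (rule interp_cong) (simp add: X_def grid_incr_def b_def algebra_simps)
    have "b \<omega> 0 + t * \<phi> 0 = 0" by (simp add: b_def \<phi>_def hat_def)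
    from uniform_limit_interp[OF cont this n_top]
    show ?thesis unfolding H_def G_def eq by (rule tendsto_barrier_min) (auto intro: interp_cont cont)
  qed
  have G_meas[measurable]: "G t \<in> borel_measurable M" for t
    by (rule borel_measurable_LIMSEQ_real[OF H_lim H_meas])
  have exponent: "real (n k) * (\<Sum>i<n k. t * grid_incr (n k) \<phi> i * grid_incr (n k) (B \<omega>) i)
      + real (n k) * (\<Sum>i<n k. (t * grid_incr (n k) \<phi> i)\<^sup>2) / 2 = t * \<xi> \<omega> + t\<^sup>2 * real p" for k t \<omega>
  proof -
    have tele: "(\<Sum>i<m. grid_incr (n k) (B \<omega>) i) = B \<omega> (real m / real (n k)) - B \<omega> 0" for m
    proof -
      have "(\<Sum>i<m. grid_incr (n k) (B \<omega>) i) = B \<omega> (real m / real (n k)) - B \<omega> (real 0 / real (n k))"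
        unfolding grid_incr_def by (rule sum_lessThan_telescope)
      then show ?thesis by simp
    qed
    have rn: "real (n k) = real p * real (Suc k)" unfolding n_def by (rule of_nat_mult)
    have "real (2 * Suc k) = 2 * real (Suc k)" by (simp only: of_nat_mult of_nat_numeral)
    then have frac: "real (Suc k) / real (n k) = 1 / real p" "real (2 * Suc k) / real (n k) = 2 / real p"
      using pr by (simp_all add: rn del: of_nat_Suc mult_Suc_right)
    have "(\<Sum>i<n k. t * grid_incr (n k) \<phi> i * grid_incr (n k) (B \<omega>) i)
        = t * (\<Sum>i<n k. grid_incr (n k) \<phi> i * grid_incr (n k) (B \<omega>) i)" by (simp add: sum_distrib_left mult.assoc)
    also have "\<dots> = t * ((2 * (B \<omega> (1 / real p) - B \<omega> 0) - (B \<omega> (2 / real p) - B \<omega> 0)) / real (Suc k))"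
      unfolding \<phi>_def using sum_hat_incr(1)[OF p2, of "Suc k" "grid_incr (n k) (B \<omega>)"]
      by (simp only: n_def[symmetric] tele frac)
    finally have 1: "real (n k) * (\<Sum>i<n k. t * grid_incr (n k) \<phi> i * grid_incr (n k) (B \<omega>) i) = t * \<xi> \<omega>"
      by (simp add: rn \<xi>_def del: of_nat_Suc)
    have "(\<Sum>i<n k. (grid_incr (n k) \<phi> i)\<^sup>2) = 2 / real (Suc k)"
      unfolding n_def \<phi>_def by (rule sum_hat_incr(2)[OF p2]) simp
    then have "(\<Sum>i<n k. (t * grid_incr (n k) \<phi> i)\<^sup>2) = t\<^sup>2 * (2 / real (Suc k))"
      by (simp only: power_mult_distrib sum_distrib_left[symmetric])
    then have 2: "real (n k) * (\<Sum>i<n k. (t * grid_incr (n k) \<phi> i)\<^sup>2) / 2 = t\<^sup>2 * real p"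
      by (simp add: rn del: of_nat_Suc)
    show ?thesis unfolding 1 2 ..
  qed
  have shift: "(\<integral>\<^sup>+\<omega>. ennreal (g (H k 0 \<omega>)) \<partial>M) = (\<integral>\<^sup>+\<omega>. ennreal (g (H k t \<omega>) * D t \<omega>) \<partial>M)"
    if g: "g \<in> borel_measurable borel" "\<And>y. 0 \<le> g y" for g k t
  proof -
    have f: "(\<lambda>x. ennreal (g (barrier_min c a q (interp (n k) x)))) \<in> borel_measurable (PiM {..<n k} (\<lambda>_. borel))"
      by (intro measurable_compose[OF measurable_compose[OF borel_measurable_barrier_min_interp g(1)]]) measurable
    show ?thesis
      using brownian_grid_shift[OF B n1 f, of "\<lambda>i. t * grid_incr (n k) \<phi> i"] g(2)
      by (simp add: exponent H_def X_def D_def ennreal_mult)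
  qed
  \<comment> \<open>The constant test function 1 in the shift formula shows that \<open>D t\<close>
    has total mass 1.\<close>
  have D_int: "integrable M (D t)" for t
  proof (rule integrableI_nonneg)
    have "(\<integral>\<^sup>+\<omega>. ennreal (D t \<omega>) \<partial>M) = (\<integral>\<^sup>+\<omega>. 1 \<partial>M)" using shift[of "\<lambda>_. 1" 0 t] by simp
    then show "(\<integral>\<^sup>+\<omega>. ennreal (D t \<omega>) \<partial>M) < \<infinity>" by (simp add: emeasure_space_1)
  qed (auto simp: D_def)
  \<comment> \<open>Refinement of the grid: the weight stays fixed while the interpolated
    functionals converge, so \<open>D t\<close> is a dominating function.\<close>
  have shift_lim: "(\<integral>\<omega>. g (G 0 \<omega>) \<partial>M) = (\<integral>\<omega>. g (G t \<omega>) * D t \<omega> \<partial>M)"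
    if g: "continuous_on UNIV g" "\<And>y. 0 \<le> g y" "\<And>y. g y \<le> 1" for g t
  proof (rule LIMSEQ_unique)
    have gm[measurable]: "g \<in> borel_measurable borel" by (rule borel_measurable_continuous_onI[OF g(1)])
    have gl: "(\<lambda>k. g (H k t \<omega>)) \<longlonglongrightarrow> g (G t \<omega>)" if "\<omega> \<in> space M" for t \<omega>
      by (rule continuous_on_tendsto_compose[OF g(1) H_lim[OF that]]) auto
    show "(\<lambda>k. \<integral>\<omega>. g (H k 0 \<omega>) \<partial>M) \<longlonglongrightarrow> (\<integral>\<omega>. g (G 0 \<omega>) \<partial>M)"
      by (rule integral_dominated_convergence[where w="\<lambda>_. 1"]) (use g gl in auto)
    have "(\<lambda>k. \<integral>\<omega>. g (H k t \<omega>) * D t \<omega> \<partial>M) \<longlonglongrightarrow> (\<integral>\<omega>. g (G t \<omega>) * D t \<omega> \<partial>M)"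
    proof (rule integral_dominated_convergence[where w="D t"])
      show "AE \<omega> in M. (\<lambda>k. g (H k t \<omega>) * D t \<omega>) \<longlonglongrightarrow> g (G t \<omega>) * D t \<omega>"
        using gl by (intro AE_I2 tendsto_intros) auto
      show "AE \<omega> in M. norm (g (H k t \<omega>) * D t \<omega>) \<le> D t \<omega>" for k
        using g by (auto simp: D_def abs_mult intro!: mult_left_le_one_le)
    qed (use D_int in auto)
    moreover have "(\<integral>\<omega>. g (H k 0 \<omega>) \<partial>M) = (\<integral>\<omega>. g (H k t \<omega>) * D t \<omega> \<partial>M)" for k
      using shift[OF gm g(2), of k t] g(2) by (simp add: integral_eq_nn_integral D_def)
    ultimately show "(\<lambda>k. \<integral>\<omega>. g (H k 0 \<omega>) \<partial>M) \<longlonglongrightarrow> (\<integral>\<omega>. g (G t \<omega>) * D t \<omega> \<partial>M)" by simp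
  qed
  define I where "I t \<omega> = (if G t \<omega> = 0 then 1 else 0 :: real)" for t \<omega>
  have I_meas[measurable]: "I t \<in> borel_measurable M" for t unfolding I_def by measurable
  have I_shift: "(\<integral>\<omega>. I 0 \<omega> \<partial>M) = (\<integral>\<omega>. I t \<omega> * D t \<omega> \<partial>M)" for t
  proof (rule LIMSEQ_unique)
    \<comment> \<open>Tents decreasing to the indicator of the point 0, because
      \<open>shift_lim\<close> is available for continuous functions only.\<close>
    let ?g = "\<lambda>m y. max 0 (1 - real m * \<bar>y\<bar>)"
    have gm: "continuous_on UNIV (?g m)" for m by (intro continuous_intros)
    have gm'[measurable]: "?g m \<in> borel_measurable borel" for m by measurable
    have gl: "(\<lambda>m. ?g m (G t \<omega>)) \<longlonglongrightarrow> I t \<omega>" for t \<omega>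
    proof (cases "G t \<omega> = 0")
      case False
      obtain m0 :: nat where m0: "1 / \<bar>G t \<omega>\<bar> < real m0" using reals_Archimedean2 by blast
      have "\<forall>\<^sub>F m in sequentially. ?g m (G t \<omega>) = I t \<omega>"
        using eventually_ge_at_top[of m0]
      proof eventually_elim
        case (elim m)
        then have "1 / \<bar>G t \<omega>\<bar> < real m" using m0 by linarith
        then show ?case using False by (simp add: I_def field_simps)
      qed
      then show ?thesis by (rule tendsto_eventually)
    qed (simp add: I_def)
    show "(\<lambda>m. \<integral>\<omega>. ?g m (G 0 \<omega>) \<partial>M) \<longlonglongrightarrow> (\<integral>\<omega>. I 0 \<omega> \<partial>M)"
      by (rule integral_dominated_convergence[where w="\<lambda>_. 1"]) (use gl in auto)
    have "(\<lambda>m. \<integral>\<omega>. ?g m (G t \<omega>) * D t \<omega> \<partial>M) \<longlonglongrightarrow> (\<integral>\<omega>. I t \<omega> * D t \<omega> \<partial>M)"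
    proof (rule integral_dominated_convergence[where w="D t"])
      show "AE \<omega> in M. (\<lambda>m. ?g m (G t \<omega>) * D t \<omega>) \<longlonglongrightarrow> I t \<omega> * D t \<omega>"
        using gl by (intro AE_I2 tendsto_intros) auto
      show "AE \<omega> in M. norm (?g m (G t \<omega>) * D t \<omega>) \<le> D t \<omega>" for m
        by (auto simp: D_def abs_mult intro!: mult_left_le_one_le)
    qed (use D_int in auto)
    then show "(\<lambda>m. \<integral>\<omega>. ?g m (G 0 \<omega>) \<partial>M) \<longlonglongrightarrow> (\<integral>\<omega>. I t \<omega> * D t \<omega> \<partial>M)"
      by (subst shift_lim[OF gm, of _ t]) auto
  qed
  \<comment> \<open>Dominates all densities with \<open>t\<close> in the unit interval. Its two
    terms are \<open>exp p\<close> times \<open>D (- 1)\<close> and \<open>D 1\<close>, so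
    integrability is inherited without computing exponential moments.\<close>
  define W where "W \<omega> = exp (\<xi> \<omega>) + exp (- \<xi> \<omega>)" for \<omega>
  have W_int: "integrable M W"
  proof -
    have "W = (\<lambda>\<omega>. exp (real p) * D (- 1) \<omega> + exp (real p) * D 1 \<omega>)"
      by (simp add: fun_eq_iff W_def D_def flip: exp_add)
    moreover have "integrable M (\<lambda>\<omega>. exp (real p) * D (- 1) \<omega> + exp (real p) * D 1 \<omega>)"
      by (intro Bochner_Integration.integrable_add integrable_mult_right D_int)
    ultimately show ?thesis by simp
  qed
  have D_le: "D t \<omega> \<le> W \<omega>" if "0 \<le> t" "t \<le> 1" for t \<omega>
  proof -
    have "\<bar>t * \<xi> \<omega>\<bar> \<le> \<bar>\<xi> \<omega>\<bar>" using that by (simp add: abs_mult mult_left_le_one_le)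
    moreover have "0 \<le> t\<^sup>2 * real p" by simp
    ultimately have "- (t * \<xi> \<omega> + t\<^sup>2 * real p) \<le> \<bar>\<xi> \<omega>\<bar>" by linarith
    then have "D t \<omega> \<le> exp \<bar>\<xi> \<omega>\<bar>" by (simp add: D_def)
    also have "\<dots> \<le> W \<omega>" by (simp add: W_def abs_if)
    finally show ?thesis .
  qed
  have W_pos: "0 \<le> W \<omega>" for \<omega> by (simp add: W_def add_nonneg_nonneg)
  have few: "(\<Sum>j=1..J. I (real j / real J) \<omega>) \<le> 2" if J: "1 \<le> J" and w: "\<omega> \<in> space M" for J \<omega>
  proof -
    define S where "S = {j \<in> {1..J}. G (real j / real J) \<omega> = 0}"
    have fin: "finite S" by (simp add: S_def)
    have "(\<Sum>j=1..J. I (real j / real J) \<omega>) = real (card S)"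
      unfolding I_def S_def by (simp add: sum.If_cases Int_def)
    moreover have "card S \<le> 2"
    proof (rule ccontr)
      assume "\<not> card S \<le> 2"
      then have S3: "2 < card S" by simp
      then have ne: "S \<noteq> {}" by auto
      have "card {Min S, Max S} \<le> 2" by (simp add: card_insert_if)
      then have "\<not> S \<subseteq> {Min S, Max S}" using S3 card_mono[of "{Min S, Max S}" S] by auto
      \<comment> \<open>A third element lies strictly between the minimum and the maximum and yields
        three ordered zeros.\<close>
      then obtain j where j: "j \<in> S" "j \<noteq> Min S" "j \<noteq> Max S" by blast
      have "Min S < j" "j < Max S" using j fin by (auto simp: order.not_eq_order_implies_strict)
      moreover have "Min S \<in> S" "Max S \<in> S" using fin ne by auto
      ultimately show False
        using barrier_min_no_three_zeros[OF b_cont[OF w] \<phi>_cont neg,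
            of "real (Min S) / real J" "real j / real J" "real (Max S) / real J"] j J
        by (auto simp: S_def G_def divide_strict_right_mono)
    qed
    ultimately show ?thesis by simp
  qed
  have bound: "real J * (\<integral>\<omega>. I 0 \<omega> \<partial>M) \<le> 2 * (\<integral>\<omega>. W \<omega> \<partial>M)" if J: "1 \<le> J" for J
  proof -
    have IW: "integrable M (\<lambda>\<omega>. I t \<omega> * W \<omega>)" for t
      by (rule Bochner_Integration.integrable_bound[OF W_int]) (use W_pos W_int in \<open>auto simp: I_def\<close>)
    have ID: "integrable M (\<lambda>\<omega>. I t \<omega> * D t \<omega>)" for t
      by (rule Bochner_Integration.integrable_bound[OF D_int[of t]]) (auto simp: I_def)
    \<comment> \<open>The same probability is written once for each of the \<open>J\<close>
      shifts.\<close>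
    have "real J * (\<integral>\<omega>. I 0 \<omega> \<partial>M) = (\<Sum>j=1..J. \<integral>\<omega>. I (real j / real J) \<omega> * D (real j / real J) \<omega> \<partial>M)"
      using I_shift by simp
    also have "\<dots> \<le> (\<Sum>j=1..J. \<integral>\<omega>. I (real j / real J) \<omega> * W \<omega> \<partial>M)"
    proof (rule sum_mono)
      fix j assume "j \<in> {1..J}"
      then have "0 \<le> real j / real J" "real j / real J \<le> 1" by auto
      then show "(\<integral>\<omega>. I (real j / real J) \<omega> * D (real j / real J) \<omega> \<partial>M) \<le> (\<integral>\<omega>. I (real j / real J) \<omega> * W \<omega> \<partial>M)"
        by (intro integral_mono ID IW mult_left_mono D_le) (auto simp: I_def)
    qed
    also have "\<dots> = (\<integral>\<omega>. (\<Sum>j=1..J. I (real j / real J) \<omega>) * W \<omega> \<partial>M)"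
      using IW by (simp add: sum_distrib_right)
    also have "\<dots> \<le> (\<integral>\<omega>. 2 * W \<omega> \<partial>M)"
    proof (rule integral_mono)
      show "integrable M (\<lambda>\<omega>. (\<Sum>j=1..J. I (real j / real J) \<omega>) * W \<omega>)"
        using IW by (simp add: sum_distrib_right)
    qed (use few[OF J] W_int W_pos in \<open>auto intro!: mult_right_mono\<close>)
    finally show ?thesis by simp
  qed
  have I0: "(\<integral>\<omega>. I 0 \<omega> \<partial>M) \<le> 0"
  proof (rule ccontr)
    assume "\<not> ?thesis"
    then have pos: "0 < (\<integral>\<omega>. I 0 \<omega> \<partial>M)" by simp
    obtain J :: nat where J: "2 * (\<integral>\<omega>. W \<omega> \<partial>M) / (\<integral>\<omega>. I 0 \<omega> \<partial>M) < real J" using reals_Archimedean2 by blast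
    have "2 * (\<integral>\<omega>. W \<omega> \<partial>M) < real J * (\<integral>\<omega>. I 0 \<omega> \<partial>M)" using J pos by (simp add: field_simps)
    moreover have "0 \<le> (\<integral>\<omega>. W \<omega> \<partial>M)" using W_pos by simp
    ultimately show False using bound[of J] by (cases "J = 0") auto
  qed
  have I_nonneg: "0 \<le> I 0 \<omega>" for \<omega> by (simp add: I_def)
  have "integrable M (I 0)" by (rule integrable_const_bound[of _ 1]) (auto simp: I_def)
  moreover have "0 \<le> (\<integral>\<omega>. I 0 \<omega> \<partial>M)" by (rule Bochner_Integration.integral_nonneg) (rule I_nonneg)
  then have "(\<integral>\<omega>. I 0 \<omega> \<partial>M) = 0" using I0 by simp
  ultimately have "AE \<omega> in M. I 0 \<omega> = 0" using I_nonneg by (subst (asm) integral_nonneg_eq_0_iff_AE) auto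
  moreover have "AE \<omega> in M. B \<omega> 0 = 0" using B by (simp add: standard_brownian_motion_def)
  ultimately show ?thesis
  proof eventually_elim
    case (elim \<omega>)
    then have "(\<lambda>s. b \<omega> s + 0 * \<phi> s) = B \<omega>" by (auto simp: b_def)
    then show ?case using elim(1) by (auto simp: I_def G_def split: if_splits)
  qed
qed

end

end

section \<open>First passage\<close>

lemma first_passage_le: "s \<in> {\<kappa>..1} \<Longrightarrow> v s < c \<Longrightarrow> first_passage \<kappa> c v \<le> s"
  unfolding first_passage_def by (auto intro!: cInf_lower bdd_belowI[of _ \<kappa>])

text \<open>The condition \<open>t \<le> 1\<close> accounts for the convention that the passage time
  is 1 when the level is never crossed.\<close>

lemma first_passage_ge:
  assumes "t \<le> 1" "\<And>s. s \<in> {\<kappa>..1} \<Longrightarrow> s < t \<Longrightarrow> c \<le> v s"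
  shows "t \<le> first_passage \<kappa> c v"
proof (cases "\<exists>s\<in>{\<kappa>..1}. v s < c")
  case True
  then have "t \<le> Inf {s\<in>{\<kappa>..1}. v s < c}"
    using assms by (intro cInf_greatest) (auto simp: not_less[symmetric])
  then show ?thesis using True by (simp add: first_passage_def)
next
  case False
  then show ?thesis unfolding first_passage_def using assms(1) by simp
qed

lemma first_passage_bounds:
  assumes "\<kappa> \<le> 1" shows "first_passage \<kappa> c v \<in> {\<kappa>..1}"
proof -
  have "\<kappa> \<le> first_passage \<kappa> c v" by (rule first_passage_ge) (use assms in auto)
  moreover have "first_passage \<kappa> c v \<le> 1"
  proof (cases "\<exists>s\<in>{\<kappa>..1}. v s < c")
    case True
    then obtain s where "s \<in> {\<kappa>..1}" "v s < c" by blast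
    then show ?thesis using first_passage_le[of s \<kappa> v c] by auto
  qed (simp add: first_passage_def)
  ultimately show ?thesis by simp
qed

lemma first_passage_less_ex:
  assumes "first_passage \<kappa> c v < t" "t \<le> 1"
  shows "\<exists>s\<in>{\<kappa>..1}. s < t \<and> v s < c"
  using first_passage_ge[OF assms(2), of \<kappa> c v] assms(1) by (meson not_le)

text \<open>A strict crossing soon after the passage time survives small perturbations, and on the
  compact interval up to just before it a path strictly above the level keeps a positive distance
  from it. The perturbed \<open>x\<close> is arbitrary, so step paths are allowed.\<close>

lemma first_passage_stable:
  assumes \<kappa>: "\<kappa> < 1" and V: "continuous_on {\<kappa>..1} V"
    and above: "\<And>s. s \<in> {\<kappa>..1} \<Longrightarrow> s < first_passage \<kappa> c V \<Longrightarrow> c < V s" and e: "0 < e"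
  obtains d where "0 < d"
    "\<And>x. (\<And>s. s \<in> {\<kappa>..1} \<Longrightarrow> \<bar>x s - V s\<bar> < d) \<Longrightarrow> \<bar>first_passage \<kappa> c x - first_passage \<kappa> c V\<bar> < e"
proof -
  let ?\<tau> = "first_passage \<kappa> c V"
  have bounds: "first_passage \<kappa> c x \<in> {\<kappa>..1}" for x using first_passage_bounds \<kappa> by simp
  have upper: "\<exists>d>0. \<forall>x. (\<forall>s\<in>{\<kappa>..1}. \<bar>x s - V s\<bar> < d) \<longrightarrow> first_passage \<kappa> c x < ?\<tau> + e"
  proof (cases "?\<tau> < 1")
    case True
    obtain s where s: "s \<in> {\<kappa>..1}" "s < min 1 (?\<tau> + e)" "V s < c"
      using first_passage_less_ex[of \<kappa> c V "min 1 (?\<tau> + e)"] True e by auto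
    have "first_passage \<kappa> c x < ?\<tau> + e" if x: "\<forall>s\<in>{\<kappa>..1}. \<bar>x s - V s\<bar> < c - V s'" "s' = s" for x s'
    proof -
      have "\<bar>x s - V s\<bar> < c - V s" using x s by auto
      then have "x s < c" by linarith
      then show ?thesis using first_passage_le[of s \<kappa> x c] s by auto
    qed
    then show ?thesis using s by (intro exI[of _ "c - V s"]) auto
  next
    case False
    have "first_passage \<kappa> c x < ?\<tau> + e" for x using bounds[of x] bounds[of V] False e by auto
    then show ?thesis by (intro exI[of _ 1]) auto
  qed
  have lower: "\<exists>d>0. \<forall>x. (\<forall>s\<in>{\<kappa>..1}. \<bar>x s - V s\<bar> < d) \<longrightarrow> ?\<tau> - e < first_passage \<kappa> c x"
  \<comment> \<open>If there is no room before \<open>?\<tau> - e/2\<close>, nothing can pass too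
    early, since no passage time is below \<open>\<kappa>\<close>.\<close>
  proof (cases "\<kappa> \<le> ?\<tau> - e/2")
    case True
    let ?t = "?\<tau> - e/2"
    have sub: "{\<kappa>..?t} \<subseteq> {\<kappa>..1}" using bounds[of V] e by auto
    obtain s0 where s0: "s0 \<in> {\<kappa>..?t}" "\<And>s. s \<in> {\<kappa>..?t} \<Longrightarrow> V s0 \<le> V s"
      using continuous_attains_inf[OF compact_Icc _ continuous_on_subset[OF V sub]] True by auto
    have pos: "0 < V s0 - c" using above[of s0] s0(1) sub e by auto
    have "?\<tau> - e < first_passage \<kappa> c x" if x: "\<forall>s\<in>{\<kappa>..1}. \<bar>x s - V s\<bar> < V s0 - c" for x
    proof -
      have "?t \<le> first_passage \<kappa> c x"
      proof (rule first_passage_ge)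
        show "?t \<le> 1" using bounds[of V] e by auto
        fix s assume s: "s \<in> {\<kappa>..1}" "s < ?t"
        then have "V s0 \<le> V s" using s0(2)[of s] by auto
        moreover have "\<bar>x s - V s\<bar> < V s0 - c" using x s by blast
        ultimately show "c \<le> x s" by linarith
      qed
      then show ?thesis using e by linarith
    qed
    then show ?thesis using pos by blast
  next
    case False
    have "?\<tau> - e < first_passage \<kappa> c x" for x using bounds[of x] False e by auto
    then show ?thesis by (intro exI[of _ 1]) auto
  qed
  obtain d1 d2 where d: "d1 > 0" "d2 > 0"
    and d1: "\<And>x. (\<forall>s\<in>{\<kappa>..1}. \<bar>x s - V s\<bar> < d1) \<Longrightarrow> first_passage \<kappa> c x < ?\<tau> + e"
    and d2: "\<And>x. (\<forall>s\<in>{\<kappa>..1}. \<bar>x s - V s\<bar> < d2) \<Longrightarrow> ?\<tau> - e < first_passage \<kappa> c x"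
    using upper lower by metis
  show ?thesis
  proof (rule that[of "min d1 d2"])
    fix x assume "\<And>s. s \<in> {\<kappa>..1} \<Longrightarrow> \<bar>x s - V s\<bar> < min d1 d2"
    then have "first_passage \<kappa> c x < ?\<tau> + e" "?\<tau> - e < first_passage \<kappa> c x" using d1[of x] d2[of x] by auto
    then show "\<bar>first_passage \<kappa> c x - ?\<tau>\<bar> < e" by linarith
  qed (use d in simp)
qed

text \<open>By continuity from the right, a crossing before \<open>t\<close> can be moved to a
  rational time, which leaves a countable union of events.\<close>

lemma borel_measurable_first_passage:
  fixes V :: "'a \<Rightarrow> real \<Rightarrow> real"
  assumes \<kappa>: "\<kappa> < 1" and V: "\<And>\<omega>. \<omega> \<in> space M \<Longrightarrow> continuous_on {\<kappa>..1} (V \<omega>)"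
    and meas: "\<And>s. s \<in> {\<kappa>..1} \<Longrightarrow> (\<lambda>\<omega>. V \<omega> s) \<in> borel_measurable M"
  shows "(\<lambda>\<omega>. first_passage \<kappa> c (V \<omega>)) \<in> borel_measurable M"
proof (rule borel_measurableI_less)
  fix t :: real
  show "{\<omega> \<in> space M. first_passage \<kappa> c (V \<omega>) < t} \<in> sets M"
  proof (cases "t \<le> 1")
    case True
    have "{\<omega> \<in> space M. first_passage \<kappa> c (V \<omega>) < t}
      = (\<Union>r\<in>{r \<in> \<rat>. \<kappa> \<le> r \<and> r < t}. {\<omega> \<in> space M. V \<omega> r < c})" (is "?L = ?R")
    proof
      show "?R \<subseteq> ?L"
      proof
        fix \<omega> assume "\<omega> \<in> ?R"
        then obtain r where r: "\<kappa> \<le> r" "r < t" "\<omega> \<in> space M" "V \<omega> r < c" by blast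
        then have "first_passage \<kappa> c (V \<omega>) \<le> r" using True by (intro first_passage_le) auto
        then show "\<omega> \<in> ?L" using r by auto
      qed
      show "?L \<subseteq> ?R"
      proof
        fix \<omega> assume "\<omega> \<in> ?L"
        then have w: "\<omega> \<in> space M" "first_passage \<kappa> c (V \<omega>) < t" by auto
        obtain s where s: "s \<in> {\<kappa>..1}" "s < t" "V \<omega> s < c"
          using first_passage_less_ex[OF w(2) True] by blast
        have "(V \<omega> \<longlongrightarrow> V \<omega> s) (at s within {\<kappa>..1})"
          using V[OF w(1)] s by (auto simp: continuous_on_def)
        then have "(V \<omega> \<longlongrightarrow> V \<omega> s) (at s within {s..1})"
          by (rule tendsto_within_subset) (use s in auto)
        then have "(V \<omega> \<longlongrightarrow> V \<omega> s) (at_right s)" using s True by (simp add: at_within_Icc_at_right)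
        then have "\<forall>\<^sub>F x in at_right s. V \<omega> x < c" by (rule order_tendstoD) (rule s(3))
        then obtain y where y: "y > s" "\<And>x. s < x \<Longrightarrow> x < y \<Longrightarrow> V \<omega> x < c"
          unfolding eventually_at_right_field by blast
        obtain r where r: "r \<in> \<rat>" "s < r" "r < min y t" using Rats_dense_in_real[of s "min y t"] y s by auto
        then show "\<omega> \<in> ?R" using y(2)[of r] s w by auto
      qed
    qed
    moreover have "?R \<in> sets M"
    proof (rule sets.countable_UN')
      show "countable {r \<in> \<rat>. \<kappa> \<le> r \<and> r < t}" by (rule countable_subset[OF _ countable_rat]) auto
      have "{\<omega> \<in> space M. V \<omega> r < c} \<in> sets M" if "r \<in> {\<kappa>..1}" for r
        using meas[OF that] by simp
      then show "(\<lambda>r. {\<omega> \<in> space M. V \<omega> r < c}) ` {r \<in> \<rat>. \<kappa> \<le> r \<and> r < t} \<subseteq> sets M"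
        using True by auto
    qed
    ultimately show ?thesis by simp
  next
    case False
    have "first_passage \<kappa> c (V \<omega>) < t" for \<omega> using first_passage_bounds[of \<kappa> c "V \<omega>"] \<kappa> False by auto
    then show ?thesis by simp
  qed
qed

text \<open>Each value \<open>w n\<close> is held from \<open>n / N\<close> up to
  \<open>(n + 1) / N\<close>, so a step path passes at grid points and the two times agree, up to
  the start: the discrete search begins at \<open>k / N\<close>, the continuous one at
  \<open>\<kappa>\<close>, less than one cell later.\<close>

lemma monitor_time_first_passage:
  assumes N: "1 \<le> N" and \<kappa>: "0 < \<kappa>" "\<kappa> < 1" and k: "k = nat \<lfloor>\<kappa> * real N\<rfloor>"
    and step: "\<And>s. 0 \<le> s \<Longrightarrow> v s = w (nat \<lfloor>real N * s\<rfloor>)"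
  shows "\<bar>real (monitor_time k N c v) / real N - first_passage \<kappa> c v\<bar> \<le> 1 / real N"
proof -
  have \<kappa>N: "0 \<le> \<kappa> * real N" "\<kappa> * real N \<le> real N" using \<kappa> by (auto intro: mult_left_le_one_le)
  have kk: "real k \<le> \<kappa> * real N" "\<kappa> * real N < real k + 1" using \<kappa>N unfolding k by linarith+
  have kN: "k \<le> N" using kk \<kappa>N by linarith
  have vw: "v (real n / real N) = w n" for n using step[of "real n / real N"] N by simp
  have floor_ge: "k \<le> nat \<lfloor>real N * s\<rfloor>" if "\<kappa> \<le> s" for s
    unfolding k using mult_right_mono[OF that, of "real N"] by (intro nat_mono floor_mono) (simp add: mult.commute)
  have floor_less: "nat \<lfloor>real N * s\<rfloor> < n" if "0 \<le> s" "s < real n / real N" for s n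
  proof -
    have "real N * s < real n" using that N by (simp add: field_simps)
    moreover have "0 \<le> real N * s" using that by simp
    ultimately show ?thesis by linarith
  qed
  show ?thesis
  proof (cases "\<exists>n\<in>{k..N}. w n < c")
    case True
    define m where "m = Min {n\<in>{k..N}. w n < c}"
    have ne: "{n\<in>{k..N}. w n < c} \<noteq> {}" using True by blast
    have "m \<in> {n\<in>{k..N}. w n < c}" unfolding m_def by (rule Min_in[OF _ ne]) simp
    then have m: "k \<le> m" "m \<le> N" "w m < c" by auto
    have min: "c \<le> w n" if "k \<le> n" "n < m" for n
    proof (rule ccontr)
      assume "\<not> c \<le> w n"
      then have "m \<le> n" unfolding m_def by (intro Min_le) (use that m in auto)
      then show False using that by simp
    qed
    have mt: "monitor_time k N c v = m" using True by (simp add: monitor_time_def vw m_def)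
    show ?thesis
    \<comment> \<open>Detection at the very first index is the only source of a discrepancy: the
      passage time is then \<open>\<kappa>\<close>, not \<open>k / N\<close>.\<close>
    proof (cases "m = k")
      case True
      have "v \<kappa> = w k" using step[of \<kappa>] \<kappa> k by (simp add: mult.commute)
      then have "first_passage \<kappa> c v \<le> \<kappa>" using m True \<kappa> by (intro first_passage_le) auto
      then have "first_passage \<kappa> c v = \<kappa>" using first_passage_bounds[of \<kappa> c v] \<kappa> by auto
      moreover have "real k / real N \<le> \<kappa>" "\<kappa> \<le> (real k + 1) / real N"
        using kk N by (simp_all add: pos_divide_le_eq pos_le_divide_eq)
      ultimately show ?thesis unfolding mt True add_divide_distrib by linarith
    next
      case False
      then have "real k + 1 \<le> real m" using m by linarith
      then have "\<kappa> * real N \<le> real m" using kk by linarith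
      then have mN: "real m / real N \<in> {\<kappa>..1}" using m N by (simp add: pos_le_divide_eq)
      have "first_passage \<kappa> c v \<le> real m / real N" by (rule first_passage_le[OF mN]) (simp add: vw m)
      moreover have "real m / real N \<le> first_passage \<kappa> c v"
      proof (rule first_passage_ge)
        fix s assume s: "s \<in> {\<kappa>..1}" "s < real m / real N"
        then have "0 \<le> s" using \<kappa> by auto
        then show "c \<le> v s" using min[OF floor_ge floor_less] s step by auto
      qed (use mN in simp)
      ultimately show ?thesis unfolding mt by simp
    qed
  next
    case False
    have "c \<le> v s" if s: "s \<in> {\<kappa>..1}" for s
    proof -
      have "nat \<lfloor>real N * s\<rfloor> \<le> nat \<lfloor>real N * 1\<rfloor>" using s by (intro nat_mono floor_mono mult_left_mono) auto
      then have "nat \<lfloor>real N * s\<rfloor> \<in> {k..N}" using floor_ge[of s] s by auto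
      then have "c \<le> w (nat \<lfloor>real N * s\<rfloor>)" using False by (meson not_less)
      then show ?thesis using step[of s] s \<kappa> by auto
    qed
    then have "\<not> (\<exists>s\<in>{\<kappa>..1}. v s < c)" by (meson not_less)
    then have "first_passage \<kappa> c v = 1" unfolding first_passage_def by (rule if_not_P)
    moreover have "monitor_time k N c v = N" using False by (simp add: monitor_time_def vw)
    ultimately show ?thesis using N by simp
  qed
qed

lemma measurable_monitor_time:
  assumes "\<And>n. (\<lambda>\<omega>. v \<omega> (real n / real N)) \<in> borel_measurable M"
  shows "(\<lambda>\<omega>. real (monitor_time k N c (v \<omega>))) \<in> borel_measurable M"
proof -
  let ?w = "\<lambda>n \<omega>. v \<omega> (real n / real N)"
  have P[measurable]: "Measurable.pred M (\<lambda>\<omega>. ?w n \<omega> < c)" for n using assms[of n] by measurable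
  \<comment> \<open>The value \<open>N\<close> has two sources: a first detection at the last index
    and no detection at all.\<close>
  have eq: "monitor_time k N c (v \<omega>) = m \<longleftrightarrow>
      (k \<le> m \<and> m \<le> N \<and> ?w m \<omega> < c \<and> (\<forall>n\<in>{k..<m}. \<not> ?w n \<omega> < c)) \<or> (m = N \<and> (\<forall>n\<in>{k..N}. \<not> ?w n \<omega> < c))" for m \<omega>
  proof (cases "\<exists>n\<in>{k..N}. ?w n \<omega> < c")
    case True
    let ?A = "{n\<in>{k..N}. ?w n \<omega> < c}"
    have A: "finite ?A" "?A \<noteq> {}" using True by auto
    have "monitor_time k N c (v \<omega>) = Min ?A" using True by (simp add: monitor_time_def)
    moreover have "Min ?A = m \<longleftrightarrow> k \<le> m \<and> m \<le> N \<and> ?w m \<omega> < c \<and> (\<forall>n\<in>{k..<m}. \<not> ?w n \<omega> < c)"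
      by (subst Min_eq_iff[OF A]) (force simp: not_less)
    ultimately show ?thesis using True by auto
  next
    case False
    then show ?thesis by (auto simp: monitor_time_def)
  qed
  have "(\<lambda>\<omega>. monitor_time k N c (v \<omega>)) \<in> measurable M (count_space UNIV)"
  proof (rule measurable_count_space_eq2_countable[THEN iffD2], intro conjI ballI)
    fix m
    have "{\<omega> \<in> space M. monitor_time k N c (v \<omega>) = m} \<in> sets M" unfolding eq by measurable
    moreover have "(\<lambda>\<omega>. monitor_time k N c (v \<omega>)) -` {m} \<inter> space M = {\<omega> \<in> space M. monitor_time k N c (v \<omega>) = m}" by auto
    ultimately show "(\<lambda>\<omega>. monitor_time k N c (v \<omega>)) -` {m} \<inter> space M \<in> sets M" by simp
  qed auto
  then show ?thesis by measurable
qed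

section \<open>The monitoring process as a random element\<close>

text \<open>\<open>U_process\<close> without its case distinction: at \<open>n = 0\<close> division
  by zero gives 0, the prescribed value on the first cell. This exhibits the process as a step
  path.\<close>

definition U_value :: "(real \<Rightarrow> real) \<Rightarrow> real \<Rightarrow> (nat \<Rightarrow> real) \<Rightarrow> nat \<Rightarrow> real" where
  "U_value K h y n = ((\<Sum>i=1..n. (\<Sum>j=1..i. y j)\<^sup>2 * scaled_kernel K h (real i - real n)) / real n ^ 3) /
        ((\<Sum>j=1..n. (y j)\<^sup>2) / real n ^ 2)"

lemma U_process_step:
  assumes "0 \<le> s" shows "U_process K h N y s = U_value K h y (nat \<lfloor>real N * s\<rfloor>)"
proof (cases "s < 1 / real N")
  case True
  then have "0 < real N" using assms by (cases "N = 0") auto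
  then have "real N * s < 1" using True by (simp add: field_simps)
  moreover have "0 \<le> real N * s" using assms by simp
  ultimately have "nat \<lfloor>real N * s\<rfloor> = 0" by linarith
  then show ?thesis using True by (simp add: U_process_def U_value_def)
qed (simp add: U_process_def U_value_def Let_def)

context monitoring
begin

lemma change_point_series_obs:
  "(\<lambda>i. change_point_series \<theta> \<eta> u N i \<omega>) = obs N \<eta> (\<lambda>j. u j \<omega>)"
  by (simp add: change_point_series_def obs_def fun_eq_iff)

lemma U_limit_measurable:
  assumes cont: "\<And>\<omega>. \<omega> \<in> space M \<Longrightarrow> continuous_on {0..1} (B \<omega>)"
    and meas: "\<And>t. t \<in> {0..1} \<Longrightarrow> (\<lambda>\<omega>. B \<omega> t) \<in> borel_measurable M" and s: "s \<in> {0..1}"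
  shows "(\<lambda>\<omega>. U_limit K \<zeta> \<theta> (B \<omega>) s) \<in> borel_measurable M"
proof -
  have A: "(\<lambda>\<omega>. path_int \<theta> (B \<omega>) r) \<in> borel_measurable M" if r: "r \<in> {0..1}" for r
    unfolding path_int_def
    by (rule borel_measurable_path_integral)
      (use r \<theta>_pos in \<open>auto intro!: meas continuous_on_subset[OF cont]\<close>)
  have "(\<lambda>\<omega>. lim_num K \<zeta> \<theta> (B \<omega>) s) \<in> borel_measurable M" unfolding lim_num_def
  proof (rule borel_measurable_path_integral)
    fix \<omega> assume w: "\<omega> \<in> space M"
    obtain C where C: "\<And>t. t \<in> {0..1} \<Longrightarrow> \<bar>B \<omega> t\<bar> \<le> C" using path_bounded[OF cont[OF w]] by blast
    show "continuous_on {0..s} (\<lambda>r. (path_int \<theta> (B \<omega>) r)\<^sup>2 * K (\<zeta> * (r - s)))"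
      by (rule continuous_on_subset[OF num_integrand_cont[OF cont[OF w] C]]) (use s in auto)
  next
    fix r assume "r \<in> {0..s}"
    then show "(\<lambda>\<omega>. (path_int \<theta> (B \<omega>) r)\<^sup>2 * K (\<zeta> * (r - s))) \<in> borel_measurable M"
      using s by (intro borel_measurable_times borel_measurable_power borel_measurable_const A) auto
  qed (use s in auto)
  moreover have "(\<lambda>\<omega>. lim_den \<theta> (B \<omega>) s) \<in> borel_measurable M" unfolding lim_den_def
  proof (rule borel_measurable_path_integral)
    fix \<omega> assume "\<omega> \<in> space M"
    from cont[OF this] have "continuous_on {0..min s \<theta>} (B \<omega>)" by (rule continuous_on_subset) (use s in auto)
    then show "continuous_on {0..min s \<theta>} (\<lambda>t. (B \<omega> t)\<^sup>2)" by (intro continuous_intros)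
  qed (use s \<theta>_pos in \<open>auto intro!: borel_measurable_power meas\<close>)
  ultimately show ?thesis
    unfolding U_limit_eq by measurable
qed

text \<open>A zero denominator forces the path to vanish up to \<open>min s \<theta>\<close>. Its
  increment from 0 to that time has a normal density, so the value there is almost surely
  nonzero.\<close>

lemma AE_lim_den_pos:
  assumes B: "standard_brownian_motion M B" and s: "0 < s" "s \<le> 1"
  shows "AE \<omega> in M. 0 < lim_den \<theta> (B \<omega>) s"
proof -
  define \<delta> where "\<delta> = min s \<theta>"
  have \<delta>: "0 < \<delta>" "\<delta> \<le> 1" using s \<theta>_pos by (auto simp: \<delta>_def)
  let ?X = "\<lambda>\<omega>. B \<omega> \<delta> - B \<omega> 0"
  have dist: "distributed M lborel ?X (normal_density 0 (sqrt (\<delta> - 0)))"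
    using B \<delta> unfolding standard_brownian_motion_def by blast
  then have X: "?X \<in> M \<rightarrow>\<^sub>M lborel" and eq: "distr M lborel ?X = gauss (sqrt (\<delta> - 0))"
    by (auto simp: distributed_def)
  have "AE x in gauss (sqrt (\<delta> - 0)). x \<noteq> 0"
    using AE_lborel_singleton[of "0::real"] by (subst AE_density) auto
  then have "AE x in distr M lborel ?X. x \<noteq> 0" unfolding eq .
  then have "AE \<omega> in M. ?X \<omega> \<noteq> 0" by (rule AE_distrD[OF X])
  moreover have "AE \<omega> in M. B \<omega> 0 = 0" using B by (simp add: standard_brownian_motion_def)
  ultimately show ?thesis using AE_space
  proof eventually_elim
    case (elim \<omega>)
    have cont: "continuous_on {0..1} (B \<omega>)" using B elim by (simp add: standard_brownian_motion_def)
    obtain C where C: "\<And>t. t \<in> {0..1} \<Longrightarrow> \<bar>B \<omega> t\<bar> \<le> C" using path_bounded[OF cont] by blast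
    have "lim_den \<theta> (B \<omega>) s \<noteq> 0"
    proof
      assume "lim_den \<theta> (B \<omega>) s = 0"
      then have "integral {0..\<delta>} (\<lambda>t. (B \<omega> t)\<^sup>2) = 0" by (simp add: lim_den_def \<delta>_def)
      moreover have "continuous_on {0..\<delta>} (\<lambda>t. (B \<omega> t)\<^sup>2)"
        by (rule continuous_on_subset[OF sq_cont[OF cont C]]) (use \<delta> in auto)
      ultimately have "\<forall>t\<in>{0..\<delta>}. (B \<omega> t)\<^sup>2 = 0" using \<delta> by (subst (asm) integral_eq_0_iff) auto
      then have "B \<omega> \<delta> = 0" using \<delta> by auto
      then show False using elim by simp
    qed
    moreover have "0 \<le> lim_den \<theta> (B \<omega>) s" by (rule lim_den_nonneg[OF cont C]) (use s in auto)
    ultimately show ?case by simp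
  qed
qed

text \<open>The null set must be chosen before the path, and the passage time depends on the path. A
  zero minimum on \<open>{\<kappa>..q}\<close> is therefore excluded for all rational
  \<open>q\<close> at once, and a rational between \<open>s\<close> and the passage time is picked
  afterwards.\<close>

lemma AE_above_before_first_passage:
  assumes B: "standard_brownian_motion M B" and \<kappa>: "0 < \<kappa>" "\<kappa> < 1" and c: "0 < c"
  shows "AE \<omega> in M. \<forall>s\<in>{\<kappa>..1}. s < first_passage \<kappa> c (U_limit K \<zeta> \<theta> (B \<omega>)) \<longrightarrow> c < U_limit K \<zeta> \<theta> (B \<omega>) s"
proof -
  have "countable ({q \<in> \<rat>. \<kappa> \<le> q \<and> q \<le> 1} :: real set)"
    by (rule countable_subset[OF _ countable_rat]) auto
  then have "AE \<omega> in M. \<forall>q\<in>{q \<in> \<rat>. \<kappa> \<le> q \<and> q \<le> 1}. barrier_min c \<kappa> q (B \<omega>) \<noteq> 0"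
    by (subst AE_ball_countable) (use AE_barrier_min_nonzero[OF c \<kappa>(1) _ _ B] in auto)
  then show ?thesis using AE_lim_den_pos[OF B \<kappa>(1) less_imp_le[OF \<kappa>(2)]] AE_space
  proof eventually_elim
    case (elim \<omega>)
    let ?V = "U_limit K \<zeta> \<theta> (B \<omega>)" and ?\<tau> = "first_passage \<kappa> c (U_limit K \<zeta> \<theta> (B \<omega>))"
    have cont: "continuous_on {0..1} (B \<omega>)" using B elim by (simp add: standard_brownian_motion_def)
    obtain C where C: "\<And>t. t \<in> {0..1} \<Longrightarrow> \<bar>B \<omega> t\<bar> \<le> C" using path_bounded[OF cont] by blast
    have barrier: "barrier c (B \<omega>) r = (?V r - c) * lim_den \<theta> (B \<omega>) r" "0 < lim_den \<theta> (B \<omega>) r"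
      if r: "r \<in> {\<kappa>..1}" for r
    proof -
      have "lim_den \<theta> (B \<omega>) \<kappa> \<le> lim_den \<theta> (B \<omega>) r" by (rule lim_den_mono[OF cont C]) (use r \<kappa> in auto)
      then show pos: "0 < lim_den \<theta> (B \<omega>) r" using elim by auto
      show "barrier c (B \<omega>) r = (?V r - c) * lim_den \<theta> (B \<omega>) r"
        unfolding barrier_def U_limit_eq using pos by (simp add: left_diff_distrib)
    qed
    show ?case
    proof (intro ballI impI)
      fix s assume s: "s \<in> {\<kappa>..1}" "s < ?\<tau>"
      obtain q where q: "q \<in> \<rat>" "s < q" "q < ?\<tau>" using Rats_dense_in_real[OF s(2)] by blast
      have q1: "\<kappa> \<le> q" "q \<le> 1" using q s first_passage_bounds[of \<kappa> c ?V] \<kappa> by auto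
      obtain r where r: "r \<in> {\<kappa>..q}" "barrier_min c \<kappa> q (B \<omega>) = barrier c (B \<omega>) r"
        "\<And>s. s \<in> {\<kappa>..q} \<Longrightarrow> barrier c (B \<omega>) r \<le> barrier c (B \<omega>) s"
        using barrier_min_attained[OF c \<kappa>(1) q1 cont] by blast
      \<comment> \<open>Before the passage time the barrier is nonnegative, so its minimum, being
        nonzero, is positive.\<close>
      have "c \<le> ?V r" using first_passage_le[of r \<kappa> ?V c] r q q1 by force
      then have "0 \<le> barrier c (B \<omega>) r" using barrier[of r] r q1 by auto
      moreover have "barrier c (B \<omega>) r \<noteq> 0" using elim(1) q q1 r(2) by auto
      ultimately have "0 < barrier c (B \<omega>) s" using r(3)[of s] s q by auto
      then show "c < ?V s" using barrier[OF s(1)] by (simp add: zero_less_mult_iff)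
    qed
  qed
qed

text \<open>\<open>d\<close> and \<open>N0\<close> depend on the limit path but not on the sample
  point, as \<open>skorohod_extended_mapping\<close> requires. They are read off from a uniform
  limit along a filter on pairs.\<close>

lemma U_process_near:
  fixes u :: "nat \<Rightarrow> 'a \<Rightarrow> real"
  defines "S \<equiv> \<lambda>N \<omega> s. (\<Sum>i=1..nat \<lfloor>real N * s\<rfloor>. u i \<omega>) / sqrt (real N)"
    and "r \<equiv> \<lambda>N \<omega>. \<bar>u 0 \<omega>\<bar> / sqrt (real N) + (\<Sum>j=1..N. (u j \<omega>)\<^sup>2) / (real N)\<^sup>2"
  assumes h: "\<And>n. 1 \<le> n \<Longrightarrow> h n > 0" "(\<lambda>n. real n / h n) \<longlonglongrightarrow> \<zeta>"
    and x: "continuous_on {0..1} x" and \<kappa>: "0 < \<kappa>" "\<kappa> \<le> 1" and pos: "0 < lim_den \<theta> x \<kappa>" and e: "0 < e"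
  shows "\<exists>d>0. \<exists>N0. \<forall>N\<ge>N0. \<forall>\<omega>.
    skorohod_dist 0 1 (restrict (S N \<omega>) {0..1}) (restrict x {0..1}) < d \<longrightarrow> r N \<omega> < d \<longrightarrow>
    (\<forall>s\<in>{\<kappa>..1}. \<bar>U_process K (h N) N (obs N \<eta> (\<lambda>j. u j \<omega>)) s - U_limit K \<zeta> \<theta> x s\<bar> < e)"
proof -
  interpret Metric_space "skorohod_space 0 1" "skorohod_dist 0 1" by (rule Metric_space_skorohod)
  let ?d = "\<lambda>N \<omega>. skorohod_dist 0 1 (restrict (S N \<omega>) {0..1}) (restrict x {0..1})"
  \<comment> \<open>Small when the sample size is large, the walk is close to \<open>x\<close> and
    the remainder is small; \<open>F\<close> pulls the neighbourhoods of 0 back along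
    \<open>g\<close>. The 1 added to the sample size avoids division by zero.\<close>
  define g where "g p = 1 / (real (fst p) + 1) + ?d (fst p) (snd p) + r (fst p) (snd p)" for p :: "nat \<times> 'a"
  define F where "F = filtercomap g (nhds 0)"
  have r0: "0 \<le> \<bar>u 0 \<omega>\<bar> / sqrt (real N)" "0 \<le> (\<Sum>j=1..N. (u j \<omega>)\<^sup>2) / (real N)\<^sup>2" for N \<omega>
    by (auto intro!: divide_nonneg_nonneg sum_nonneg)
  have parts: "1 / (real N + 1) \<le> g (N, \<omega>)" "?d N \<omega> \<le> g (N, \<omega>)" "\<bar>r N \<omega>\<bar> \<le> g (N, \<omega>)" "0 \<le> g (N, \<omega>)" for N \<omega>
  proof -
    have "0 \<le> 1 / (real N + 1)" "0 \<le> ?d N \<omega>" "0 \<le> r N \<omega>" using r0[of \<omega> N] unfolding r_def by auto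
    then show "1 / (real N + 1) \<le> g (N, \<omega>)" "?d N \<omega> \<le> g (N, \<omega>)" "\<bar>r N \<omega>\<bar> \<le> g (N, \<omega>)" "0 \<le> g (N, \<omega>)"
      unfolding g_def by auto
  qed
  have evI: "eventually P F" if "0 < \<delta>" "\<And>N \<omega>. g (N, \<omega>) < \<delta> \<Longrightarrow> P (N, \<omega>)" for P \<delta>
    unfolding F_def eventually_filtercomap
  proof (intro exI[of _ "\<lambda>y. y < \<delta>"] conjI allI impI)
    show "\<forall>\<^sub>F y in nhds 0. y < \<delta>" using order_tendstoD(2)[OF filterlim_ident that(1)] .
  qed (use that(2) in auto)
  have evD: "\<exists>\<delta>>0. \<forall>N \<omega>. g (N, \<omega>) < \<delta> \<longrightarrow> P (N, \<omega>)" if ev: "eventually P F" for P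
  proof -
    obtain Q where Q: "eventually Q (nhds 0)" "\<And>p. Q (g p) \<Longrightarrow> P p"
      using ev unfolding F_def eventually_filtercomap by blast
    then obtain \<delta> where \<delta>: "\<delta> > 0" "\<And>y. dist y 0 < \<delta> \<Longrightarrow> Q y" unfolding eventually_nhds_metric by blast
    have "P (N, \<omega>)" if "g (N, \<omega>) < \<delta>" for N \<omega>
      using Q(2) \<delta>(2)[of "g (N, \<omega>)"] that parts(4)[of N \<omega>] by simp
    then show ?thesis using \<delta>(1) by blast
  qed
  have "uniform_limit {\<kappa>..1} (\<lambda>p. U_process K (h (fst p)) (fst p) (obs (fst p) \<eta> (\<lambda>j. u j (snd p)))) (U_limit K \<zeta> \<theta> x) F"
  proof (rule U_process_uniform_limit[OF _ h x _ _ _ _ \<kappa> pos])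
    show "filterlim fst at_top F" unfolding filterlim_at_top
    proof
      fix Z :: nat
      show "\<forall>\<^sub>F p in F. Z \<le> fst p"
      proof (rule evI[of "1 / (real Z + 1)"])
        fix N \<omega> assume "g (N, \<omega>) < 1 / (real Z + 1)"
        then have "1 / (real N + 1) < 1 / (real Z + 1)" using parts(1)[of N \<omega>] by linarith
        then show "Z \<le> fst (N, \<omega>)" by (simp add: field_simps)
      qed simp
    qed
    fix e :: real assume e: "0 < e"
    obtain \<delta> where \<delta>: "0 < \<delta>" "\<And>f t. f \<in> skorohod_space 0 1 \<Longrightarrow> skorohod_dist 0 1 f (restrict x {0..1}) < \<delta> \<Longrightarrow>
        t \<in> {0..1} \<Longrightarrow> \<bar>f t - restrict x {0..1} t\<bar> < e"
    proof (rule skorohod_dist_less_imp_uniform[OF continuous_in_skorohod_space[OF x] _ e])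
      show "continuous_on {0..1} (restrict x {0..1})" by (rule continuous_on_eq[OF x]) simp
    qed blast
    show "\<forall>\<^sub>F p in F. \<forall>s\<in>{0..1}. \<bar>(\<Sum>j=1..nat \<lfloor>real (fst p) * s\<rfloor>. u j (snd p)) / sqrt (real (fst p)) - x s\<bar> \<le> e"
    proof (rule evI[OF \<delta>(1)])
      fix N \<omega> assume "g (N, \<omega>) < \<delta>"
      then have d: "?d N \<omega> < \<delta>" using parts(2)[of N \<omega>] by linarith
      have "restrict (S N \<omega>) {0..1} \<in> skorohod_space 0 1" unfolding S_def
        using step_in_skorohod_space[of "real N" "\<lambda>n. (\<Sum>i=1..n. u i \<omega>) / sqrt (real N)"] by simp
      from \<delta>(2)[OF this d] show "\<forall>s\<in>{0..1}. \<bar>(\<Sum>j=1..nat \<lfloor>real (fst (N, \<omega>)) * s\<rfloor>. u j (snd (N, \<omega>))) / sqrt (real (fst (N, \<omega>))) - x s\<bar> \<le> e"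
        by (auto simp: S_def less_imp_le)
    qed
  next
    show "((\<lambda>p. r (fst p) (snd p)) \<longlongrightarrow> 0) F"
    proof (rule tendstoI)
      fix e :: real assume e: "0 < e"
      show "\<forall>\<^sub>F p in F. dist (r (fst p) (snd p)) 0 < e"
      proof (rule evI[OF e])
        fix N \<omega> assume "g (N, \<omega>) < e"
        then show "dist (r (fst (N, \<omega>)) (snd (N, \<omega>))) 0 < e" using parts(3)[of N \<omega>] by simp
      qed
    qed
    show "\<forall>\<^sub>F p in F. \<bar>u 0 (snd p)\<bar> / sqrt (real (fst p)) \<le> r (fst p) (snd p)"
      "\<forall>\<^sub>F p in F. (\<Sum>j=1..fst p. (u j (snd p))\<^sup>2) / (real (fst p))\<^sup>2 \<le> r (fst p) (snd p)"
      unfolding r_def using r0 by (auto intro!: always_eventually add_increasing add_increasing2)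
  qed
  from evD[OF uniform_limitD[OF this e]]
  obtain \<delta> where \<delta>: "\<delta> > 0" and near: "\<And>N \<omega>. g (N, \<omega>) < \<delta> \<Longrightarrow>
      \<forall>s\<in>{\<kappa>..1}. dist (U_process K (h N) N (obs N \<eta> (\<lambda>j. u j \<omega>)) s) (U_limit K \<zeta> \<theta> x s) < e" by auto
  obtain N0 :: nat where N0: "3 / \<delta> < real N0" using reals_Archimedean2 by blast
  have "\<forall>s\<in>{\<kappa>..1}. \<bar>U_process K (h N) N (obs N \<eta> (\<lambda>j. u j \<omega>)) s - U_limit K \<zeta> \<theta> x s\<bar> < e"
    if N: "N \<ge> N0" and d: "?d N \<omega> < \<delta>/3" and r: "r N \<omega> < \<delta>/3" for N \<omega>
  proof -
    have "3 / \<delta> < real N + 1" using N N0 by linarith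
    then have "1 / (real N + 1) < \<delta>/3" using \<delta> by (simp add: field_simps)
    then have "g (N, \<omega>) < \<delta>" using d r unfolding g_def by simp
    from near[OF this] show ?thesis by (simp add: dist_real_def)
  qed
  then show ?thesis using \<delta> by (intro exI[of _ "\<delta>/3"] conjI exI[of _ N0]) auto
qed

end

text \<open>The covariance at lag zero, with vanishing mean, gives a constant second moment
  \<open>v\<close>. The sum of \<open>N\<close> squares divided by the square of \<open>N\<close>
  then has expectation \<open>v / N\<close>.\<close>

lemma weakly_stationary_remainder:
  fixes u :: "nat \<Rightarrow> 'a \<Rightarrow> real"
  assumes "prob_space M" and ws: "weakly_stationary M u" and mean: "\<And>n. (\<integral>\<omega>. u n \<omega> \<partial>M) = 0"
  defines "r \<equiv> \<lambda>N \<omega>. \<bar>u 0 \<omega>\<bar> / sqrt (real N) + (\<Sum>j=1..N. (u j \<omega>)\<^sup>2) / (real N)\<^sup>2"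
  shows "integrable M (r N)" and "(\<lambda>N. \<integral>\<omega>. r N \<omega> \<partial>M) \<longlonglongrightarrow> 0"
proof -
  interpret prob_space M by fact
  have meas: "u n \<in> borel_measurable M" and sq: "integrable M (\<lambda>\<omega>. (u n \<omega>)\<^sup>2)" for n
    using ws by (auto simp: weakly_stationary_def)
  have int: "integrable M (u n)" for n by (rule square_integrable_imp_integrable[OF meas sq])
  show "integrable M (r N)" for N
    unfolding r_def using int sq by (intro Bochner_Integration.integrable_add integrable_divide_zero Bochner_Integration.integrable_sum integrable_abs) auto
  define v where "v = (\<integral>\<omega>. (u 0 \<omega>)\<^sup>2 \<partial>M)"
  have var: "(\<integral>\<omega>. (u n \<omega>)\<^sup>2 \<partial>M) = v" for n
  proof -
    have "covariance M (u n) (u (n + 0)) = covariance M (u 0) (u 0)"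
      using ws unfolding weakly_stationary_def by blast
    then show ?thesis by (simp add: covariance_def mean v_def power2_eq_square)
  qed
  have eq: "(\<integral>\<omega>. r N \<omega> \<partial>M) = (\<integral>\<omega>. \<bar>u 0 \<omega>\<bar> \<partial>M) * (1 / sqrt (real N)) + v * (1 / real N)" for N
  proof -
    have "(\<integral>\<omega>. r N \<omega> \<partial>M) = (\<integral>\<omega>. \<bar>u 0 \<omega>\<bar> / sqrt (real N) \<partial>M) + (\<integral>\<omega>. (\<Sum>j=1..N. (u j \<omega>)\<^sup>2) / (real N)\<^sup>2 \<partial>M)"
      unfolding r_def using int sq
      by (intro Bochner_Integration.integral_add integrable_divide_zero Bochner_Integration.integrable_sum integrable_abs) auto
    also have "(\<integral>\<omega>. (\<Sum>j=1..N. (u j \<omega>)\<^sup>2) / (real N)\<^sup>2 \<partial>M) = real N * v / (real N)\<^sup>2"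
      using sq by (simp add: Bochner_Integration.integral_sum var)
    finally show ?thesis by (simp add: power2_eq_square)
  qed
  have "(\<lambda>N. 1 / sqrt (real N)) \<longlonglongrightarrow> 0"
    by (rule tendsto_divide_0[OF tendsto_const filterlim_at_top_imp_at_infinity[OF
      filterlim_compose[OF sqrt_at_top filterlim_real_sequentially]]])
  then have "(\<lambda>N. (\<integral>\<omega>. \<bar>u 0 \<omega>\<bar> \<partial>M) * (1 / sqrt (real N)) + v * (1 / real N)) \<longlonglongrightarrow> (\<integral>\<omega>. \<bar>u 0 \<omega>\<bar> \<partial>M) * 0 + v * 0"
    by (intro tendsto_intros lim_1_over_n)
  then show "(\<lambda>N. \<integral>\<omega>. r N \<omega> \<partial>M) \<longlonglongrightarrow> 0" unfolding eq by simp
qed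

text \<open>The functions \<open>cts_step\<close> determine weak convergence on the real line. They
  are bounded and uniformly continuous, which suits
  \<open>skorohod_extended_mapping\<close>.\<close>

lemma conv_in_distI:
  assumes "prob_space M" "prob_space M'"
    and X: "\<And>N. X N \<in> borel_measurable M" and Z: "Z \<in> borel_measurable M'"
    and step: "\<And>x y. x < y \<Longrightarrow> (\<lambda>N. \<integral>\<omega>. cts_step x y (X N \<omega>) \<partial>M) \<longlonglongrightarrow> (\<integral>\<omega>. cts_step x y (Z \<omega>) \<partial>M')"
  shows "conv_in_dist M X M' Z"
  unfolding conv_in_dist_def
proof (intro conjI allI X Z, rule integral_cts_step_conv_imp_weak_conv)
  fix x y :: real assume xy: "x < y"
  have cm: "cts_step x y \<in> borel_measurable borel"
    by (rule borel_measurable_continuous_onI, rule uniformly_continuous_imp_continuous[OF cts_step_uniformly_continuous[OF xy]])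
  show "(\<lambda>N. integral\<^sup>L (distr M borel (X N)) (cts_step x y)) \<longlonglongrightarrow> integral\<^sup>L (distr M' borel Z) (cts_step x y)"
    using step[OF xy] X Z cm by (simp add: integral_distr)
qed (use assms in \<open>auto intro: prob_space.real_distribution_distr\<close>)

theorem theorem3p2:
  fixes M :: "'a measure" and u :: "nat \<Rightarrow> 'a \<Rightarrow> real"
    and M' :: "'b measure" and B :: "'b \<Rightarrow> real \<Rightarrow> real"
    and K :: "real \<Rightarrow> real" and h :: "nat \<Rightarrow> real"
    and \<zeta> \<theta> \<eta> \<kappa> c :: real
  assumes "prob_space M"
    and "standard_brownian_motion M' B"
    and "admissible_kernel K"
    and "\<And>N. N \<ge> 1 \<Longrightarrow> h N > 0"
    and "(\<lambda>N. real N / h N) \<longlonglongrightarrow> \<zeta>" and "\<zeta> \<ge> 1"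
    and "0 < \<theta>" and "\<theta> < 1" and "\<eta> > 0"
    and "weakly_stationary M u"
    and "\<And>n. (\<integral>\<omega>. u n \<omega> \<partial>M) = 0"
    and "I0_series M' B M u"
    and "weakly_stationary M (\<lambda>n \<omega>. (u n \<omega>)\<^sup>2)"
    and "(\<lambda>k. covariance M (\<lambda>\<omega>. (u 1 \<omega>)\<^sup>2) (\<lambda>\<omega>. (u (1 + k) \<omega>)\<^sup>2)) \<longlonglongrightarrow> 0"
    and "0 < \<kappa>" and "\<kappa> < 1"
  defines "U \<equiv> \<lambda>N \<omega>. U_process K (h N) N (\<lambda>i. change_point_series \<theta> \<eta> u N i \<omega>)"
  shows "weak_conv_D \<kappa> 1 M U M' (\<lambda>\<omega>. U_limit K \<zeta> \<theta> (B \<omega>)) \<and>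
    conv_in_dist
      M (\<lambda>N \<omega>. real (monitor_time (nat \<lfloor>\<kappa> * real N\<rfloor>) N c (U N \<omega>)) / real N)
      M' (\<lambda>\<omega>. first_passage \<kappa> c (U_limit K \<zeta> \<theta> (B \<omega>)))"
proof -
  note B = \<open>standard_brownian_motion M' B\<close>
  note \<kappa> = \<open>0 < \<kappa>\<close> \<open>\<kappa> < 1\<close>
  interpret M: prob_space M by fact
  interpret M': prob_space M' using B by (simp add: standard_brownian_motion_def)
  obtain L where K: "\<And>x. 0 \<le> K x" and L: "L-lipschitz_on UNIV K"
    using \<open>admissible_kernel K\<close> unfolding admissible_kernel_def by blast
  have "\<bar>K x - K y\<bar> \<le> L * \<bar>x - y\<bar>" for x y using lipschitz_onD[OF L, of x y] by (simp add: dist_real_def)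
  then interpret monitoring K L \<zeta> \<theta>
    using K \<open>\<zeta> \<ge> 1\<close> \<open>0 < \<theta>\<close> \<open>\<theta> < 1\<close> by unfold_locales auto
  obtain \<sigma> where \<sigma>: "\<sigma> > 0" and S: "weak_conv_D 0 1
        M (\<lambda>N \<omega> s. (\<Sum>i = 1..nat \<lfloor>real N * s\<rfloor>. u i \<omega>) / sqrt (real N))
        M' (\<lambda>\<omega> s. \<sigma> * B \<omega> s)"
    using \<open>I0_series M' B M u\<close> unfolding I0_series_def by blast
  have u_meas[measurable]: "u n \<in> borel_measurable M" for n
    using \<open>weakly_stationary M u\<close> by (simp add: weakly_stationary_def)
  have B_cont: "continuous_on {0..1} (B \<omega>)" if "\<omega> \<in> space M'" for \<omega>
    using B that by (simp add: standard_brownian_motion_def)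
  have B_meas: "(\<lambda>\<omega>. B \<omega> t) \<in> borel_measurable M'" if "t \<in> {0..1}" for t
    using B that by (simp add: standard_brownian_motion_def)
  have sub: "{\<kappa>..1} \<subseteq> {0<..1}" using \<kappa> by auto
  let ?V = "\<lambda>\<omega>. U_limit K \<zeta> \<theta> (B \<omega>)"
  have V_cont: "continuous_on {\<kappa>..1} (?V \<omega>)" and V_nonneg: "\<And>s. s \<in> {\<kappa>..1} \<Longrightarrow> 0 \<le> ?V \<omega> s" if w: "\<omega> \<in> space M'" for \<omega>
  proof -
    obtain C where C: "\<And>t. t \<in> {0..1} \<Longrightarrow> \<bar>B \<omega> t\<bar> \<le> C" using path_bounded[OF B_cont[OF w]] by blast
    show "continuous_on {\<kappa>..1} (?V \<omega>)" by (rule continuous_on_subset[OF U_limit_cont[OF B_cont[OF w] C] sub])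
    show "0 \<le> ?V \<omega> s" if "s \<in> {\<kappa>..1}" for s
      using U_limit_nonneg[OF B_cont[OF w] C, of s] that sub by blast
  qed
  have V_meas: "(\<lambda>\<omega>. ?V \<omega> s) \<in> borel_measurable M'" if "s \<in> {\<kappa>..1}" for s
    by (rule U_limit_measurable[OF B_cont B_meas]) (use that \<kappa> in auto)
  have U_obs: "U N \<omega> = U_process K (h N) N (obs N \<eta> (\<lambda>j. u j \<omega>))" for N \<omega>
    unfolding U_def change_point_series_obs ..
  define w where "w N n \<omega> = U_value K (h N) (obs N \<eta> (\<lambda>j. u j \<omega>)) n" for N n \<omega>
  have U_step: "U N \<omega> s = w N (nat \<lfloor>real N * s\<rfloor>) \<omega>" if "0 \<le> s" for N \<omega> s
    unfolding U_obs w_def by (rule U_process_step[OF that])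
  have w_meas[measurable]: "w N n \<in> borel_measurable M" for N n
  proof -
    have [measurable]: "(\<lambda>\<omega>. obs N \<eta> (\<lambda>j. u j \<omega>) i) \<in> borel_measurable M" for i
      unfolding obs_def by (cases "i < nat \<lfloor>real N * \<theta>\<rfloor>") simp_all
    show ?thesis unfolding w_def U_value_def by measurable
  qed
  have U_rest: "restrict (U N \<omega>) {\<kappa>..1} = restrict (\<lambda>s. w N (nat \<lfloor>real N * s\<rfloor>) \<omega>) {\<kappa>..1}" for N \<omega>
    using U_step \<kappa> by (auto simp: restrict_def fun_eq_iff)
  define r where "r N \<omega> = \<bar>u 0 \<omega>\<bar> / sqrt (real N) + (\<Sum>j=1..N. (u j \<omega>)\<^sup>2) / (real N)\<^sup>2" for N \<omega>
  have r_int: "integrable M (r N)" and r_lim: "(\<lambda>N. \<integral>\<omega>. r N \<omega> \<partial>M) \<longlonglongrightarrow> 0" for N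
    unfolding r_def
    using weakly_stationary_remainder[OF \<open>prob_space M\<close> \<open>weakly_stationary M u\<close> \<open>\<And>n. (\<integral>\<omega>. u n \<omega> \<partial>M) = 0\<close>] by blast+
  have r_nonneg: "0 \<le> r N \<omega>" for N \<omega>
    unfolding r_def by (intro add_nonneg_nonneg divide_nonneg_nonneg sum_nonneg) auto
  \<comment> \<open>Used twice over the same walk: for continuous functionals of \<open>U N\<close>
    and for step functions of the stopping time.\<close>
  note mapping = skorohod_extended_mapping[OF \<open>prob_space M\<close> M'.prob_space_axioms S _ _ _ _ r_int r_nonneg r_lim]
  let ?dist = "\<lambda>N \<omega> \<omega>'. skorohod_dist 0 1 (\<lambda>s\<in>{0..1}. (\<Sum>i=1..nat \<lfloor>real N * s\<rfloor>. u i \<omega>) / sqrt (real N)) (\<lambda>s\<in>{0..1}. \<sigma> * B \<omega>' s)"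
  have near: "\<exists>d>0. \<exists>N0. \<forall>N\<ge>N0. \<forall>\<omega>\<in>space M.
       ?dist N \<omega> \<omega>' < d \<longrightarrow>
       r N \<omega> < d \<longrightarrow> (\<forall>s\<in>{\<kappa>..1}. \<bar>U N \<omega> s - ?V \<omega>' s\<bar> < e)"
    if w: "\<omega>' \<in> space M'" and pos: "0 < lim_den \<theta> (B \<omega>') \<kappa>" and e: "0 < e" for \<omega>' e
  proof -
    have x: "continuous_on {0..1} (\<lambda>t. \<sigma> * B \<omega>' t)" by (intro continuous_intros B_cont w)
    have "lim_den \<theta> (\<lambda>t. \<sigma> * B \<omega>' t) \<kappa> = \<sigma>\<^sup>2 * lim_den \<theta> (B \<omega>') \<kappa>"
      unfolding lim_den_def by (simp add: power_mult_distrib)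
    then have "0 < lim_den \<theta> (\<lambda>t. \<sigma> * B \<omega>' t) \<kappa>" using pos \<sigma> by simp
    from U_process_near[OF \<open>\<And>N. N \<ge> 1 \<Longrightarrow> h N > 0\<close> \<open>(\<lambda>N. real N / h N) \<longlonglongrightarrow> \<zeta>\<close> x \<kappa>(1) less_imp_le[OF \<kappa>(2)] this e, of u \<eta>]
    obtain d N0 where "d > 0" "\<forall>N\<ge>N0. \<forall>\<omega>.
       ?dist N \<omega> \<omega>' < d \<longrightarrow>
       r N \<omega> < d \<longrightarrow> (\<forall>s\<in>{\<kappa>..1}. \<bar>U N \<omega> s - ?V \<omega>' s\<bar> < e)"
      unfolding U_obs r_def U_limit_scale[OF less_imp_neq[OF \<sigma>, symmetric]] by blast
    then show ?thesis by blast
  qed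
  have U_borel: "(\<lambda>\<omega>. restrict (U N \<omega>) {\<kappa>..1}) \<in> M \<rightarrow>\<^sub>M borel_of_topology (skorohod_topology \<kappa> 1)" for N
    unfolding U_rest by (rule measurable_step_skorohod) auto
  have V_borel: "(\<lambda>\<omega>. restrict (?V \<omega>) {\<kappa>..1}) \<in> M' \<rightarrow>\<^sub>M borel_of_topology (skorohod_topology \<kappa> 1)"
    by (rule measurable_skorohod_continuous[OF _ _ V_cont V_meas]) (use \<kappa> in auto)
  have U_in: "restrict (U N \<omega>) {\<kappa>..1} \<in> skorohod_space \<kappa> 1" for N \<omega>
    unfolding U_rest by (rule step_in_skorohod_space) simp
  have V_in: "restrict (?V \<omega>) {\<kappa>..1} \<in> skorohod_space \<kappa> 1" if "\<omega> \<in> space M'" for \<omega>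
    by (rule continuous_in_skorohod_space[OF V_cont[OF that]])
  have pos_AE: "AE \<omega> in M'. 0 < lim_den \<theta> (B \<omega>) \<kappa>"
    by (rule AE_lim_den_pos[OF B]) (use \<kappa> in auto)
  have conv_D: "weak_conv_D \<kappa> 1 M U M' ?V"
    unfolding weak_conv_D_def
  proof (intro conjI allI impI U_borel V_borel, elim conjE)
    fix \<phi> assume \<phi>: "continuous_map (skorohod_topology \<kappa> 1) euclideanreal \<phi>"
      and bdd: "bounded (\<phi> ` skorohod_space \<kappa> 1)"
    interpret D: Metric_space "skorohod_space \<kappa> 1" "skorohod_dist \<kappa> 1" by (rule Metric_space_skorohod)
    obtain C where C: "\<And>f. f \<in> skorohod_space \<kappa> 1 \<Longrightarrow> \<bar>\<phi> f\<bar> \<le> C"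
      using bdd unfolding bounded_iff by auto
    \<comment> \<open>The estimate needs continuity of \<open>\<phi>\<close> only at the limit path,
      where uniform closeness of \<open>U N\<close> implies Skorohod closeness.\<close>
    have \<phi>_dist: "\<exists>\<delta>>0. \<forall>f. f \<in> skorohod_space \<kappa> 1 \<and> skorohod_dist \<kappa> 1 a f < \<delta> \<longrightarrow> dist (\<phi> a) (\<phi> f) < e"
      if "a \<in> skorohod_space \<kappa> 1" "0 < e" for a e
      using \<phi> that D.metric_continuous_map[OF Met_TC.Metric_space_axioms, of \<phi>]
      unfolding skorohod_topology_def by simp
    show "(\<lambda>N. \<integral>\<omega>. \<phi> (restrict (U N \<omega>) {\<kappa>..1}) \<partial>M) \<longlonglongrightarrow> (\<integral>\<omega>. \<phi> (restrict (?V \<omega>) {\<kappa>..1}) \<partial>M')"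
    proof (rule mapping[where C=C])
      show "(\<lambda>\<omega>. \<phi> (restrict (U N \<omega>) {\<kappa>..1})) \<in> borel_measurable M" for N
        by (rule measurable_compose[OF U_borel continuous_map_measurable[OF \<phi>]])
      show "(\<lambda>\<omega>. \<phi> (restrict (?V \<omega>) {\<kappa>..1})) \<in> borel_measurable M'"
        by (rule measurable_compose[OF V_borel continuous_map_measurable[OF \<phi>]])
      show "AE \<omega>' in M'. \<forall>e>0. \<exists>d>0. \<exists>N0. \<forall>N\<ge>N0. \<forall>\<omega>\<in>space M.
        ?dist N \<omega> \<omega>' < d \<longrightarrow>
        r N \<omega> < d \<longrightarrow> \<bar>\<phi> (restrict (U N \<omega>) {\<kappa>..1}) - \<phi> (restrict (?V \<omega>') {\<kappa>..1})\<bar> < e"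
        using pos_AE AE_space
      proof eventually_elim
        case (elim \<omega>')
        show ?case
        proof (intro allI impI)
          fix e :: real assume e: "0 < e"
          obtain \<delta> where \<delta>: "\<delta> > 0" "\<And>f. f \<in> skorohod_space \<kappa> 1 \<Longrightarrow>
              skorohod_dist \<kappa> 1 (restrict (?V \<omega>') {\<kappa>..1}) f < \<delta> \<Longrightarrow> dist (\<phi> (restrict (?V \<omega>') {\<kappa>..1})) (\<phi> f) < e"
            using \<phi>_dist[OF V_in[OF elim(2)] e] by blast
          have close: "\<bar>\<phi> (restrict (U N \<omega>) {\<kappa>..1}) - \<phi> (restrict (?V \<omega>') {\<kappa>..1})\<bar> < e"
            if "\<forall>s\<in>{\<kappa>..1}. \<bar>U N \<omega> s - ?V \<omega>' s\<bar> < \<delta>/2" for N \<omega>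
          proof -
            have "skorohod_dist \<kappa> 1 (restrict (?V \<omega>') {\<kappa>..1}) (restrict (U N \<omega>) {\<kappa>..1}) \<le> \<delta>/2"
              by (rule skorohod_dist_le[OF V_in[OF elim(2)] U_in])
                 (use that \<delta>(1) in \<open>auto simp: abs_minus_commute less_imp_le\<close>)
            then show ?thesis using \<delta>(2)[OF U_in[of N \<omega>]] \<delta>(1) by (simp add: dist_real_def abs_minus_commute)
          qed
          have "0 < \<delta>/2" using \<delta>(1) by simp
          from near[OF elim(2,1) this] show "\<exists>d>0. \<exists>N0. \<forall>N\<ge>N0. \<forall>\<omega>\<in>space M.
            ?dist N \<omega> \<omega>' < d \<longrightarrow>
            r N \<omega> < d \<longrightarrow> \<bar>\<phi> (restrict (U N \<omega>) {\<kappa>..1}) - \<phi> (restrict (?V \<omega>') {\<kappa>..1})\<bar> < e"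
            using close by meson
        qed
      qed
    qed (use C U_in V_in in auto)
  qed
  let ?R = "\<lambda>N \<omega>. real (monitor_time (nat \<lfloor>\<kappa> * real N\<rfloor>) N c (U N \<omega>)) / real N"
  let ?T = "\<lambda>\<omega>. first_passage \<kappa> c (?V \<omega>)"
  have R_meas: "?R N \<in> borel_measurable M" for N
    by (intro borel_measurable_divide borel_measurable_const measurable_monitor_time)
      (simp add: U_step w_meas)
  have T_meas: "?T \<in> borel_measurable M'"
    by (rule borel_measurable_first_passage[OF \<kappa>(2) V_cont V_meas])
  have "conv_in_dist M ?R M' ?T"
  proof (rule conv_in_distI[OF \<open>prob_space M\<close> M'.prob_space_axioms R_meas T_meas])
    fix x y :: real assume xy: "x < y"
    have step01: "\<bar>cts_step x y z\<bar> \<le> 1" for z using xy by (auto simp: cts_step_def field_simps)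
    have step_uc: "uniformly_continuous_on UNIV (cts_step x y)" by (rule cts_step_uniformly_continuous[OF xy])
    then have step_meas: "cts_step x y \<in> borel_measurable borel"
      by (intro borel_measurable_continuous_onI uniformly_continuous_imp_continuous)
    show "(\<lambda>N. \<integral>\<omega>. cts_step x y (?R N \<omega>) \<partial>M) \<longlonglongrightarrow> (\<integral>\<omega>. cts_step x y (?T \<omega>) \<partial>M')"
    proof (cases "0 < c")
      case False
      have T1: "?T \<omega> = 1" if "\<omega> \<in> space M'" for \<omega>
        using V_nonneg[OF that] False by (force simp: first_passage_def)
      \<comment> \<open>\<open>N = 0\<close> is left out because the quotient is then 0 by division
        by zero; a single index does not affect the limit.\<close>
      have R1: "?R N \<omega> = 1" if N: "1 \<le> N" for N \<omega>
      proof -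
        have "0 \<le> scaled_kernel K (h N) z" for z
          using K \<open>\<And>N. N \<ge> 1 \<Longrightarrow> h N > 0\<close>[OF N] by (simp add: scaled_kernel_def less_imp_le)
        then have "0 \<le> w N n \<omega>" for n unfolding w_def U_value_def
          by (intro divide_nonneg_nonneg sum_nonneg mult_nonneg_nonneg) auto
        then have "\<not> U N \<omega> (real n / real N) < c" for n using False by (simp add: U_step not_less order_trans[of c 0])
        then show ?thesis using N by (simp add: monitor_time_def)
      qed
      have "\<forall>\<^sub>F N in sequentially. (\<integral>\<omega>. cts_step x y (?R N \<omega>) \<partial>M) = cts_step x y 1"
        using eventually_ge_at_top[of 1] by eventually_elim (simp add: R1 M.prob_space)
      moreover have "(\<integral>\<omega>. cts_step x y (?T \<omega>) \<partial>M') = cts_step x y 1"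
        by (simp add: T1 M'.prob_space cong: Bochner_Integration.integral_cong)
      ultimately show ?thesis by (simp add: tendsto_eventually)
    next
      case True
      show ?thesis
      proof (rule mapping[where C=1])
        show "(\<lambda>\<omega>. cts_step x y (?R N \<omega>)) \<in> borel_measurable M" for N
          by (rule measurable_compose[OF R_meas step_meas])
        show "(\<lambda>\<omega>. cts_step x y (?T \<omega>)) \<in> borel_measurable M'"
          by (rule measurable_compose[OF T_meas step_meas])
        show "AE \<omega>' in M'. \<forall>e>0. \<exists>d>0. \<exists>N0. \<forall>N\<ge>N0. \<forall>\<omega>\<in>space M.
          ?dist N \<omega> \<omega>' < d \<longrightarrow>
          r N \<omega> < d \<longrightarrow> \<bar>cts_step x y (?R N \<omega>) - cts_step x y (?T \<omega>')\<bar> < e"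
          using pos_AE AE_above_before_first_passage[OF B \<kappa> True] AE_space
        proof eventually_elim
          case (elim \<omega>')
          show ?case
          proof (intro allI impI)
            fix e :: real assume e: "0 < e"
            obtain \<delta> where \<delta>: "\<delta> > 0" "\<And>a b. dist b a < \<delta> \<Longrightarrow> dist (cts_step x y b) (cts_step x y a) < e"
              using step_uc e unfolding uniformly_continuous_on_def by blast
            have "0 < \<delta>/2" using \<delta>(1) by simp
            then obtain d1 where d1: "0 < d1" "\<And>v. (\<And>s. s \<in> {\<kappa>..1} \<Longrightarrow> \<bar>v s - ?V \<omega>' s\<bar> < d1) \<Longrightarrow>
                \<bar>first_passage \<kappa> c v - ?T \<omega>'\<bar> < \<delta>/2"
              using first_passage_stable[OF \<kappa>(2) V_cont[OF elim(3)]] elim(2) by metis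
            obtain d N0 where d: "d > 0" and N0: "\<And>N \<omega>. N \<ge> N0 \<Longrightarrow> \<omega> \<in> space M \<Longrightarrow>
              ?dist N \<omega> \<omega>' < d \<Longrightarrow>
              r N \<omega> < d \<Longrightarrow> \<forall>s\<in>{\<kappa>..1}. \<bar>U N \<omega> s - ?V \<omega>' s\<bar> < d1"
              using near[OF elim(3,1) d1(1)] by metis
            \<comment> \<open>Half of \<open>\<delta>\<close> absorbs the grid error
              \<open>1 / N\<close> of the discrete stopping time, the other half the difference
              between the passage times of \<open>U N\<close> and of the limit.\<close>
            obtain N1 :: nat where N1: "2 / \<delta> < real N1" using reals_Archimedean2 by blast
            show "\<exists>d>0. \<exists>N0. \<forall>N\<ge>N0. \<forall>\<omega>\<in>space M.
              ?dist N \<omega> \<omega>' < d \<longrightarrow>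
              r N \<omega> < d \<longrightarrow> \<bar>cts_step x y (?R N \<omega>) - cts_step x y (?T \<omega>')\<bar> < e"
            proof (intro exI[of _ d] exI[of _ "max 1 (max N0 N1)"] conjI d allI ballI impI)
              fix N \<omega> assume N: "max 1 (max N0 N1) \<le> N" and \<omega>: "\<omega> \<in> space M"
                and close: "?dist N \<omega> \<omega>' < d"
                  "r N \<omega> < d"
              have "\<bar>first_passage \<kappa> c (U N \<omega>) - ?T \<omega>'\<bar> < \<delta>/2"
                using N0[OF _ \<omega> close] N by (intro d1(2)) auto
              moreover have "\<bar>?R N \<omega> - first_passage \<kappa> c (U N \<omega>)\<bar> \<le> 1 / real N"
                by (rule monitor_time_first_passage[where w="\<lambda>n. w N n \<omega>", OF _ \<kappa> refl U_step]) (use N in auto)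
              moreover have "1 / real N < \<delta>/2"
              proof -
                have "2 / \<delta> < real N" using N N1 by linarith
                then show ?thesis using \<delta>(1) N by (simp add: field_simps)
              qed
              ultimately have "dist (?R N \<omega>) (?T \<omega>') < \<delta>" unfolding dist_real_def by linarith
              from \<delta>(2)[OF this] show "\<bar>cts_step x y (?R N \<omega>) - cts_step x y (?T \<omega>')\<bar> < e"
                by (simp add: dist_real_def)
            qed
          qed
        qed
      qed (use step01 in auto)
    qed
  qed
  with conv_D show ?thesis by blast
qed

end
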